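(* There exist positive absolute constants $C, c$ such that the following holds. Let $m$, $r < cm$ and $R \le m$ be positive integers with $R \ge C r \log (m/r)$. Then there exists an $R$-dimensional origin-symmetric convex polytope with $2m$ facets which has exactly $2^r \binom{m}{r}$ faces of dimension $R-r$ (the maximal possible number for such polytopes). Moreover, if $E$ is a random $R$-dimensional subspace of $\mathbb{R}^m$, then with probability at least $1 - e^{-cR}$ the section $E \cap [-1,1]^m$ of the cube is such a polytope.
   Context: Random $R$-dimensional subspaces of $\mathbb{R}^m$ are distributed according to the normalized Haar (rotation-invariant probability) measure on the Grassmannian $G_{m,R}$ of $R$-dimensional linear subspaces of $\mathbb{R}^m$. A facet of an $R$-dimensional polytope is a face of dimension $R-1$. Absolute constants do not depend on any parameter. *)

theory Defs
  imports "HOL-Analysis.Finite_Function_Topology" "HOL-Probability.Probability"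
begin

text \<open>
  The constants of the theorem must not depend on any dimension, so the dimensions are quantified
  inside the formula and cannot be types. All the spaces \<open>\<real>\<^sup>m\<close> are therefore
  realised inside the one real vector space \<^typ>\<open>(nat, real) poly_mapping\<close> of
  finitely supported real sequences.
\<close>

type_synonym rvec = "(nat, real) poly_mapping"

definition Rspace :: "nat \<Rightarrow> rvec set" where
  "Rspace m = {x. Poly_Mapping.keys x \<subseteq> {..<m}}"

definition dotp :: "rvec \<Rightarrow> rvec \<Rightarrow> real" where
  "dotp x y = (\<Sum>i\<in>Poly_Mapping.keys x. Poly_Mapping.lookup x i * Poly_Mapping.lookup y i)"

definition cube :: "nat \<Rightarrow> rvec set" where
  "cube m = {x \<in> Rspace m. \<forall>i<m. Poly_Mapping.lookup x i \<in> {-1..1}}"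

text \<open>
  The library's \<^const>\<open>aff_dim\<close> (hence also its facet relation) is restricted to class
  \<^class>\<open>euclidean_space\<close>. The following is the same notion for finite-dimensional
  sets in any real vector space; the agreement is proved below.
\<close>

definition affdim :: "'a::real_vector set \<Rightarrow> int" where
  "affdim S = (if S = {} then -1 else int (dim {x - y |x y. x \<in> S \<and> y \<in> S}))"

lemma affdim_eq_aff_dim: "affdim S = aff_dim S"
proof (cases "S = {}")
  case False
  then obtain a where a: "a \<in> S" by blast
  let ?D = "{x - y |x y. x \<in> S \<and> y \<in> S}" and ?T = "(+) (-a) ` S"
  have "?D \<subseteq> span ?T"
  proof safe
    fix x y assume "x \<in> S" "y \<in> S"
    then have "(-a + x) - (-a + y) \<in> span ?T"
      by (intro span_diff span_base) auto
    then show "x - y \<in> span ?T" by simp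
  qed
  then have "dim ?D \<le> dim ?T"
    using dim_subset[of ?D "span ?T"] by (simp only: dim_span)
  moreover have "?T \<subseteq> ?D"
  proof
    fix z assume "z \<in> ?T"
    then obtain x where "x \<in> S" "z = x - a" by auto
    then show "z \<in> ?D" using a by blast
  qed
  then have "dim ?T \<le> dim ?D" by (rule dim_subset)
  ultimately have "dim ?D = dim ?T" by (rule order_antisym)
  moreover have "aff_dim S = int (dim ?T)"
    using a by (intro aff_dim_eq_dim hull_inc)
  ultimately show ?thesis
    using False unfolding affdim_def by (simp only: if_False)
qed (simp add: affdim_def)

definition faces :: "'a::real_vector set \<Rightarrow> int \<Rightarrow> 'a set set" where
  "faces P k = {F. F face_of P \<and> affdim F = k}"

definition sym_polytope :: "nat \<Rightarrow> nat \<Rightarrow> 'a::real_vector set \<Rightarrow> bool" where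
  "sym_polytope R m P \<longleftrightarrow>
     polytope P \<and> affdim P = int R \<and> uminus ` P = P \<and> card (faces P (int R - 1)) = 2 * m"

definition Grassmannian :: "nat \<Rightarrow> nat \<Rightarrow> rvec set set" where
  "Grassmannian m R = {E. subspace E \<and> E \<subseteq> Rspace m \<and> dim E = R}"

definition orth_proj :: "rvec set \<Rightarrow> rvec \<Rightarrow> rvec" where
  "orth_proj E x = (THE y. y \<in> E \<and> (\<forall>z\<in>E. dotp (x - y) z = 0))"

definition proj_matrix :: "rvec set \<Rightarrow> nat \<Rightarrow> nat \<Rightarrow> real" where
  "proj_matrix E i j = Poly_Mapping.lookup (orth_proj E (Poly_Mapping.single j 1)) i"

text \<open>
  The usual topology of the Grassmannian, for which a subspace is identified with the matrix of
  the orthogonal projection onto it. For subspaces of \<open>\<real>\<^sup>m\<close> all entries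
  outside the leading \<open>m \<times> m\<close> block vanish.
\<close>

definition Grassmannian_topology :: "nat \<Rightarrow> nat \<Rightarrow> rvec set topology" where
  "Grassmannian_topology m R = pullback_topology (Grassmannian m R) proj_matrix euclidean"

definition orthogonal_on :: "nat \<Rightarrow> (rvec \<Rightarrow> rvec) \<Rightarrow> bool" where
  "orthogonal_on m U \<longleftrightarrow> linear U \<and> U ` Rspace m \<subseteq> Rspace m \<and>
     (\<forall>x\<in>Rspace m. \<forall>y\<in>Rspace m. dotp (U x) (U y) = dotp x y)"

text \<open>
  Rotation-invariant Borel probability measures on the Grassmannian. There is exactly one such
  measure, the normalized Haar measure.
\<close>

definition Grassmannian_Haar :: "nat \<Rightarrow> nat \<Rightarrow> rvec set measure \<Rightarrow> bool" where
  "Grassmannian_Haar m R \<mu> \<longleftrightarrow>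
     prob_space \<mu> \<and>
     space \<mu> = Grassmannian m R \<and>
     sets \<mu> = sigma_sets (Grassmannian m R) {A. openin (Grassmannian_topology m R) A} \<and>
     (\<forall>U. orthogonal_on m U \<longrightarrow>
        (\<forall>A\<in>sets \<mu>. emeasure \<mu> ((\<lambda>E. U ` E) ` A) = emeasure \<mu> A))"

end

theory Submission
  imports Defs
begin

text \<open>
  The section \<open>E \<inter> [-1,1]\<^sup>m\<close> has the maximal number of faces of codimension \<open>r\<close> iff \<open>E\<close> meets
  the relative interior of every face of the cube of codimension \<open>r\<close>. By duality this follows
  from the null space property \<open>2 \<parallel>z\<^sub>I\<parallel>\<^sub>1 \<le> \<parallel>z\<^bsub>I\<^sup>c\<^esub>\<parallel>\<^sub>1\<close> for \<open>z\<close> orthogonal to \<open>E\<close> and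
  \<open>\<bar>I\<bar> = r\<close>. If a quadratic form approximates the squared Euclidean norm with relative error at most \<open>1/3\<close> on all
  integer vectors of \<open>\<ell>\<^sub>1\<close>-norm at most \<open>10 r\<close>, then Maurey's empirical method
  bounds \<open>\<parallel>z\<parallel>\<^sub>2\<close> by \<open>\<parallel>z\<parallel>\<^sub>1 / (3 \<surd>r)\<close> on its kernel, which yields that property. There are
  only \<open>exp (O (r log (m/r)))\<close> such integer vectors, and for the form \<open>(m/R) \<parallel>P\<^sub>E x\<parallel>\<^sup>2\<close> a
  single vector fails with probability \<open>exp (- \<Omega> (R))\<close>: by invariance \<open>x\<close> may be replaced by a
  random sign vector, for which a Hanson--Wright inequality holds. The existence of a generic
  subspace comes from the row space of a random sign matrix in the same way. The upper bound for
  an arbitrary symmetric polytope uses its minimal description by inequalities \<open>\<bar>f\<^sub>i\<bar> \<le> 1\<close>,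
  which has one pair \<open>\<plusminus>f\<^sub>i\<close> for each pair of opposite facets.
\<close>

subsection \<open>Sign vectors and a Hanson--Wright inequality\<close>

text \<open>The sign matrices are needed besides the Haar estimate: the last claim speaks of every
  measure satisfying \<open>Grassmannian_Haar\<close>, but no such measure is constructed, so no
  polytope can be extracted from it. The constants fit together as follows. Subtracting 2/3 of the
  squared norm from a form with relative error 1/3 leaves a form that is nonnegative on the short
  integer vectors, has diagonal at most 2/3, and equals -2/3 of the squared norm on the kernel;
  averaging then gives (L - 1) |z|_2^2 <= |z|_1^2. For L = 10 r we have L - 1 >= 9 r, and
  Cauchy-Schwarz on r coordinates gives 3 |z_I|_1 <= |z|_1. The tail exponent is R/576; one half of
  it absorbs the number of integer vectors, which C = 100000 guarantees, and the other half, R/1152,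
  is the claimed probability. The bound r < m/1152 also provides ln (m/r) >= 1 and 20 r <= m.
  Genericity is shown to be an open condition on the subspace, so that its probability is that of a
  measurable event.\<close>

lemma two_pow_fact_le: "2 ^ n * fact n \<le> (fact (2 * n) :: real)"
proof (induction n)
  case (Suc n)
  have "2 ^ Suc n * fact (Suc n) = (2 * real (Suc n)) * (2 ^ n * fact n)"
    by (simp add: algebra_simps)
  also have "\<dots> \<le> (2 * real (Suc n)) * fact (2 * n)"
    using Suc by (intro mult_left_mono) auto
  also have "\<dots> \<le> (real (2 * Suc n) * real (2 * n + 1)) * fact (2 * n)"
    by (intro mult_right_mono) (auto simp: algebra_simps)
  also have "\<dots> = fact (2 * Suc n)"
    by (simp add: algebra_simps)
  finally show ?case .
qed simp

text \<open>Both sides are power series in \<open>x^2\<close>; the coefficients compare because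
  \<open>1 / (2n)! <= 1 / (2^n n!)\<close>. This is the sub-Gaussian bound for a single random
  sign.\<close>

lemma cosh_le_exp_square: "cosh (x::real) \<le> exp (x\<^sup>2 / 2)"
proof -
  let ?f = "\<lambda>n. if even n then x ^ n /\<^sub>R fact n else 0"
  have "?f sums cosh x" by (rule cosh_converges)
  then have "(\<lambda>n. ?f (2 * n)) sums cosh x"
    by (subst sums_mono_reindex) (auto simp: strict_mono_def image_iff elim!: evenE)
  moreover have "(\<lambda>n. (x\<^sup>2 / 2) ^ n /\<^sub>R fact n) sums exp (x\<^sup>2 / 2)"
    by (rule exp_converges)
  moreover have "?f (2 * n) \<le> (x\<^sup>2 / 2) ^ n /\<^sub>R fact n" for n
  proof -
    have "?f (2 * n) = (x\<^sup>2) ^ n / fact (2 * n)"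
      by (simp add: power_mult divide_inverse)
    also have "\<dots> \<le> (x\<^sup>2) ^ n / (2 ^ n * fact n)"
      using two_pow_fact_le[of n] by (intro divide_left_mono) auto
    finally show ?thesis by (simp add: power_divide field_simps)
  qed
  ultimately show ?thesis by (rule sums_le[rotated])
qed

text \<open>Sums over \<open>signs J\<close>, divided by \<open>2 ^ card J\<close>, play the role of
  expectations over independent random signs. Extensionality makes the set finite and makes sums of
  products factorise.\<close>

definition signs :: "'a set \<Rightarrow> ('a \<Rightarrow> real) set" where
  "signs J = J \<rightarrow>\<^sub>E {-1, 1}"

lemma finite_signs [simp]: "finite J \<Longrightarrow> finite (signs J)"
  by (simp add: signs_def finite_PiE)

lemma card_signs: "finite J \<Longrightarrow> card (signs J) = 2 ^ card J"
  by (simp add: signs_def card_PiE numeral_2_eq_2)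

lemma signsD: "\<epsilon> \<in> signs J \<Longrightarrow> j \<in> J \<Longrightarrow> \<epsilon> j = -1 \<or> \<epsilon> j = 1"
  by (auto simp: signs_def PiE_def Pi_def)

lemma signs_square: "\<epsilon> \<in> signs J \<Longrightarrow> j \<in> J \<Longrightarrow> \<epsilon> j * \<epsilon> j = 1"
  using signsD by fastforce

text \<open>By independence the sum factorises into the terms \<open>2 * cosh (a j)\<close>.\<close>

lemma sum_signs_exp_linear_le:
  assumes "finite J"
  shows "(\<Sum>\<epsilon>\<in>signs J. exp (\<Sum>j\<in>J. a j * \<epsilon> j)) \<le> 2 ^ card J * exp ((\<Sum>j\<in>J. (a j)\<^sup>2) / 2)"
proof -
  have "(\<Sum>\<epsilon>\<in>signs J. exp (\<Sum>j\<in>J. a j * \<epsilon> j)) = (\<Prod>j\<in>J. \<Sum>s\<in>{-1,1}. exp (a j * s))"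
    unfolding signs_def using assms by (subst prod_sum_PiE) (auto simp: exp_sum)
  also have "\<dots> = (\<Prod>j\<in>J. 2 * cosh (a j))"
    by (intro prod.cong) (auto simp: cosh_def)
  also have "\<dots> \<le> (\<Prod>j\<in>J. 2 * exp ((a j)\<^sup>2 / 2))"
    by (intro prod_mono) (auto simp: cosh_le_exp_square)
  also have "\<dots> = 2 ^ card J * exp (\<Sum>j\<in>J. (a j)\<^sup>2 / 2)"
    using assms by (simp add: prod.distrib exp_sum)
  finally show ?thesis by (simp add: sum_divide_distrib)
qed

text \<open>Fubini for signs: those on \<open>B\<close> can be frozen while those on
  \<open>A\<close> are averaged.\<close>

lemma sum_signs_Un:
  assumes "A \<inter> B = {}"
  shows "(\<Sum>\<epsilon>\<in>signs (A \<union> B). F \<epsilon>) = (\<Sum>y\<in>signs B. \<Sum>x\<in>signs A. F (merge A B (x, y)))"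
proof -
  have "(\<Sum>\<epsilon>\<in>signs (A \<union> B). F \<epsilon>) = (\<Sum>(y, x)\<in>signs B \<times> signs A. F (merge A B (x, y)))"
  proof (intro sum.reindex_bij_witness[where j = "\<lambda>\<epsilon>. (restrict \<epsilon> B, restrict \<epsilon> A)"
          and i = "\<lambda>(y, x). merge A B (x, y)"])
    fix \<epsilon> assume "\<epsilon> \<in> signs (A \<union> B)"
    then show eq: "(\<lambda>(y, x). merge A B (x, y)) (restrict \<epsilon> B, restrict \<epsilon> A) = \<epsilon>"
      by (auto simp: signs_def merge_def PiE_def extensional_def fun_eq_iff)
    then show "(case (restrict \<epsilon> B, restrict \<epsilon> A) of (y, x) \<Rightarrow> F (merge A B (x, y))) = F \<epsilon>"
      by simp
  next
    fix p assume "p \<in> signs B \<times> signs A"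
    then obtain y x where p: "p = (y, x)" "y \<in> signs B" "x \<in> signs A" by blast
    have "restrict (merge A B (x, y)) A = x" "restrict (merge A B (x, y)) B = y"
      using p assms by (auto simp: signs_def merge_def PiE_def extensional_def fun_eq_iff)
    then show "(restrict ((\<lambda>(y, x). merge A B (x, y)) p) B,
        restrict ((\<lambda>(y, x). merge A B (x, y)) p) A) = p"
      by (simp add: p)
    show "(\<lambda>(y, x). merge A B (x, y)) p \<in> signs (A \<union> B)"
      using p by (auto simp: signs_def merge_def PiE_def extensional_def Pi_def)
  qed (auto simp: signs_def)
  then show ?thesis by (simp add: sum.cartesian_product)
qed

section \<open>Gaussian linearisation of squares\<close>

abbreviation std_gaussian :: "real measure" where
  "std_gaussian \<equiv> density lborel std_normal_density"

lemma nn_integral_normal_density: "0 < \<sigma> \<Longrightarrow> (\<integral>\<^sup>+x. normal_density \<mu> \<sigma> x \<partial>lborel) = 1"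
  by (simp add: nn_integral_eq_integral)

text \<open>Completing the square: the integrand is \<open>exp (s^2 / 2)\<close> times the normal
  density with mean \<open>s\<close> and variance 1.\<close>

lemma nn_integral_gaussian_exp:
  "(\<integral>\<^sup>+h. ennreal (exp (s * h)) \<partial>std_gaussian) = ennreal (exp (s\<^sup>2 / 2))"
proof -
  have "std_normal_density h * exp (s * h) = exp (s\<^sup>2 / 2) * normal_density s 1 h" for h :: real
    by (simp add: normal_density_def field_simps power2_eq_square flip: exp_add)
  then have "(\<integral>\<^sup>+h. ennreal (exp (s * h)) \<partial>std_gaussian)
      = (\<integral>\<^sup>+h. ennreal (exp (s\<^sup>2 / 2)) * ennreal (normal_density s 1 h) \<partial>lborel)"
    by (subst nn_integral_density) (auto simp flip: ennreal_mult)
  also have "\<dots> = ennreal (exp (s\<^sup>2 / 2))"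
    by (simp add: nn_integral_cmult nn_integral_normal_density)
  finally show ?thesis .
qed

text \<open>The integrand is a multiple of the centred normal density with variance
  \<open>1 / (1 - 2 * \<tau>)\<close>.\<close>

lemma nn_integral_gaussian_exp_square:
  assumes "2 * \<tau> < 1"
  shows "(\<integral>\<^sup>+h. ennreal (exp (\<tau> * h\<^sup>2)) \<partial>std_gaussian) = ennreal (1 / sqrt (1 - 2 * \<tau>))"
proof -
  define \<sigma> where "\<sigma> = 1 / sqrt (1 - 2 * \<tau>)"
  have \<sigma>: "\<sigma> > 0" "\<sigma>\<^sup>2 = 1 / (1 - 2 * \<tau>)"
    using assms by (auto simp: \<sigma>_def power_divide)
  have "std_normal_density h * exp (\<tau> * h\<^sup>2) = \<sigma> * normal_density 0 \<sigma> h" for h :: real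
  proof -
    have "- h\<^sup>2 / 2 + \<tau> * h\<^sup>2 = - h\<^sup>2 / (2 * \<sigma>\<^sup>2)"
      using assms by (simp add: \<sigma>(2) field_simps)
    moreover have "\<sigma> * (1 / sqrt (2 * pi * \<sigma>\<^sup>2)) = 1 / sqrt (2 * pi)"
      using \<sigma>(1) by (simp add: real_sqrt_mult)
    ultimately have "std_normal_density h * exp (\<tau> * h\<^sup>2)
        = \<sigma> * (1 / sqrt (2 * pi * \<sigma>\<^sup>2)) * exp (- h\<^sup>2 / (2 * \<sigma>\<^sup>2))"
      unfolding std_normal_density_def by (simp only: mult.assoc flip: exp_add)
    then show ?thesis by (simp add: normal_density_def)
  qed
  then have "(\<integral>\<^sup>+h. ennreal (exp (\<tau> * h\<^sup>2)) \<partial>std_gaussian)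
      = (\<integral>\<^sup>+h. ennreal \<sigma> * ennreal (normal_density 0 \<sigma> h) \<partial>lborel)"
    using \<sigma>(1) by (subst nn_integral_density) (auto simp flip: ennreal_mult)
  also have "\<dots> = ennreal \<sigma>"
    using \<sigma>(1) by (simp add: nn_integral_cmult nn_integral_normal_density)
  finally show ?thesis by (simp add: \<sigma>_def)
qed

text \<open>Each factor \<open>exp (\<tau> * Y^2)\<close> is the Gaussian average of
  \<open>exp (t * Y * h)\<close> with \<open>t^2 = 2 * \<tau>\<close>. After this linearisation the
  signs are averaged first by \<open>sum_signs_exp_linear_le\<close>; the contraction hypothesis
  bounds the result by \<open>exp (\<tau> * |h|^2)\<close>, whose Gaussian integral is
  explicit.\<close>

lemma sum_signs_exp_square_le:
  fixes u :: "'k \<Rightarrow> 'j \<Rightarrow> real"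
  assumes K: "finite K" and J: "finite J" and \<tau>: "0 \<le> \<tau>" "2 * \<tau> < 1"
    and contr: "\<And>h. (\<Sum>j\<in>J. (\<Sum>k\<in>K. h k * u k j)\<^sup>2) \<le> (\<Sum>k\<in>K. (h k)\<^sup>2)"
  shows "(\<Sum>\<epsilon>\<in>signs J. exp (\<tau> * (\<Sum>k\<in>K. (\<Sum>j\<in>J. u k j * \<epsilon> j)\<^sup>2)))
    \<le> 2 ^ card J * (1 / sqrt (1 - 2 * \<tau>)) ^ card K"
proof -
  define t where "t = sqrt (2 * \<tau>)"
  have t: "t\<^sup>2 = 2 * \<tau>" using \<tau> by (simp add: t_def)
  let ?Y = "\<lambda>\<epsilon> k. \<Sum>j\<in>J. u k j * \<epsilon> j"
  let ?M = "\<lambda>_::'k. std_gaussian"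
  interpret N: product_sigma_finite ?M
    unfolding product_sigma_finite_def
    using prob_space_normal_density prob_space_imp_sigma_finite zero_less_one by blast
  \<comment> \<open>Collects the exponent by signs instead of by Gaussian variables, so that it is
    linear in the signs.\<close>
  have swap: "(\<Sum>k\<in>K. t * ?Y \<epsilon> k * h k) = (\<Sum>j\<in>J. (t * (\<Sum>k\<in>K. h k * u k j)) * \<epsilon> j)" for \<epsilon> h
    by (simp add: sum_distrib_left sum_distrib_right mult_ac sum.swap[of _ J K])
  have "ennreal (\<Sum>\<epsilon>\<in>signs J. exp (\<tau> * (\<Sum>k\<in>K. (?Y \<epsilon> k)\<^sup>2)))
      = (\<Sum>\<epsilon>\<in>signs J. \<Prod>k\<in>K. ennreal (exp ((t * ?Y \<epsilon> k)\<^sup>2 / 2)))"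
  proof -
    have "exp (\<tau> * (\<Sum>k\<in>K. (?Y \<epsilon> k)\<^sup>2)) = (\<Prod>k\<in>K. exp ((t * ?Y \<epsilon> k)\<^sup>2 / 2))" for \<epsilon>
      using K by (simp add: power_mult_distrib t sum_distrib_left[of \<tau>] exp_sum)
    then show ?thesis by (simp add: sum_ennreal prod_ennreal prod_nonneg)
  qed
  also have "\<dots> = (\<Sum>\<epsilon>\<in>signs J. \<integral>\<^sup>+h. (\<Prod>k\<in>K. ennreal (exp (t * ?Y \<epsilon> k * h k))) \<partial>PiM K ?M)"
    unfolding nn_integral_gaussian_exp[symmetric]
    by (intro sum.cong refl, subst N.product_nn_integral_prod) (auto simp: K)
  also have "\<dots> = (\<Sum>\<epsilon>\<in>signs J. \<integral>\<^sup>+h. ennreal (exp (\<Sum>k\<in>K. t * ?Y \<epsilon> k * h k)) \<partial>PiM K ?M)"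
    using K by (simp add: prod_ennreal exp_sum)
  also have "\<dots> = (\<integral>\<^sup>+h. (\<Sum>\<epsilon>\<in>signs J. ennreal (exp (\<Sum>k\<in>K. t * ?Y \<epsilon> k * h k))) \<partial>PiM K ?M)"
    by (subst nn_integral_sum) (auto simp: J)
  also have "\<dots> \<le> (\<integral>\<^sup>+h. ennreal (2 ^ card J) * (\<Prod>k\<in>K. ennreal (exp (\<tau> * (h k)\<^sup>2))) \<partial>PiM K ?M)"
  proof (intro nn_integral_mono)
    fix h
    have "(\<Sum>\<epsilon>\<in>signs J. exp (\<Sum>k\<in>K. t * ?Y \<epsilon> k * h k))
        \<le> 2 ^ card J * exp ((\<Sum>j\<in>J. (t * (\<Sum>k\<in>K. h k * u k j))\<^sup>2) / 2)"
      unfolding swap by (rule sum_signs_exp_linear_le[OF J])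
    also have "(\<Sum>j\<in>J. (t * (\<Sum>k\<in>K. h k * u k j))\<^sup>2) / 2 = \<tau> * (\<Sum>j\<in>J. (\<Sum>k\<in>K. h k * u k j)\<^sup>2)"
      by (simp add: power_mult_distrib t flip: sum_distrib_left)
    also have "exp \<dots> \<le> exp (\<tau> * (\<Sum>k\<in>K. (h k)\<^sup>2))"
      using \<tau> contr by (auto intro!: mult_left_mono)
    also have "\<dots> = (\<Prod>k\<in>K. exp (\<tau> * (h k)\<^sup>2))"
      using K by (simp add: exp_sum sum_distrib_left)
    finally show "(\<Sum>\<epsilon>\<in>signs J. ennreal (exp (\<Sum>k\<in>K. t * ?Y \<epsilon> k * h k)))
        \<le> ennreal (2 ^ card J) * (\<Prod>k\<in>K. ennreal (exp (\<tau> * (h k)\<^sup>2)))"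
      by (simp add: sum_ennreal prod_ennreal prod_nonneg flip: ennreal_mult)
  qed
  also have "\<dots> = ennreal (2 ^ card J) * (\<Prod>k\<in>K. \<integral>\<^sup>+h. ennreal (exp (\<tau> * h\<^sup>2)) \<partial>std_gaussian)"
    by (subst nn_integral_cmult, simp, subst N.product_nn_integral_prod) (auto simp: K)
  also have "\<dots> = ennreal (2 ^ card J * (1 / sqrt (1 - 2 * \<tau>)) ^ card K)"
    using \<tau> by (simp add: nn_integral_gaussian_exp_square ennreal_power flip: ennreal_mult)
  finally show ?thesis
    using \<tau> by (subst (asm) ennreal_le_iff) auto
qed

lemma sum_orthonormal_square:
  fixes u :: "'k \<Rightarrow> 'j \<Rightarrow> real"
  assumes K: "finite K"
    and on: "\<And>k l. k \<in> K \<Longrightarrow> l \<in> K \<Longrightarrow> (\<Sum>j\<in>J. u k j * u l j) = (if k = l then 1 else 0)"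
  shows "(\<Sum>j\<in>J. (\<Sum>k\<in>K. h k * u k j)\<^sup>2) = (\<Sum>k\<in>K. (h k)\<^sup>2)"
proof -
  have "(\<Sum>j\<in>J. (\<Sum>k\<in>K. h k * u k j)\<^sup>2) = (\<Sum>k\<in>K. \<Sum>l\<in>K. h k * h l * (\<Sum>j\<in>J. u k j * u l j))"
  proof -
    have "(\<Sum>j\<in>J. (\<Sum>k\<in>K. h k * u k j)\<^sup>2) = (\<Sum>j\<in>J. \<Sum>k\<in>K. \<Sum>l\<in>K. h k * h l * (u k j * u l j))"
      unfolding power2_eq_square sum_product by (intro sum.cong refl) (simp add: mult_ac)
    also have "\<dots> = (\<Sum>k\<in>K. \<Sum>l\<in>K. \<Sum>j\<in>J. h k * h l * (u k j * u l j))"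
      by (subst sum.swap, intro sum.cong refl, subst sum.swap) (rule refl)
    finally show ?thesis by (simp only: sum_distrib_left)
  qed
  also have "\<dots> = (\<Sum>k\<in>K. (h k)\<^sup>2)"
    using K by (intro sum.cong refl) (simp add: on power2_eq_square if_distrib cong: if_cong)
  finally show ?thesis .
qed

lemma sum_signs_exp_bilinear_le:
  fixes u :: "'k \<Rightarrow> 'j \<Rightarrow> real"
  assumes K: "finite K" and J: "finite J" and D: "D \<subseteq> J" and s: "s\<^sup>2 < 1"
    and on: "\<And>k l. k \<in> K \<Longrightarrow> l \<in> K \<Longrightarrow> (\<Sum>j\<in>J. u k j * u l j) = (if k = l then 1 else 0)"
  shows "(\<Sum>\<epsilon>\<in>signs J. exp (s * (\<Sum>i\<in>D. \<Sum>j\<in>J - D. (\<Sum>k\<in>K. u k i * u k j) * \<epsilon> i * \<epsilon> j)))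
    \<le> 2 ^ card J * (1 / sqrt (1 - s\<^sup>2)) ^ card K"
proof -
  let ?P = "\<lambda>i j. \<Sum>k\<in>K. u k i * u k j"
  let ?Y = "\<lambda>y k. \<Sum>j\<in>J - D. u k j * y j"
  have fin: "finite D" "finite (J - D)" using D J finite_subset by auto
  have "(\<Sum>\<epsilon>\<in>signs J. exp (s * (\<Sum>i\<in>D. \<Sum>j\<in>J - D. ?P i j * \<epsilon> i * \<epsilon> j)))
      = (\<Sum>y\<in>signs (J - D). \<Sum>x\<in>signs D. exp (s * (\<Sum>i\<in>D. \<Sum>j\<in>J - D.
          ?P i j * merge D (J - D) (x, y) i * merge D (J - D) (x, y) j)))"
    using D by (subst sum_signs_Un[symmetric]) (auto simp: Un_absorb1)
  also have "\<dots> = (\<Sum>y\<in>signs (J - D). \<Sum>x\<in>signs D. exp (\<Sum>i\<in>D. (s * (\<Sum>j\<in>J - D. ?P i j * y j)) * x i))"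
    by (intro sum.cong refl arg_cong[where f = exp])
      (simp add: merge_def sum_distrib_left sum_distrib_right mult_ac)
  also have "\<dots> \<le> (\<Sum>y\<in>signs (J - D). 2 ^ card D * exp (s\<^sup>2 / 2 * (\<Sum>k\<in>K. (?Y y k)\<^sup>2)))"
  proof (intro sum_mono)
    fix y
    \<comment> \<open>Enlarging the outer range from \<open>D\<close> to \<open>J\<close> makes the
      orthonormality of the \<open>u k\<close> available.\<close>
    have "(\<Sum>i\<in>D. (\<Sum>j\<in>J - D. ?P i j * y j)\<^sup>2) \<le> (\<Sum>i\<in>J. (\<Sum>j\<in>J - D. ?P i j * y j)\<^sup>2)"
      using D J by (intro sum_mono2) auto
    also have "\<dots> = (\<Sum>i\<in>J. (\<Sum>k\<in>K. ?Y y k * u k i)\<^sup>2)"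
    proof (intro sum.cong refl arg_cong[where f = "\<lambda>x. x\<^sup>2"])
      fix i
      show "(\<Sum>j\<in>J - D. ?P i j * y j) = (\<Sum>k\<in>K. ?Y y k * u k i)"
        by (simp add: sum_distrib_left sum_distrib_right mult_ac) (rule sum.swap)
    qed
    also have "\<dots> = (\<Sum>k\<in>K. (?Y y k)\<^sup>2)"
      by (rule sum_orthonormal_square[OF K on])
    finally have le: "(\<Sum>i\<in>D. (\<Sum>j\<in>J - D. ?P i j * y j)\<^sup>2) \<le> (\<Sum>k\<in>K. (?Y y k)\<^sup>2)" .
    have "(\<Sum>x\<in>signs D. exp (\<Sum>i\<in>D. (s * (\<Sum>j\<in>J - D. ?P i j * y j)) * x i))
        \<le> 2 ^ card D * exp ((\<Sum>i\<in>D. (s * (\<Sum>j\<in>J - D. ?P i j * y j))\<^sup>2) / 2)"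
      by (rule sum_signs_exp_linear_le[OF fin(1)])
    also have "(\<Sum>i\<in>D. (s * (\<Sum>j\<in>J - D. ?P i j * y j))\<^sup>2) / 2
        = s\<^sup>2 / 2 * (\<Sum>i\<in>D. (\<Sum>j\<in>J - D. ?P i j * y j)\<^sup>2)"
      by (simp only: power_mult_distrib sum_distrib_left[symmetric] times_divide_eq_left)
    also have "2 ^ card D * exp \<dots> \<le> 2 ^ card D * exp (s\<^sup>2 / 2 * (\<Sum>k\<in>K. (?Y y k)\<^sup>2))"
      by (intro mult_left_mono iffD2[OF exp_le_cancel_iff] le) simp_all
    finally show "(\<Sum>x\<in>signs D. exp (\<Sum>i\<in>D. (s * (\<Sum>j\<in>J - D. ?P i j * y j)) * x i))
        \<le> 2 ^ card D * exp (s\<^sup>2 / 2 * (\<Sum>k\<in>K. (?Y y k)\<^sup>2))" .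
  qed
  also have "\<dots> = 2 ^ card D * (\<Sum>y\<in>signs (J - D). exp (s\<^sup>2 / 2 * (\<Sum>k\<in>K. (?Y y k)\<^sup>2)))"
    by (rule sum_distrib_left[symmetric])
  also have "\<dots> \<le> 2 ^ card D * (2 ^ card (J - D) * (1 / sqrt (1 - 2 * (s\<^sup>2 / 2))) ^ card K)"
  proof (intro mult_left_mono sum_signs_exp_square_le K fin)
    fix h
    have "(\<Sum>j\<in>J - D. (\<Sum>k\<in>K. h k * u k j)\<^sup>2) \<le> (\<Sum>j\<in>J. (\<Sum>k\<in>K. h k * u k j)\<^sup>2)"
      using J by (intro sum_mono2) auto
    also have "\<dots> = (\<Sum>k\<in>K. (h k)\<^sup>2)"
      by (rule sum_orthonormal_square[OF K on])
    finally show "(\<Sum>j\<in>J - D. (\<Sum>k\<in>K. h k * u k j)\<^sup>2) \<le> (\<Sum>k\<in>K. (h k)\<^sup>2)" .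
  qed (use s in auto)
  also have "\<dots> = 2 ^ card J * (1 / sqrt (1 - s\<^sup>2)) ^ card K"
    using D J fin by (simp add: card_Diff_subset card_mono flip: power_add)
  finally show ?thesis .
qed

section \<open>Decoupling and the tail bound\<close>

lemma card_separating_subsets:
  assumes J: "finite J" and ij: "i \<in> J" "j \<in> J" "i \<noteq> j"
  shows "4 * card {D \<in> Pow J. i \<in> D \<and> j \<notin> D} = 2 ^ card J"
proof -
  have "bij_betw (insert i) (Pow (J - {i, j})) {D \<in> Pow J. i \<in> D \<and> j \<notin> D}"
    by (rule bij_betw_byWitness[where f' = "\<lambda>D. D - {i}"]) (use ij in auto)
  then have "card {D \<in> Pow J. i \<in> D \<and> j \<notin> D} = card (Pow (J - {i, j}))"
    by (rule bij_betw_same_card[symmetric])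
  moreover have "card J = card ({i, j} \<union> (J - {i, j}))"
    using ij by (intro arg_cong[where f = card]) blast
  then have "card J = card (J - {i, j}) + 2"
    using J ij by (subst (asm) card_Un_disjoint) auto
  ultimately show ?thesis using J by (simp add: card_Pow power_add)
qed

text \<open>A uniformly random \<open>D\<close> contains \<open>i\<close> but not \<open>j\<close>
  with probability 1/4. Hence an off-diagonal sum is four times the average of its restrictions to
  \<open>D \<times> (J - D)\<close>, and in each of these the two indices run over disjoint sets of
  signs.\<close>

lemma sum_decoupling:
  fixes A :: "'j \<Rightarrow> 'j \<Rightarrow> real"
  assumes J: "finite J"
  shows "4 * (\<Sum>D\<in>Pow J. \<Sum>i\<in>D. \<Sum>j\<in>J - D. A i j) = 2 ^ card J * (\<Sum>i\<in>J. \<Sum>j\<in>J - {i}. A i j)"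
proof -
  have "(\<Sum>D\<in>Pow J. \<Sum>i\<in>D. \<Sum>j\<in>J - D. A i j)
      = (\<Sum>D\<in>Pow J. \<Sum>i\<in>J. \<Sum>j\<in>J - {i}. if i \<in> D \<and> j \<notin> D then A i j else 0)"
  proof (rule sum.cong[OF refl])
    fix D assume "D \<in> Pow J"
    then have D: "D = {i\<in>J. i \<in> D}" by auto
    have "(\<Sum>i\<in>D. \<Sum>j\<in>J - D. A i j) = (\<Sum>i\<in>J. if i \<in> D then \<Sum>j\<in>J - D. A i j else 0)"
      using J by (subst D) (simp only: sum.inter_filter)
    also have "\<dots> = (\<Sum>i\<in>J. \<Sum>j\<in>J - {i}. if i \<in> D \<and> j \<notin> D then A i j else 0)"
    proof (intro sum.cong refl)
      fix i
      show "(if i \<in> D then \<Sum>j\<in>J - D. A i j else 0)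
          = (\<Sum>j\<in>J - {i}. if i \<in> D \<and> j \<notin> D then A i j else 0)"
      proof (cases "i \<in> D")
        case True
        then have "J - D = {j \<in> J - {i}. j \<notin> D}" by auto
        then show ?thesis using True J by (simp add: sum.inter_filter[symmetric])
      qed simp
    qed
    finally show "(\<Sum>i\<in>D. \<Sum>j\<in>J - D. A i j)
      = (\<Sum>i\<in>J. \<Sum>j\<in>J - {i}. if i \<in> D \<and> j \<notin> D then A i j else 0)" .
  qed
  also have "\<dots> = (\<Sum>i\<in>J. \<Sum>j\<in>J - {i}. \<Sum>D\<in>Pow J. if i \<in> D \<and> j \<notin> D then A i j else 0)"
    by (subst sum.swap, intro sum.cong refl, subst sum.swap) (rule refl)
  also have "\<dots> = (\<Sum>i\<in>J. \<Sum>j\<in>J - {i}. 2 ^ card J / 4 * A i j)"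
  proof (intro sum.cong refl)
    fix i j assume "i \<in> J" "j \<in> J - {i}"
    then have "real (4 * card {D \<in> Pow J. i \<in> D \<and> j \<notin> D}) = real (2 ^ card J)"
      by (subst card_separating_subsets[OF J, of i j]) auto
    then have "4 * real (card {D \<in> Pow J. i \<in> D \<and> j \<notin> D}) = 2 ^ card J"
      by simp
    moreover have "(\<Sum>D\<in>Pow J. if i \<in> D \<and> j \<notin> D then A i j else 0)
        = real (card {D \<in> Pow J. i \<in> D \<and> j \<notin> D}) * A i j"
      using J by (simp add: sum.inter_filter[symmetric])
    ultimately show "(\<Sum>D\<in>Pow J. if i \<in> D \<and> j \<notin> D then A i j else 0) = 2 ^ card J / 4 * A i j"
      by simp
  qed
  finally show ?thesis by (simp add: sum_distrib_left)
qed

text \<open>The diagonal of the quadratic form contributes its trace \<open>card K\<close>, because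
  the squares of signs are 1; so subtracting \<open>card K\<close> leaves the off-diagonal part.
  Jensen's inequality moves \<open>exp\<close> inside the decoupling average, and the factor 4 there
  turns \<open>l\<close> into \<open>s = 4 * l\<close>.\<close>

lemma sum_signs_exp_chaos_le:
  fixes u :: "'k \<Rightarrow> 'j \<Rightarrow> real"
  assumes K: "finite K" and J: "finite J" and l: "16 * l\<^sup>2 < 1"
    and on: "\<And>k l. k \<in> K \<Longrightarrow> l \<in> K \<Longrightarrow> (\<Sum>j\<in>J. u k j * u l j) = (if k = l then 1 else 0)"
  shows "(\<Sum>\<epsilon>\<in>signs J. exp (l * ((\<Sum>k\<in>K. (\<Sum>j\<in>J. u k j * \<epsilon> j)\<^sup>2) - card K)))
    \<le> 2 ^ card J * (1 / sqrt (1 - 16 * l\<^sup>2)) ^ card K"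
proof -
  let ?P = "\<lambda>i j. \<Sum>k\<in>K. u k i * u k j"
  let ?B = "\<lambda>\<epsilon> D. \<Sum>i\<in>D. \<Sum>j\<in>J - D. ?P i j * \<epsilon> i * \<epsilon> j"
  let ?n = "2 ^ card J :: real"
  have offdiag: "(\<Sum>k\<in>K. (\<Sum>j\<in>J. u k j * \<epsilon> j)\<^sup>2) - card K = (\<Sum>i\<in>J. \<Sum>j\<in>J - {i}. ?P i j * \<epsilon> i * \<epsilon> j)"
    if \<epsilon>: "\<epsilon> \<in> signs J" for \<epsilon>
  proof -
    have "(\<Sum>k\<in>K. (\<Sum>j\<in>J. u k j * \<epsilon> j)\<^sup>2) = (\<Sum>k\<in>K. \<Sum>i\<in>J. \<Sum>j\<in>J. u k i * u k j * \<epsilon> i * \<epsilon> j)"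
      unfolding power2_eq_square sum_product by (simp add: mult_ac)
    also have "\<dots> = (\<Sum>i\<in>J. \<Sum>j\<in>J. ?P i j * \<epsilon> i * \<epsilon> j)"
      unfolding sum_distrib_right by (subst sum.swap, intro sum.cong refl, subst sum.swap) (rule refl)
    also have "\<dots> = (\<Sum>i\<in>J. ?P i i + (\<Sum>j\<in>J - {i}. ?P i j * \<epsilon> i * \<epsilon> j))"
    proof (rule sum.cong[OF refl])
      fix i assume "i \<in> J"
      then show "(\<Sum>j\<in>J. ?P i j * \<epsilon> i * \<epsilon> j) = ?P i i + (\<Sum>j\<in>J - {i}. ?P i j * \<epsilon> i * \<epsilon> j)"
        using signs_square[OF \<epsilon> \<open>i \<in> J\<close>] by (subst sum.remove[OF J \<open>i \<in> J\<close>]) (simp only: mult.assoc mult_1_right)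
    qed
    also have "\<dots> = (\<Sum>i\<in>J. ?P i i) + (\<Sum>i\<in>J. \<Sum>j\<in>J - {i}. ?P i j * \<epsilon> i * \<epsilon> j)"
      by (rule sum.distrib)
    also have "(\<Sum>i\<in>J. ?P i i) = card K"
      by (subst sum.swap) (simp add: on)
    finally show ?thesis by simp
  qed
  have "(\<Sum>\<epsilon>\<in>signs J. exp (l * ((\<Sum>k\<in>K. (\<Sum>j\<in>J. u k j * \<epsilon> j)\<^sup>2) - card K)))
      \<le> (\<Sum>\<epsilon>\<in>signs J. \<Sum>D\<in>Pow J. 1 / ?n * exp (4 * l * ?B \<epsilon> D))"
  proof (intro sum_mono)
    fix \<epsilon> assume \<epsilon>: "\<epsilon> \<in> signs J"
    have "?n * (\<Sum>i\<in>J. \<Sum>j\<in>J - {i}. ?P i j * \<epsilon> i * \<epsilon> j) = 4 * (\<Sum>D\<in>Pow J. ?B \<epsilon> D)"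
      by (rule sum_decoupling[OF J, symmetric])
    then have "(\<Sum>i\<in>J. \<Sum>j\<in>J - {i}. ?P i j * \<epsilon> i * \<epsilon> j) = 4 / ?n * (\<Sum>D\<in>Pow J. ?B \<epsilon> D)"
      by (simp add: field_simps)
    then have "l * ((\<Sum>k\<in>K. (\<Sum>j\<in>J. u k j * \<epsilon> j)\<^sup>2) - card K) = (\<Sum>D\<in>Pow J. (1 / ?n) *\<^sub>R (4 * l * ?B \<epsilon> D))"
      unfolding offdiag[OF \<epsilon>] sum_distrib_left[symmetric] scaleR_right.sum[symmetric] by simp
    also have "exp \<dots> \<le> (\<Sum>D\<in>Pow J. 1 / ?n * exp (4 * l * ?B \<epsilon> D))"
    proof (rule convex_on_sum[OF _ _ exp_convex])
      show "(\<Sum>D\<in>Pow J. 1 / ?n) = 1" using J by (simp add: card_Pow)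
    qed (use J in auto)
    finally show "exp (l * ((\<Sum>k\<in>K. (\<Sum>j\<in>J. u k j * \<epsilon> j)\<^sup>2) - card K))
        \<le> (\<Sum>D\<in>Pow J. 1 / ?n * exp (4 * l * ?B \<epsilon> D))" .
  qed
  also have "\<dots> = (\<Sum>D\<in>Pow J. 1 / ?n * (\<Sum>\<epsilon>\<in>signs J. exp (4 * l * ?B \<epsilon> D)))"
    by (subst sum.swap) (simp only: sum_distrib_left)
  also have "\<dots> \<le> (\<Sum>D\<in>Pow J. 1 / ?n * (?n * (1 / sqrt (1 - (4 * l)\<^sup>2)) ^ card K))"
  proof (intro sum_mono mult_left_mono sum_signs_exp_bilinear_le[OF K J _ _ on])
    show "(4 * l)\<^sup>2 < 1" using l by (simp add: power_mult_distrib)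
  qed auto
  also have "\<dots> = ?n * (1 / sqrt (1 - 16 * l\<^sup>2)) ^ card K"
    using J by (simp add: card_Pow power_mult_distrib)
  finally show ?thesis .
qed

text \<open>Chernoff's method with \<open>l = 1/96\<close> and \<open>l = -1/96\<close>, one for
  each tail. Then \<open>16 * l^2 = 1/576\<close>, so each factor of the moment bound is
  \<open>sqrt (576/575) <= exp (1/576)\<close>; the threshold becomes \<open>l * X > R/288\<close>,
  and the exponent left over is \<open>R/576 - R/288\<close>.\<close>

lemma hanson_wright_signs:
  fixes u :: "'k \<Rightarrow> 'j \<Rightarrow> real"
  assumes K: "finite K" and J: "finite J"
    and on: "\<And>k l. k \<in> K \<Longrightarrow> l \<in> K \<Longrightarrow> (\<Sum>j\<in>J. u k j * u l j) = (if k = l then 1 else 0)"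
  shows "real (card {\<epsilon> \<in> signs J. \<bar>(\<Sum>k\<in>K. (\<Sum>j\<in>J. u k j * \<epsilon> j)\<^sup>2) - card K\<bar> > card K / 3})
    \<le> 2 ^ card J * (2 * exp (- (card K / 576)))"
proof -
  let ?R = "real (card K)"
  define X where "X \<epsilon> = (\<Sum>k\<in>K. (\<Sum>j\<in>J. u k j * \<epsilon> j)\<^sup>2) - ?R" for \<epsilon>
  have base: "1 / sqrt (1 - 16 * l\<^sup>2) \<le> exp (1 / 576)" if "l\<^sup>2 = (1 / 96)\<^sup>2" for l :: real
  proof -
    have "576 / 575 \<le> 1 + 2 / (576 :: real)" by simp
    also have "\<dots> \<le> exp (2 / 576)" by (rule exp_ge_add_one_self)
    also have "\<dots> = (exp (1 / 576))\<^sup>2" by (simp add: power2_eq_square flip: exp_add)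
    finally have "sqrt (576 / 575) \<le> exp (1 / 576)" by (intro real_le_lsqrt) auto
    moreover have "1 / sqrt (1 - 16 * l\<^sup>2) = sqrt (576 / 575)"
      unfolding that by (simp add: power2_eq_square real_sqrt_divide)
    ultimately show ?thesis by simp
  qed
  have tail: "real (card {\<epsilon> \<in> signs J. l * X \<epsilon> > ?R / 288}) \<le> 2 ^ card J * exp (- (?R / 576))"
    if l: "l\<^sup>2 = (1 / 96)\<^sup>2" for l
  proof -
    let ?S = "{\<epsilon> \<in> signs J. l * X \<epsilon> > ?R / 288}"
    have "real (card ?S) * exp (?R / 288) = (\<Sum>\<epsilon>\<in>?S. exp (?R / 288))" by simp
    also have "\<dots> \<le> (\<Sum>\<epsilon>\<in>?S. exp (l * X \<epsilon>))" by (intro sum_mono) auto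
    also have "\<dots> \<le> (\<Sum>\<epsilon>\<in>signs J. exp (l * X \<epsilon>))" using J by (intro sum_mono2) auto
    also have "\<dots> \<le> 2 ^ card J * (1 / sqrt (1 - 16 * l\<^sup>2)) ^ card K"
      unfolding X_def
    proof (rule sum_signs_exp_chaos_le[OF K J _ on])
      show "16 * l\<^sup>2 < 1" unfolding l by (simp add: power2_eq_square)
    qed
    also have "\<dots> \<le> 2 ^ card J * exp (1 / 576) ^ card K"
    proof (intro mult_left_mono power_mono base l)
      show "0 \<le> 1 / sqrt (1 - 16 * l\<^sup>2)" unfolding l by (simp add: power2_eq_square)
    qed simp
    also have "exp (1 / 576) ^ card K = exp (?R / 576)"
      by (subst exp_of_nat_mult[symmetric]) simp
    finally have "real (card ?S) \<le> 2 ^ card J * (exp (?R / 576) / exp (?R / 288))"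
      by (simp only: times_divide_eq_right pos_le_divide_eq exp_gt_zero)
    also have "exp (?R / 576) / exp (?R / 288) = exp (- (?R / 576))"
      by (simp flip: exp_diff)
    finally show ?thesis .
  qed
  let ?S = "\<lambda>l. {\<epsilon> \<in> signs J. l * X \<epsilon> > ?R / 288}"
  have "{\<epsilon> \<in> signs J. \<bar>X \<epsilon>\<bar> > ?R / 3} \<subseteq> ?S (1 / 96) \<union> ?S (- 1 / 96)"
  proof -
    have "1 / 96 * x > ?R / 288 \<or> - 1 / 96 * x > ?R / 288" if "\<bar>x\<bar> > ?R / 3" for x
      using that by (simp add: abs_if split: if_splits)
    then show ?thesis by blast
  qed
  then have "card {\<epsilon> \<in> signs J. \<bar>X \<epsilon>\<bar> > ?R / 3} \<le> card (?S (1 / 96) \<union> ?S (- 1 / 96))"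
    by (rule card_mono[rotated]) (intro finite_UnI finite_subset[OF _ finite_signs[OF J]] Collect_subset)
  also have "\<dots> \<le> card (?S (1 / 96)) + card (?S (- 1 / 96))"
    by (rule card_Un_le)
  finally have "real (card {\<epsilon> \<in> signs J. \<bar>X \<epsilon>\<bar> > ?R / 3})
      \<le> real (card (?S (1 / 96))) + real (card (?S (- 1 / 96)))"
    by (simp only: of_nat_le_iff of_nat_add[symmetric])
  also have "\<dots> \<le> 2 ^ card J * exp (- (?R / 576)) + 2 ^ card J * exp (- (?R / 576))"
    by (intro add_mono tail) (simp_all add: power2_eq_square)
  finally show ?thesis by (simp add: X_def)
qed

subsection \<open>Integer vectors and Maurey's method\<close>

text \<open>Cut out of a finite box of extensional functions, over which sums of products factorise
  into coordinates.\<close>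

definition integer_vectors :: "nat \<Rightarrow> nat \<Rightarrow> (nat \<Rightarrow> int) set" where
  "integer_vectors m L = {w \<in> {..<m} \<rightarrow>\<^sub>E {- int L..int L}. (\<Sum>i<m. \<bar>w i\<bar>) \<le> int L}"

lemma finite_integer_vectors [simp]: "finite (integer_vectors m L)"
  unfolding integer_vectors_def
  by (rule finite_subset[of _ "{..<m} \<rightarrow>\<^sub>E {- int L..int L}"]) (auto intro: finite_PiE)

text \<open>A truncated two-sided geometric series is at most \<open>(1 + t) / (1 - t)\<close>,
  which is at most \<open>1 + 4 * t\<close> for \<open>t <= 1/2\<close>.\<close>

lemma sum_power_abs_le:
  assumes t: "0 \<le> (t::real)" "t \<le> 1 / 2"
  shows "(\<Sum>a\<in>{- int n..int n}. t ^ nat \<bar>a\<bar>) \<le> exp (4 * t)"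
proof -
  have "(1 - t) * (\<Sum>a\<in>{- int n..int n}. t ^ nat \<bar>a\<bar>) = 1 + t - 2 * t ^ Suc n"
  proof (induction n)
    case (Suc n)
    have "{- int (Suc n)..int (Suc n)} = insert (int (Suc n)) (insert (- int (Suc n)) {- int n..int n})"
      by auto
    then have "(\<Sum>a\<in>{- int (Suc n)..int (Suc n)}. t ^ nat \<bar>a\<bar>)
        = 2 * t ^ Suc n + (\<Sum>a\<in>{- int n..int n}. t ^ nat \<bar>a\<bar>)"
      by (simp add: nat_add_distrib)
    then have "(1 - t) * (\<Sum>a\<in>{- int (Suc n)..int (Suc n)}. t ^ nat \<bar>a\<bar>)
        = (1 - t) * (2 * t ^ Suc n) + (1 + t - 2 * t ^ Suc n)"
      by (simp only: distrib_left Suc)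
    then show ?case by (simp add: algebra_simps)
  qed simp
  also have "\<dots> \<le> 1 + t" using t by simp
  also have "\<dots> \<le> (1 - t) * (1 + 4 * t)"
  proof -
    have "0 \<le> 2 * t * (1 - 2 * t)" using t by (intro mult_nonneg_nonneg) auto
    then show ?thesis by (simp add: algebra_simps)
  qed
  also have "\<dots> \<le> (1 - t) * exp (4 * t)"
    using t by (intro mult_left_mono) auto
  finally show ?thesis using t by simp
qed

text \<open>Generating function bound: give \<open>w\<close> the weight \<open>t\<close> to the
  power of its l1-norm, which is at least \<open>t ^ L\<close> on the set, and sum the weights over
  the whole box. The choice \<open>t = L/m\<close> makes the product over the \<open>m\<close>
  coordinates at most \<open>exp (4 * L)\<close>.\<close>

lemma card_integer_vectors_le:
  assumes L: "0 < L" "2 * L \<le> m"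
  shows "real (card (integer_vectors m L)) \<le> (real m / real L) ^ L * exp (4 * real L)"
proof -
  define t where "t = real L / real m"
  have t: "0 < t" "t \<le> 1 / 2" using L by (auto simp: t_def field_simps)
  let ?P = "{..<m} \<rightarrow>\<^sub>E {- int L..int L}"
  have "real (card (integer_vectors m L)) * t ^ L = (\<Sum>w\<in>integer_vectors m L. t ^ L)"
    by simp
  also have "\<dots> \<le> (\<Sum>w\<in>integer_vectors m L. \<Prod>i<m. t ^ nat \<bar>w i\<bar>)"
  proof (intro sum_mono)
    fix w assume "w \<in> integer_vectors m L"
    then have "(\<Sum>i<m. \<bar>w i\<bar>) \<le> int L" by (simp add: integer_vectors_def)
    moreover have "int (\<Sum>i<m. nat \<bar>w i\<bar>) = (\<Sum>i<m. \<bar>w i\<bar>)" by simp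
    ultimately have "(\<Sum>i<m. nat \<bar>w i\<bar>) \<le> L" by linarith
    then have "t ^ L \<le> t ^ (\<Sum>i<m. nat \<bar>w i\<bar>)"
      using t by (intro power_decreasing) auto
    then show "t ^ L \<le> (\<Prod>i<m. t ^ nat \<bar>w i\<bar>)"
      by (simp only: power_sum)
  qed
  also have "\<dots> \<le> (\<Sum>w\<in>?P. \<Prod>i<m. t ^ nat \<bar>w i\<bar>)"
  proof (rule sum_mono2)
    show "finite ?P" by (rule finite_PiE) simp_all
    show "integer_vectors m L \<subseteq> ?P" by (auto simp only: integer_vectors_def)
  qed (use t in \<open>simp add: prod_nonneg\<close>)
  also have "\<dots> = (\<Prod>i<m. \<Sum>a\<in>{- int L..int L}. t ^ nat \<bar>a\<bar>)"
    by (rule prod_sum_PiE[symmetric]) auto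
  also have "\<dots> \<le> (\<Prod>i<m. exp (4 * t))"
  proof (rule prod_mono)
    fix i show "0 \<le> (\<Sum>a\<in>{- int L..int L}. t ^ nat \<bar>a\<bar>)
        \<and> (\<Sum>a\<in>{- int L..int L}. t ^ nat \<bar>a\<bar>) \<le> exp (4 * t)"
      using t by (simp add: sum_power_abs_le sum_nonneg)
  qed
  also have "\<dots> = exp (real m * (4 * t))"
    by (simp only: prod_constant card_lessThan exp_of_nat_mult)
  also have "real m * (4 * t) = 4 * real L"
    using L by (simp add: t_def)
  finally have "real (card (integer_vectors m L)) \<le> exp (4 * real L) / t ^ L"
    using t by (simp only: pos_le_divide_eq zero_less_power)
  also have "\<dots> = (real m / real L) ^ L * exp (4 * real L)"
    by (simp add: t_def power_divide)
  finally show ?thesis .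
qed

section \<open>Bilinear forms and the empirical method\<close>

definition bform :: "nat \<Rightarrow> (nat \<Rightarrow> nat \<Rightarrow> real) \<Rightarrow> (nat \<Rightarrow> real) \<Rightarrow> (nat \<Rightarrow> real) \<Rightarrow> real" where
  "bform m M x y = (\<Sum>i<m. \<Sum>j<m. M i j * x i * y j)"

lemma bform_add_left: "bform m M (\<lambda>i. x i + y i) z = bform m M x z + bform m M y z"
  by (simp add: bform_def algebra_simps sum.distrib)

lemma bform_add_right: "bform m M x (\<lambda>i. y i + z i) = bform m M x y + bform m M x z"
  by (simp add: bform_def algebra_simps sum.distrib)

lemma bform_scale: "bform m M (\<lambda>i. c * x i) (\<lambda>i. d * y i) = c * d * bform m M x y"
  by (simp add: bform_def algebra_simps sum_distrib_left)

lemma bform_cong: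
  "(\<And>i. i < m \<Longrightarrow> x i = x' i) \<Longrightarrow> (\<And>i. i < m \<Longrightarrow> y i = y' i) \<Longrightarrow> bform m M x y = bform m M x' y'"
  by (simp add: bform_def)

lemma bform_unit_left:
  assumes "i < m"
  shows "bform m M (\<lambda>j. if j = i then c else 0) y = c * (\<Sum>j<m. M i j * y j)"
proof -
  have "bform m M (\<lambda>j. if j = i then c else 0) y = (\<Sum>a<m. if a = i then \<Sum>j<m. M i j * c * y j else 0)"
    unfolding bform_def by (intro sum.cong) auto
  then show ?thesis using assms by (simp add: sum_distrib_left mult_ac)
qed

lemma bform_unit_right:
  assumes "i < m"
  shows "bform m M x (\<lambda>j. if j = i then c else 0) = c * (\<Sum>a<m. M a i * x a)"
proof -
  have "bform m M x (\<lambda>j. if j = i then c else 0) = (\<Sum>a<m. \<Sum>j<m. if j = i then M a i * x a * c else 0)"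
    unfolding bform_def by (intro sum.cong) auto
  then show ?thesis using assms by (simp add: sum_distrib_left mult_ac)
qed

text \<open>
  Maurey's empirical method without probability: the left-hand side is the expectation of
  \<open>bform m M (u + X) (u + X)\<close> for a sum \<open>X\<close> of \<open>k\<close> independent random signed
  unit vectors with mean \<open>v\<close>.
\<close>

lemma maurey_bform_nonneg:
  fixes u s :: "nat \<Rightarrow> int"
  assumes nonneg: "\<And>w :: nat \<Rightarrow> int. (\<Sum>i<m. \<bar>w i\<bar>) \<le> int L \<Longrightarrow>
      0 \<le> bform m M (\<lambda>i. real_of_int (w i)) (\<lambda>i. real_of_int (w i))"
    and p: "\<And>i. 0 \<le> p i" "(\<Sum>i<m. p i) = 1" and s: "\<And>i. \<bar>s i\<bar> = 1"
    and v: "v = (\<lambda>i. p i * real_of_int (s i))"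
    and "(\<Sum>i<m. \<bar>u i\<bar>) + int k \<le> int L"
  shows "0 \<le> bform m M u u + k * (bform m M u v + bform m M v u)
    + real k * (real k - 1) * bform m M v v + k * (\<Sum>i<m. p i * M i i)"
  using assms(6)
proof (induction k arbitrary: u)
  case 0
  then show ?case using nonneg[of u] by simp
next
  case (Suc k)
  define e where "e i = (\<lambda>j. if j = i then s i else 0)" for i :: nat
  have e: "(\<lambda>j. real_of_int (e i j)) = (\<lambda>j. if j = i then real_of_int (s i) else 0)" for i
    by (auto simp: e_def)
  have ss: "real_of_int (s i) * real_of_int (s i) = 1" for i
    using s[of i] by (metis abs_mult_self_eq mult_1 of_int_1 of_int_mult)
  let ?b = "bform m M"
  let ?D = "\<Sum>i<m. p i * M i i"
  let ?G = "\<lambda>u. ?b u u + k * (?b u v + ?b v u) + real k * (real k - 1) * ?b v v + k * ?D"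
  have avg_right: "(\<Sum>i<m. p i * ?b x (e i)) = ?b x v" for x
  proof -
    have "(\<Sum>i<m. p i * ?b x (e i)) = (\<Sum>i<m. \<Sum>a<m. M a i * x a * v i)"
      by (intro sum.cong refl) (simp add: e bform_unit_right v sum_distrib_left mult_ac)
    then show ?thesis unfolding bform_def by (subst sum.swap) simp
  qed
  have avg_left: "(\<Sum>i<m. p i * ?b (e i) x) = ?b x' y'" if "x' = v" "y' = x" for x x' y'
    unfolding that bform_def[of m M v x]
    by (intro sum.cong refl) (simp add: e bform_unit_left v sum_distrib_left mult_ac)
  \<comment> \<open>The induction hypothesis is applied after each possible first step
    \<open>e i\<close> and averaged with the weights \<open>p i\<close>.\<close>
  have "0 \<le> (\<Sum>i<m. p i * ?G (\<lambda>j. real_of_int (u j + e i j)))"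
  proof (intro sum_nonneg mult_nonneg_nonneg p)
    fix i assume "i \<in> {..<m}"
    have "(\<Sum>j<m. \<bar>e i j\<bar>) = (\<Sum>j<m. if j = i then 1 else 0)"
      by (intro sum.cong refl) (simp add: e_def s)
    then have "(\<Sum>j<m. \<bar>e i j\<bar>) = 1"
      using \<open>i \<in> {..<m}\<close> by simp
    moreover have "(\<Sum>j<m. \<bar>u j + e i j\<bar>) \<le> (\<Sum>j<m. \<bar>u j\<bar> + \<bar>e i j\<bar>)"
      by (intro sum_mono) simp
    ultimately have "(\<Sum>j<m. \<bar>u j + e i j\<bar>) + int k \<le> int L"
      using Suc.prems by (simp add: sum.distrib)
    then show "0 \<le> ?G (\<lambda>j. real_of_int (u j + e i j))" by (rule Suc.IH)
  qed
  also have "\<dots> = (\<Sum>i<m. p i * (?b u u) + p i * ?b u (e i) + p i * ?b (e i) u + p i * M i i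
      + p i * (k * (?b u v + ?b v u)) + k * (p i * ?b (e i) v) + k * (p i * ?b v (e i))
      + p i * (real k * (real k - 1) * ?b v v + k * ?D))"
  proof (intro sum.cong refl)
    fix i assume "i \<in> {..<m}"
    \<comment> \<open>The square of the sign is 1, so this term depends only on the diagonal of
      \<open>M\<close>; it is the source of the \<open>?D\<close> summand.\<close>
    then have "?b (e i) (e i) = M i i"
      using ss[of i] by (simp add: e bform_unit_left if_distrib cong: if_cong)
    then show "p i * ?G (\<lambda>j. real_of_int (u j + e i j)) = p i * (?b u u) + p i * ?b u (e i) + p i * ?b (e i) u + p i * M i i
      + p i * (k * (?b u v + ?b v u)) + k * (p i * ?b (e i) v) + k * (p i * ?b v (e i))
      + p i * (real k * (real k - 1) * ?b v v + k * ?D)"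
      by (simp add: bform_add_left bform_add_right algebra_simps)
  qed
  also have "\<dots> = ?b u u + ?b u v + ?b v u + ?D + k * (?b u v + ?b v u) + k * ?b v v + k * ?b v v
      + (real k * (real k - 1) * ?b v v + k * ?D)"
    by (simp only: sum.distrib avg_right avg_left[OF refl refl] p(2) mult_1
        flip: sum_distrib_left sum_distrib_right)
  also have "\<dots> = ?b u u + Suc k * (?b u v + ?b v u)
      + real (Suc k) * (real (Suc k) - 1) * ?b v v + Suc k * ?D"
    by (simp add: algebra_simps)
  finally show ?case .
qed

text \<open>Let \<open>M\<close> be \<open>Q\<close> minus 2/3 of the identity. It is nonnegative on
  short integer vectors, so \<open>maurey_bform_nonneg\<close> applies to \<open>v = z / S\<close>,
  where \<open>S\<close> is the l1-norm of \<open>z\<close>. Since \<open>z\<close> is in the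
  kernel, \<open>M\<close> is -2/3 of the squared norm at \<open>v\<close>, while the diagonal of
  \<open>M\<close> is at most 2/3; the two constants cancel.\<close>

lemma kernel_l2_le_l1:
  fixes z :: "nat \<Rightarrow> real"
  assumes near: "\<And>w :: nat \<Rightarrow> int. (\<Sum>i<m. \<bar>w i\<bar>) \<le> int L \<Longrightarrow>
      \<bar>bform m Q (\<lambda>i. real_of_int (w i)) (\<lambda>i. real_of_int (w i)) - (\<Sum>i<m. (real_of_int (w i))\<^sup>2)\<bar>
        \<le> (\<Sum>i<m. (real_of_int (w i))\<^sup>2) / 3"
    and L: "0 < L" and z: "bform m Q z z = 0"
  shows "(real L - 1) * (\<Sum>i<m. (z i)\<^sup>2) \<le> (\<Sum>i<m. \<bar>z i\<bar>)\<^sup>2"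
proof (cases "(\<Sum>i<m. \<bar>z i\<bar>) = 0")
  case True
  then have "\<forall>i\<in>{..<m}. z i = 0" by (subst (asm) sum_nonneg_eq_0_iff) auto
  then show ?thesis by simp
next
  case False
  define S where "S = (\<Sum>i<m. \<bar>z i\<bar>)"
  have S: "S > 0" using False by (simp add: S_def order_less_le sum_nonneg)
  define p where "p i = \<bar>z i\<bar> / S" for i
  define s :: "nat \<Rightarrow> int" where "s i = (if z i < 0 then -1 else 1)" for i
  define v where "v = (\<lambda>i. p i * real_of_int (s i))"
  define M where "M i j = Q i j - (if i = j then 2 / 3 else 0)" for i j
  have M: "bform m M x x = bform m Q x x - 2 / 3 * (\<Sum>i<m. (x i)\<^sup>2)" for x
  proof -
    have "bform m M x x = bform m Q x x - (\<Sum>i<m. \<Sum>j<m. if i = j then 2 / 3 * (x i)\<^sup>2 else 0)"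
      unfolding bform_def M_def sum_subtractf[symmetric]
      by (intro sum.cong refl) (simp add: algebra_simps power2_eq_square)
    then show ?thesis by (simp add: sum_distrib_left)
  qed
  have vz: "v i = 1 / S * z i" for i
    by (simp add: v_def p_def s_def)
  have p1: "(\<Sum>i<m. p i) = 1"
    using S by (simp add: p_def S_def flip: sum_divide_distrib)
  \<comment> \<open>Start at the zero vector and take \<open>L\<close> steps; zero is written
    through \<open>real_of_int\<close> to match the integer start of Maurey's walk.\<close>
  have "0 \<le> bform m M (\<lambda>i. real_of_int 0) (\<lambda>i. real_of_int 0)
      + L * (bform m M (\<lambda>i. real_of_int 0) v + bform m M v (\<lambda>i. real_of_int 0))
      + real L * (real L - 1) * bform m M v v + L * (\<Sum>i<m. p i * M i i)"
  proof (rule maurey_bform_nonneg[OF _ _ p1 _ v_def])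
    fix w :: "nat \<Rightarrow> int" assume "(\<Sum>i<m. \<bar>w i\<bar>) \<le> int L"
    from near[OF this] show "0 \<le> bform m M (\<lambda>i. real_of_int (w i)) (\<lambda>i. real_of_int (w i))"
      unfolding M by linarith
  qed (use S in \<open>auto simp: p_def s_def\<close>)
  moreover have "bform m M (\<lambda>i. 0) x = 0" "bform m M x (\<lambda>i. 0) = 0" for x
    by (simp_all add: bform_def)
  ultimately have "0 \<le> real L * ((real L - 1) * bform m M v v + (\<Sum>i<m. p i * M i i))"
    by (simp add: algebra_simps)
  then have pos: "0 \<le> (real L - 1) * bform m M v v + (\<Sum>i<m. p i * M i i)"
    using L by (simp add: zero_le_mult_iff)
  have "(\<Sum>i<m. p i * M i i) \<le> (\<Sum>i<m. p i * (2 / 3))"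
  proof (intro sum_mono mult_left_mono)
    fix i assume "i \<in> {..<m}"
    \<comment> \<open>Unit vectors are short integer vectors because \<open>0 < L\<close>, so
      \<open>near\<close> bounds the diagonal entry by 4/3.\<close>
    define w :: "nat \<Rightarrow> int" where "w = (\<lambda>j. if j = i then 1 else 0)"
    have w: "(\<lambda>j. real_of_int (w j)) = (\<lambda>j. if j = i then 1 else 0)"
      by (auto simp: w_def)
    have "(\<Sum>j<m. \<bar>w j\<bar>) = (\<Sum>j<m. if j = i then 1 else 0)"
      by (intro sum.cong refl) (simp add: w_def)
    then have le: "(\<Sum>j<m. \<bar>w j\<bar>) \<le> int L"
      using L \<open>i \<in> {..<m}\<close> by simp
    have "bform m Q (\<lambda>i. real_of_int (w i)) (\<lambda>i. real_of_int (w i)) = Q i i"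
      using \<open>i \<in> {..<m}\<close> by (simp add: w bform_unit_left if_distrib cong: if_cong)
    moreover have "(\<Sum>j<m. (real_of_int (w j))\<^sup>2) = (\<Sum>j<m. if j = i then 1 else 0)"
      by (intro sum.cong refl) (simp add: w_def)
    then have "(\<Sum>j<m. (real_of_int (w j))\<^sup>2) = 1"
      using \<open>i \<in> {..<m}\<close> by simp
    ultimately have "\<bar>Q i i - 1\<bar> \<le> 1 / 3"
      using near[OF le] by simp
    then have "Q i i \<le> 4 / 3" by linarith
    then show "M i i \<le> 2 / 3" by (simp add: M_def)
  qed (use S in \<open>simp add: p_def\<close>)
  also have "\<dots> = 2 / 3"
    by (simp only: p1 mult_1 flip: sum_distrib_right)
  finally have "0 \<le> (real L - 1) * bform m M v v + 2 / 3" using pos by linarith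
  also have "bform m M v v = 1 / S\<^sup>2 * (bform m Q z z - 2 / 3 * (\<Sum>i<m. (z i)\<^sup>2))"
    unfolding M[symmetric] vz[abs_def] bform_scale by (simp add: power2_eq_square)
  finally have "0 \<le> 2 / 3 * (1 - (real L - 1) * (\<Sum>i<m. (z i)\<^sup>2) / S\<^sup>2)"
    by (simp add: z right_diff_distrib)
  then have "(real L - 1) * (\<Sum>i<m. (z i)\<^sup>2) / S\<^sup>2 \<le> 1" by simp
  then show ?thesis
    using S by (simp add: S_def[symmetric] divide_le_eq)
qed

text \<open>By Cauchy-Schwarz the squared l1-norm on \<open>I\<close> is at most \<open>r\<close>
  times the squared l2-norm, and \<open>9 * r <= 10 * r - 1\<close>. So
  \<open>kernel_l2_le_l1\<close> bounds three times the l1-norm on \<open>I\<close> by the full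
  l1-norm, and one of the three parts cancels.\<close>

lemma kernel_null_space_property:
  fixes z :: "nat \<Rightarrow> real"
  assumes near: "\<And>w :: nat \<Rightarrow> int. (\<Sum>i<m. \<bar>w i\<bar>) \<le> int (10 * r) \<Longrightarrow>
      \<bar>bform m Q (\<lambda>i. real_of_int (w i)) (\<lambda>i. real_of_int (w i)) - (\<Sum>i<m. (real_of_int (w i))\<^sup>2)\<bar>
        \<le> (\<Sum>i<m. (real_of_int (w i))\<^sup>2) / 3"
    and r: "0 < r" and z: "bform m Q z z = 0" and I: "I \<subseteq> {..<m}" "card I = r"
  shows "2 * (\<Sum>i\<in>I. \<bar>z i\<bar>) \<le> (\<Sum>i\<in>{..<m} - I. \<bar>z i\<bar>)"
proof -
  have fin: "finite I" using I finite_subset by blast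
  have "(\<Sum>i\<in>I. \<bar>z i\<bar> * 1)\<^sup>2 \<le> (\<Sum>i\<in>I. \<bar>z i\<bar>\<^sup>2) * (\<Sum>i\<in>I. 1\<^sup>2)"
    by (rule Cauchy_Schwarz_ineq_sum)
  also have "\<dots> \<le> (\<Sum>i<m. (z i)\<^sup>2) * real r"
    using I by (auto intro!: mult_right_mono sum_mono2)
  finally have "9 * (\<Sum>i\<in>I. \<bar>z i\<bar>)\<^sup>2 \<le> 9 * real r * (\<Sum>i<m. (z i)\<^sup>2)"
    by (simp add: mult.commute)
  also have "\<dots> \<le> (real (10 * r) - 1) * (\<Sum>i<m. (z i)\<^sup>2)"
    using r by (intro mult_right_mono sum_nonneg) auto
  also have "\<dots> \<le> (\<Sum>i<m. \<bar>z i\<bar>)\<^sup>2"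
    by (rule kernel_l2_le_l1[OF near _ z]) (use r in simp_all)
  finally have "(3 * (\<Sum>i\<in>I. \<bar>z i\<bar>))\<^sup>2 \<le> (\<Sum>i<m. \<bar>z i\<bar>)\<^sup>2"
    by (simp add: power_mult_distrib)
  then have "3 * (\<Sum>i\<in>I. \<bar>z i\<bar>) \<le> (\<Sum>i<m. \<bar>z i\<bar>)"
    by (rule power2_le_imp_le) (simp add: sum_nonneg)
  also have "(\<Sum>i<m. \<bar>z i\<bar>) = (\<Sum>i\<in>I. \<bar>z i\<bar>) + (\<Sum>i\<in>{..<m} - I. \<bar>z i\<bar>)"
    using I by (subst sum.subset_diff[of I]) auto
  finally show ?thesis by simp
qed

subsection \<open>Faces of symmetric polyhedra\<close>

lemma affine_line_kernel:
  fixes f :: "'a::real_vector \<Rightarrow> real"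
  assumes W: "subspace W" and f: "linear f" and a: "a \<in> W" "f a \<noteq> 0"
    and B: "{x \<in> W. f x = 0} \<subseteq> span B"
  shows "W \<subseteq> span (insert a B)"
proof
  fix x assume x: "x \<in> W"
  let ?c = "f x / f a"
  have "x - ?c *\<^sub>R a \<in> {x \<in> W. f x = 0}"
    using W f a x by (simp add: linear_diff linear_scale subspace_diff subspace_scale)
  then have "x - ?c *\<^sub>R a \<in> span B" using B by blast
  then show "x \<in> span (insert a B)" by (auto simp: span_insert)
qed

lemma subspace_kernel_on:
  fixes f :: "'a::real_vector \<Rightarrow> real"
  shows "subspace W \<Longrightarrow> linear f \<Longrightarrow> subspace {x \<in> W. f x = 0}"
  by (auto simp: subspace_def linear_add linear_scale linear_0)

text \<open>Rank-nullity for one functional. The finite spanning set is there because the ambient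
  space may be infinite-dimensional, where \<open>dim\<close> of a subspace need not measure its
  size.\<close>

lemma dim_kernel:
  fixes f :: "'a::real_vector \<Rightarrow> real"
  assumes W: "subspace W" and fin: "finite B" "W \<subseteq> span B" and f: "linear f"
    and a: "a \<in> W" "f a \<noteq> 0"
  shows "dim W = Suc (dim {x \<in> W. f x = 0})"
proof -
  let ?K = "{x \<in> W. f x = 0}"
  have K: "subspace ?K" by (rule subspace_kernel_on[OF W f])
  obtain C where C: "C \<subseteq> ?K" "independent C" "?K \<subseteq> span C" "card C = dim ?K"
    using basis_exists by blast
  have sC: "span C = ?K" using C K by (meson span_minimal subset_antisym)
  have "finite C"
    using independent_span_bound[OF fin(1) C(2)] C(1) fin(2) by blast
  have "a \<notin> span C" using a sC by simp
  then have ind: "independent (insert a C)" and "a \<notin> C"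
    using C(2) by (simp_all add: independent_insertI) (use span_base in blast)
  have "W \<subseteq> span (insert a C)"
    by (rule affine_line_kernel[OF W f a C(3)])
  moreover have "insert a C \<subseteq> W" using C(1) a by blast
  ultimately have "dim W = card (insert a C)"
    using ind by (intro dim_unique) auto
  then show ?thesis using \<open>finite C\<close> \<open>a \<notin> C\<close> C(4) by simp
qed

text \<open>Each functional lowers the dimension by at most one, and nothing is left after the
  last.\<close>

lemma separated_finite_span:
  fixes g :: "'i \<Rightarrow> 'a::real_vector \<Rightarrow> real"
  assumes "finite I" "subspace W" "\<And>i. i \<in> I \<Longrightarrow> linear (g i)"
    and "\<And>x. x \<in> W \<Longrightarrow> (\<forall>i\<in>I. g i x = 0) \<Longrightarrow> x = 0"
  shows "\<exists>B. finite B \<and> W \<subseteq> span B"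
  using assms
proof (induction I arbitrary: W rule: finite_induct)
  case empty
  then have "W \<subseteq> span {}" by auto
  then show ?case by blast
next
  case (insert i I)
  let ?K = "{x \<in> W. g i x = 0}"
  have K: "subspace ?K" using insert.prems by (intro subspace_kernel_on) auto
  obtain B where B: "finite B" "?K \<subseteq> span B"
    using insert.IH[OF K] insert.prems by auto
  show ?case
  proof (cases "\<exists>a\<in>W. g i a \<noteq> 0")
    case True
    then obtain a where a: "a \<in> W" "g i a \<noteq> 0" by blast
    have "W \<subseteq> span (insert a B)"
      using insert.prems a B by (intro affine_line_kernel[of W "g i"]) auto
    then show ?thesis using B by blast
  next
    case False
    then have "W = ?K" by blast
    then show ?thesis using B by metis
  qed
qed

text \<open>Instantiated twice: for sections of the cube, with \<open>J = {..<m}\<close> and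
  \<open>g\<close> the coordinates, and for arbitrary symmetric polytopes, where \<open>J\<close> is
  a set of functionals and \<open>g\<close> is application. \<open>separating\<close> embeds
  \<open>W\<close> into the functions on \<open>J\<close>; it makes \<open>W\<close>
  finite-dimensional and the body bounded.\<close>

locale sym_polyhedron =
  fixes W :: "'a::real_vector set" and J :: "'i set" and g :: "'i \<Rightarrow> 'a \<Rightarrow> real"
  assumes subspace_W: "subspace W" and finite_J: "finite J"
    and linear_g: "i \<in> J \<Longrightarrow> linear (g i)"
    and separating: "x \<in> W \<Longrightarrow> (\<And>i. i \<in> J \<Longrightarrow> g i x = 0) \<Longrightarrow> x = 0"
begin

definition body :: "'a set" where
  "body = {x \<in> W. \<forall>i\<in>J. \<bar>g i x\<bar> \<le> 1}"

text \<open>The direction space of a face whose tight constraints are those in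
  \<open>I\<close>.\<close>

definition kern :: "'i set \<Rightarrow> 'a set" where
  "kern I = {x \<in> W. \<forall>i\<in>I. g i x = 0}"

definition tight :: "'a \<Rightarrow> 'i set" where
  "tight x = {i \<in> J. \<bar>g i x\<bar> = 1}"

definition sect :: "'i set \<Rightarrow> ('i \<Rightarrow> real) \<Rightarrow> 'a set" where
  "sect I e = {x \<in> body. \<forall>i\<in>I. g i x = e i}"

text \<open>Labels of the candidate faces of codimension \<open>k\<close>. The sign functions are
  extensional on \<open>I\<close>, so distinct labels differ in \<open>I\<close> or at a point of
  \<open>I\<close>.\<close>

definition patterns :: "nat \<Rightarrow> ('i set \<times> ('i \<Rightarrow> real)) set" where
  "patterns k = (SIGMA I : {I. I \<subseteq> J \<and> card I = k}. signs I)"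

definition hits_patterns :: "nat \<Rightarrow> bool" where
  "hits_patterns k \<longleftrightarrow> (\<forall>I e. (I, e) \<in> patterns k \<longrightarrow>
     (\<exists>x\<in>W. (\<forall>i\<in>I. g i x = e i) \<and> (\<forall>j\<in>J - I. \<bar>g j x\<bar> < 1)))"

lemma g_add: "i \<in> J \<Longrightarrow> g i (x + y) = g i x + g i y"
  and g_diff: "i \<in> J \<Longrightarrow> g i (x - y) = g i x - g i y"
  and g_scale: "i \<in> J \<Longrightarrow> g i (c *\<^sub>R x) = c * g i x"
  and g_minus: "i \<in> J \<Longrightarrow> g i (- x) = - g i x"
  and g_zero: "i \<in> J \<Longrightarrow> g i 0 = 0"
  using linear_g[of i] by (simp_all add: linear_add linear_diff linear_scale linear_neg linear_0)

lemma W_add: "x \<in> W \<Longrightarrow> y \<in> W \<Longrightarrow> x + y \<in> W"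
  and W_diff: "x \<in> W \<Longrightarrow> y \<in> W \<Longrightarrow> x - y \<in> W"
  and W_scale: "x \<in> W \<Longrightarrow> c *\<^sub>R x \<in> W"
  and W_minus: "x \<in> W \<Longrightarrow> - x \<in> W"
  and W_zero: "0 \<in> W"
  using subspace_W by (simp_all add: subspace_add subspace_diff subspace_scale subspace_neg subspace_0)

lemma tight_subset: "tight x \<subseteq> J"
  by (auto simp: tight_def)

lemma finite_subset_J: "I \<subseteq> J \<Longrightarrow> finite I"
  using finite_J finite_subset by blast

lemma finite_span_W: "\<exists>B. finite B \<and> W \<subseteq> span B"
  by (rule separated_finite_span[OF finite_J subspace_W linear_g]) (auto intro: separating)

lemma subspace_kern: "I \<subseteq> J \<Longrightarrow> subspace (kern I)"
  unfolding kern_def subspace_def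
  by (auto simp: W_zero W_add W_scale g_zero g_add g_scale subset_iff)

lemma dim_kern_insert:
  assumes "I \<subseteq> J" "t \<in> J" "x \<in> kern I" "g t x \<noteq> 0"
  shows "dim (kern I) = Suc (dim (kern (insert t I)))"
proof -
  obtain B where B: "finite B" "W \<subseteq> span B" using finite_span_W by blast
  have "kern I \<subseteq> span B" using B by (auto simp: kern_def)
  from dim_kernel[OF subspace_kern[OF assms(1)] B(1) this linear_g[OF assms(2)] assms(3,4)]
  have "dim (kern I) = Suc (dim {x \<in> kern I. g t x = 0})" .
  moreover have "{x \<in> kern I. g t x = 0} = kern (insert t I)" by (auto simp: kern_def)
  ultimately show ?thesis by simp
qed

lemma kern_empty: "kern {} = W"
  by (simp add: kern_def)

text \<open>The equation \<open>dim (kern I) + card I = dim W\<close> says that the functionals in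
  \<open>I\<close> are independent on \<open>W\<close>. As long as the kernel is larger than
  \<open>kern T\<close>, some functional in \<open>T\<close> is nonzero on it and can be added. The
  freedom to prescribe \<open>I0\<close> is used in \<open>card_faces_eq_imp_hits\<close>.\<close>

lemma independent_extend:
  assumes "I0 \<subseteq> T" "T \<subseteq> J" "dim (kern I0) + card I0 = dim W"
  shows "\<exists>I. I0 \<subseteq> I \<and> I \<subseteq> T \<and> kern I = kern T \<and> dim (kern I) + card I = dim W"
  using assms
proof (induction "card (T - I0)" arbitrary: I0 rule: less_induct)
  case less
  show ?case
  proof (cases "kern I0 = kern T")
    case True
    then show ?thesis using less.prems by blast
  next
    case False
    have "kern T \<subseteq> kern I0" using less.prems by (auto simp: kern_def)
    then obtain x where x: "x \<in> kern I0" "x \<notin> kern T" using False by blast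
    then obtain t where t: "t \<in> T" "g t x \<noteq> 0" by (auto simp: kern_def)
    then have "t \<notin> I0" using x by (auto simp: kern_def)
    have fin: "finite T" "finite I0" using less.prems finite_subset_J by auto
    have "dim (kern I0) = Suc (dim (kern (insert t I0)))"
      using less.prems t x by (intro dim_kern_insert[of _ _ x]) auto
    then have "dim (kern (insert t I0)) + card (insert t I0) = dim W"
      using less.prems \<open>t \<notin> I0\<close> fin by simp
    moreover have "card (T - insert t I0) < card (T - I0)"
      using t \<open>t \<notin> I0\<close> fin by (intro psubset_card_mono) auto
    ultimately show ?thesis
      using less.hyps[of "insert t I0"] less.prems t by auto
  qed
qed

section \<open>Faces as sections by tight constraints\<close>

lemma convex_body: "convex body"
  unfolding convex_def body_def
proof (intro ballI allI impI, safe)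
  fix x y and u v :: real and i
  assume uv: "0 \<le> u" "0 \<le> v" "u + v = 1" and i: "i \<in> J"
    and x: "\<forall>i\<in>J. \<bar>g i x\<bar> \<le> 1" and y: "\<forall>i\<in>J. \<bar>g i y\<bar> \<le> 1"
  have "\<bar>g i (u *\<^sub>R x + v *\<^sub>R y)\<bar> \<le> u * \<bar>g i x\<bar> + v * \<bar>g i y\<bar>"
    using uv i by (simp add: g_add g_scale) (metis abs_mult abs_of_nonneg abs_triangle_ineq)
  also have "\<dots> \<le> u * 1 + v * 1"
    using uv i x y by (intro add_mono mult_left_mono) auto
  finally show "\<bar>g i (u *\<^sub>R x + v *\<^sub>R y)\<bar> \<le> 1" using uv by simp
qed (auto intro: W_add W_scale)

lemma zero_in_body: "0 \<in> body"
  by (simp add: body_def W_zero g_zero)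

lemma uminus_body: "uminus ` body = body"
proof -
  have "- x \<in> body" if "x \<in> body" for x
    using that by (simp add: body_def W_minus g_minus)
  then show ?thesis by (auto simp: image_iff intro: bexI[of _ "- _"]) (metis minus_minus)
qed

text \<open>The values \<open>e i\<close> are signs, so \<open>1 - e i * g i\<close> is nonnegative
  on the body; if a proper convex combination of two such values vanishes, both vanish.\<close>

lemma sect_face:
  assumes I: "I \<subseteq> J" and e: "\<And>i. i \<in> I \<Longrightarrow> \<bar>e i\<bar> = 1"
  shows "sect I e face_of body"
  unfolding face_of_def
proof (intro conjI ballI impI)
  show "sect I e \<subseteq> body" by (auto simp: sect_def)
  show "convex (sect I e)"
    unfolding convex_def
  proof (intro ballI allI impI)
    fix x y and u v :: real
    assume xy: "x \<in> sect I e" "y \<in> sect I e" and uv: "0 \<le> u" "0 \<le> v" "u + v = 1"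
    then have "u *\<^sub>R x + v *\<^sub>R y \<in> body"
      using convex_body by (auto simp: sect_def convex_def)
    moreover have "g i (u *\<^sub>R x + v *\<^sub>R y) = e i" if "i \<in> I" for i
      using xy uv that I by (auto simp: sect_def g_add g_scale subset_iff simp flip: distrib_right)
    ultimately show "u *\<^sub>R x + v *\<^sub>R y \<in> sect I e" by (simp add: sect_def)
  qed
next
  fix a b x assume ab: "a \<in> body" "b \<in> body" and x: "x \<in> sect I e" "x \<in> open_segment a b"
  obtain u where u: "0 < u" "u < 1" "x = (1 - u) *\<^sub>R a + u *\<^sub>R b"
    using x(2) by (auto simp: in_segment)
  have "g i a = e i \<and> g i b = e i" if "i \<in> I" for i
  proof -
    have i: "i \<in> J" using that I by blast
    have eq: "(1 - u) * g i a + u * g i b = e i"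
      using x(1) u that i by (auto simp: sect_def g_add g_scale)
    have "\<bar>g i a\<bar> \<le> 1" "\<bar>g i b\<bar> \<le> 1" using ab i by (auto simp: body_def)
    moreover have "e i = 1 \<or> e i = -1" using e[OF that] by (auto simp: abs_if split: if_splits)
    ultimately have pos: "0 \<le> 1 - e i * g i a" "0 \<le> 1 - e i * g i b" and ee: "e i * e i = 1"
      by (auto simp: abs_le_iff)
    have "(1 - u) * (1 - e i * g i a) + u * (1 - e i * g i b) = 1 - e i * ((1 - u) * g i a + u * g i b)"
      by (simp add: algebra_simps)
    also have "\<dots> = 0" using eq ee by simp
    finally have "(1 - u) * (1 - e i * g i a) + u * (1 - e i * g i b) = 0" .
    moreover have "0 \<le> (1 - u) * (1 - e i * g i a)" "0 \<le> u * (1 - e i * g i b)"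
      using pos u by (auto intro: mult_nonneg_nonneg)
    ultimately have "(1 - u) * (1 - e i * g i a) = 0" "u * (1 - e i * g i b) = 0"
      by linarith+
    then have "e i * g i a = 1" "e i * g i b = 1" using u by auto
    then have "e i * (e i * g i a) = e i" "e i * (e i * g i b) = e i" by simp_all
    then show ?thesis using ee by (simp flip: mult.assoc)
  qed
  then show "a \<in> sect I e" "b \<in> sect I e" using ab by (auto simp: sect_def)
qed

text \<open>Along \<open>v\<close> the tight constraints are constant, and the finitely many slack
  ones stay slack for a short time in both directions. So \<open>x\<close> is a relative interior
  point of the section through its tight constraints.\<close>

lemma perturb:
  assumes x: "x \<in> body" and v: "v \<in> kern (tight x)"
  shows "\<exists>d>0. \<forall>t. \<bar>t\<bar> \<le> d \<longrightarrow> x + t *\<^sub>R v \<in> sect (tight x) (\<lambda>i. g i x)"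
proof -
  have "\<forall>\<^sub>F t in at_right 0. \<bar>g i x\<bar> + t * \<bar>g i v\<bar> < 1" if "i \<in> J - tight x" for i
  proof -
    have "((\<lambda>t. \<bar>g i x\<bar> + t * \<bar>g i v\<bar>) \<longlongrightarrow> \<bar>g i x\<bar> + 0 * \<bar>g i v\<bar>) (at_right 0)"
      by (intro tendsto_intros)
    moreover have "\<bar>g i x\<bar> + 0 * \<bar>g i v\<bar> < 1"
      using that x by (force simp: tight_def body_def)
    ultimately show ?thesis by (rule order_tendstoD(2))
  qed
  then have "\<forall>\<^sub>F t in at_right 0. \<forall>i\<in>J - tight x. \<bar>g i x\<bar> + t * \<bar>g i v\<bar> < 1"
    using finite_J by (intro eventually_ball_finite) auto
  then obtain b where b: "b > 0" "\<And>t. 0 < t \<Longrightarrow> t < b \<Longrightarrow> \<forall>i\<in>J - tight x. \<bar>g i x\<bar> + t * \<bar>g i v\<bar> < 1"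
    by (auto simp: eventually_at_right_field)
  show ?thesis
  proof (intro exI[of _ "b / 2"] conjI allI impI)
    fix t :: real assume t: "\<bar>t\<bar> \<le> b / 2"
    have "\<bar>g i (x + t *\<^sub>R v)\<bar> \<le> 1" if i: "i \<in> J" for i
    proof (cases "i \<in> tight x")
      case True
      then show ?thesis using v i by (simp add: kern_def g_add g_scale tight_def)
    next
      case False
      have "\<bar>g i (x + t *\<^sub>R v)\<bar> \<le> \<bar>g i x\<bar> + \<bar>t\<bar> * \<bar>g i v\<bar>"
        using i by (simp add: g_add g_scale flip: abs_mult)
      also have "\<dots> \<le> \<bar>g i x\<bar> + b / 2 * \<bar>g i v\<bar>"
        using t by (intro add_left_mono mult_right_mono) auto
      also have "\<dots> < 1" using b(1) b(2)[of "b / 2"] False i by simp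
      finally show ?thesis by simp
    qed
    moreover have "g i (x + t *\<^sub>R v) = g i x" if "i \<in> tight x" for i
      using that v subsetD[OF tight_subset that] by (simp add: kern_def g_add g_scale)
    ultimately show "x + t *\<^sub>R v \<in> sect (tight x) (\<lambda>i. g i x)"
      using x v by (auto simp: sect_def body_def kern_def W_add W_scale)
  qed (use b in auto)
qed

lemma affdim_sect_tight:
  assumes x: "x \<in> body"
  shows "affdim (sect (tight x) (\<lambda>i. g i x)) = int (dim (kern (tight x)))"
proof -
  define F where "F = sect (tight x) (\<lambda>i. g i x)"
  define D where "D = {a - b |a b. a \<in> F \<and> b \<in> F}"
  have xF: "x \<in> F" using x by (simp add: F_def sect_def)
  have "c \<in> kern (tight x)" if c: "c \<in> D" for c
  proof -
    obtain a b where ab: "c = a - b" "a \<in> F" "b \<in> F" using c unfolding D_def by blast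
    then have "a \<in> W" "b \<in> W" by (simp_all add: F_def sect_def body_def)
    moreover have "g i (a - b) = 0" if "i \<in> tight x" for i
      using ab(2,3) that subsetD[OF tight_subset that] by (simp add: F_def sect_def g_diff)
    ultimately show ?thesis by (simp add: ab(1) kern_def W_diff)
  qed
  then have "D \<subseteq> kern (tight x)" by blast
  then have "span D \<subseteq> kern (tight x)"
    by (rule span_minimal[OF _ subspace_kern[OF tight_subset]])
  moreover have "kern (tight x) \<subseteq> span D"
  proof
    fix v assume "v \<in> kern (tight x)"
    from perturb[OF x this] obtain d where d: "d > 0"
      "\<forall>t. \<bar>t\<bar> \<le> d \<longrightarrow> x + t *\<^sub>R v \<in> F" unfolding F_def by blast
    then have "x + d *\<^sub>R v \<in> F" by simp
    then have "(x + d *\<^sub>R v) - x \<in> D" using xF unfolding D_def by blast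
    then have "(1 / d) *\<^sub>R ((x + d *\<^sub>R v) - x) \<in> span D" by (rule span_scale[OF span_base])
    then show "v \<in> span D" using d(1) by simp
  qed
  ultimately have "span D = kern (tight x)" by (rule subset_antisym)
  then have "dim D = dim (kern (tight x))" by (metis dim_span)
  moreover have "F \<noteq> {}" using xF by blast
  ultimately show ?thesis unfolding affdim_def F_def[symmetric] D_def[symmetric] by (simp only: if_False)
qed

text \<open>By \<open>perturb\<close> the segment from \<open>y\<close> to \<open>x\<close> can be
  prolonged beyond \<open>x\<close> inside the body, which puts \<open>x\<close> in an open segment
  starting at \<open>y\<close>.\<close>

lemma sect_tight_subset_face:
  assumes F: "F face_of body" and x: "x \<in> F"
  shows "sect (tight x) (\<lambda>i. g i x) \<subseteq> F"
proof
  fix y assume y: "y \<in> sect (tight x) (\<lambda>i. g i x)"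
  have xb: "x \<in> body" using F x by (auto simp: face_of_def)
  have "x - y \<in> kern (tight x)"
    using xb y tight_subset by (auto simp: kern_def sect_def body_def W_diff g_diff subset_iff)
  from perturb[OF xb this] obtain d where d: "d > 0" "x + d *\<^sub>R (x - y) \<in> sect (tight x) (\<lambda>i. g i x)"
    by force
  show "y \<in> F"
  proof (cases "x = y")
    case False
    let ?z = "x + d *\<^sub>R (x - y)"
    \<comment> \<open>The point \<open>?z\<close> lies \<open>d\<close> times the distance from
      \<open>y\<close> to \<open>x\<close> beyond \<open>x\<close>; this fixes the weights.\<close>
    have "x = (1 - 1 / (1 + d)) *\<^sub>R y + (1 / (1 + d)) *\<^sub>R ?z"
    proof -
      have "(1 - 1 / (1 + d)) *\<^sub>R y + (1 / (1 + d)) *\<^sub>R ?z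
          = (1 / (1 + d) + 1 / (1 + d) * d) *\<^sub>R x + (1 - 1 / (1 + d) - 1 / (1 + d) * d) *\<^sub>R y"
        by (simp add: algebra_simps)
      also have "1 / (1 + d) + 1 / (1 + d) * d = 1" using d by (simp add: field_simps)
      finally show ?thesis using d by (simp add: field_simps)
    qed
    moreover have "y \<noteq> ?z"
    proof
      assume "y = ?z"
      then have "(1 + d) *\<^sub>R (x - y) = 0" by (simp add: algebra_simps)
      then show False using d False by simp
    qed
    ultimately have "x \<in> open_segment y ?z"
      using d unfolding in_segment by (intro conjI exI[of _ "1 / (1 + d)"]) auto
    then show ?thesis
      using face_ofD[OF F _ _ _ x] y d by (auto simp: sect_def)
  qed (use x in simp)
qed

text \<open>A point of \<open>F\<close> with the fewest tight constraints is generic: a constraint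
  tight at its midpoint with \<open>y\<close> is tight at both with the same value, so by minimality
  every constraint tight at \<open>x\<close> has the same value at \<open>y\<close>.\<close>

lemma face_eq_sect:
  assumes F: "F face_of body" "F \<noteq> {}"
  shows "\<exists>x\<in>F. F = sect (tight x) (\<lambda>i. g i x)"
proof -
  obtain x where x: "x \<in> F" and min: "\<And>y. y \<in> F \<Longrightarrow> card (tight x) \<le> card (tight y)"
    using F(2) ex_has_least_nat[of "\<lambda>x. x \<in> F" _ "\<lambda>x. card (tight x)"] by blast
  have Fb: "F \<subseteq> body" "convex F" using F by (auto simp: face_of_def)
  have "F \<subseteq> sect (tight x) (\<lambda>i. g i x)"
  proof
    fix y assume y: "y \<in> F"
    let ?z = "(1 / 2) *\<^sub>R x + (1 / 2) *\<^sub>R y"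
    have z: "?z \<in> F" using Fb(2) x y by (auto simp: convex_def)
    have xy: "\<bar>g i x\<bar> \<le> 1" "\<bar>g i y\<bar> \<le> 1" if "i \<in> J" for i
      using x y Fb that by (auto simp: body_def)
    have mid: "g i x = g i y \<and> i \<in> tight x" if "i \<in> tight ?z" for i
    proof -
      have i: "i \<in> J" "\<bar>g i x / 2 + g i y / 2\<bar> = 1"
        using that by (auto simp: tight_def g_add g_scale)
      then show ?thesis using xy[OF i(1)] by (auto simp: tight_def abs_if split: if_splits)
    qed
    then have "tight ?z \<subseteq> tight x" by blast
    moreover have "finite (tight x)" by (rule finite_subset_J[OF tight_subset])
    ultimately have "tight ?z = tight x"
      using min[OF z] by (simp add: card_seteq)
    then show "y \<in> sect (tight x) (\<lambda>i. g i x)"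
      using mid y Fb by (auto simp: sect_def)
  qed
  then show ?thesis using sect_tight_subset_face[OF F(1) x] x by blast
qed

lemma sect_cong: "(\<And>i. i \<in> I \<Longrightarrow> e i = e' i) \<Longrightarrow> sect I e = sect I e'"
  by (auto simp: sect_def)

lemma sect_eq_sect_tight:
  assumes x: "x \<in> body" and I: "I \<subseteq> tight x" "kern I = kern (tight x)"
  shows "sect I (\<lambda>i. g i x) = sect (tight x) (\<lambda>i. g i x)"
proof
  show "sect I (\<lambda>i. g i x) \<subseteq> sect (tight x) (\<lambda>i. g i x)"
  proof
    fix y assume y: "y \<in> sect I (\<lambda>i. g i x)"
    then have "y - x \<in> kern I"
      using x I(1) subsetD[OF tight_subset] by (auto simp: kern_def sect_def body_def W_diff g_diff subset_iff)
    then have ker: "y - x \<in> kern (tight x)" using I(2) by simp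
    have "g i y = g i x" if "i \<in> tight x" for i
    proof -
      have "g i (y - x) = 0" using ker that by (simp add: kern_def)
      then show ?thesis using subsetD[OF tight_subset that] by (simp add: g_diff)
    qed
    then show "y \<in> sect (tight x) (\<lambda>i. g i x)" using y by (auto simp: sect_def)
  qed
qed (use I in \<open>auto simp: sect_def\<close>)

section \<open>Counting faces by sign patterns\<close>

lemma affdim_body: "affdim body = int (dim W)"
proof -
  have "tight 0 = {}" by (auto simp: tight_def g_zero)
  then show ?thesis
    using affdim_sect_tight[OF zero_in_body] by (simp add: sect_def kern_empty)
qed

lemma finite_patterns: "finite (patterns k)"
  unfolding patterns_def
  using finite_J by (intro finite_SigmaI) (auto intro: finite_signs finite_subset_J)

lemma card_patterns: "card (patterns k) = 2 ^ k * (card J choose k)"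
proof -
  have "finite {I. I \<subseteq> J \<and> card I = k}" using finite_J by simp
  then have "card (patterns k) = (\<Sum>I | I \<subseteq> J \<and> card I = k. card (signs I))"
    unfolding patterns_def
    by (intro card_SigmaI) (auto intro: finite_signs finite_subset_J)
  also have "\<dots> = (\<Sum>I | I \<subseteq> J \<and> card I = k. 2 ^ k)"
    by (intro sum.cong) (auto simp: card_signs finite_subset_J)
  also have "\<dots> = 2 ^ k * (card J choose k)"
    using n_subsets[OF finite_J, of k] by simp
  finally show ?thesis .
qed

lemma restrict_signs:
  assumes "I \<subseteq> tight x"
  shows "restrict (\<lambda>i. g i x) I \<in> signs I"
proof -
  have "g i x = -1 \<or> g i x = 1" if "i \<in> I" for i
  proof -
    have "\<bar>g i x\<bar> = 1" using that assms by (auto simp: tight_def)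
    then show ?thesis by linarith
  qed
  then show ?thesis by (auto simp: signs_def)
qed

text \<open>A face is cut out by the tight constraints of one of its points. There may be more than
  \<open>k\<close> of them, but an independent subfamily with the same kernel has exactly
  \<open>k\<close> members and cuts out the same face.\<close>

lemma faces_subset_patterns:
  assumes k: "k \<le> dim W"
  shows "faces body (int (dim W) - int k) \<subseteq> (\<lambda>(I, e). sect I e) ` patterns k"
proof
  fix F assume "F \<in> faces body (int (dim W) - int k)"
  then have F: "F face_of body" "affdim F = int (dim W) - int k" by (auto simp: faces_def)
  \<comment> \<open>The empty face has \<open>affdim\<close> -1, whereas the prescribed dimension is
    nonnegative.\<close>
  then have "F \<noteq> {}" using k by (auto simp: affdim_def)
  then obtain x where x: "x \<in> F" "F = sect (tight x) (\<lambda>i. g i x)" using face_eq_sect[OF F(1)] by blast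
  have xb: "x \<in> body" using F x by (auto simp: face_of_def)
  obtain I where I: "I \<subseteq> tight x" "kern I = kern (tight x)" "dim (kern I) + card I = dim W"
    using independent_extend[of "{}" "tight x"] tight_subset by (auto simp: kern_empty)
  have "int (dim (kern I)) = int (dim W) - int k"
    using affdim_sect_tight[OF xb] F(2) x(2) I(2) by simp
  then have "card I = k" using I(3) by linarith
  then have "(I, restrict (\<lambda>i. g i x) I) \<in> patterns k"
    using I(1) tight_subset restrict_signs[OF I(1)] by (auto simp: patterns_def)
  moreover have "F = sect I (restrict (\<lambda>i. g i x) I)"
    using x(2) sect_eq_sect_tight[OF xb I(1,2)] sect_cong[of I "restrict (\<lambda>i. g i x) I" "\<lambda>i. g i x"]
    by simp
  ultimately show "F \<in> (\<lambda>(I, e). sect I e) ` patterns k"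
    by (auto simp: image_iff intro!: bexI[of _ "(I, restrict (\<lambda>i. g i x) I)"])
qed

lemma card_faces_le: "k \<le> dim W \<Longrightarrow> card (faces body (int (dim W) - int k)) \<le> 2 ^ k * (card J choose k)"
  using card_mono[OF finite_imageI[OF finite_patterns] faces_subset_patterns]
    card_image_le[OF finite_patterns] card_patterns by (metis le_trans)

text \<open>Points realising two sign patterns on \<open>I\<close> that differ only at
  \<open>i\<close> have a difference that is killed by every other constraint of \<open>I\<close>
  but not by \<open>g i\<close>. So each constraint lowers the dimension.\<close>

lemma hits_patterns_dim_kern:
  assumes hit: "hits_patterns k" and I: "I \<subseteq> J" "card I = k"
  shows "dim (kern I) + k = dim W"
proof -
  have "dim (kern I') + card I' = dim W" if "finite I'" "I' \<subseteq> I" for I'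
    using that
  proof (induction I' rule: finite_induct)
    case (insert i I')
    let ?e = "\<lambda>s. (\<lambda>j\<in>I. if j = i then s else 1) :: 'i \<Rightarrow> real"
    have "(I, ?e 1) \<in> patterns k" "(I, ?e (- 1)) \<in> patterns k"
      using I by (auto simp: patterns_def signs_def)
    then obtain x y where x: "x \<in> W" "\<forall>j\<in>I. g j x = ?e 1 j" and y: "y \<in> W" "\<forall>j\<in>I. g j y = ?e (- 1) j"
      using hit unfolding hits_patterns_def by meson
    have "x - y \<in> kern I'"
      using x y insert I by (auto simp: kern_def W_diff g_diff subset_iff)
    moreover have "g i (x - y) \<noteq> 0"
      using x y insert I by (auto simp: g_diff subset_iff)
    ultimately have "dim (kern I') = Suc (dim (kern (insert i I')))"
      using insert I by (intro dim_kern_insert) auto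
    then show ?case using insert by auto
  qed (simp add: kern_empty)
  then show ?thesis using I finite_subset_J by blast
qed

lemma hits_patterns_witness:
  assumes hit: "hits_patterns k" and p: "(I, e) \<in> patterns k"
  obtains x where "x \<in> body" "tight x = I" "\<And>i. i \<in> I \<Longrightarrow> g i x = e i"
proof -
  obtain x where x: "x \<in> W" "\<forall>i\<in>I. g i x = e i" "\<forall>j\<in>J - I. \<bar>g j x\<bar> < 1"
    using hit p unfolding hits_patterns_def by meson
  have I: "I \<subseteq> J" "e \<in> signs I" using p by (auto simp: patterns_def)
  have e: "\<bar>g i x\<bar> = 1" if "i \<in> I" for i
    using signsD[OF I(2) that] x(2) that by auto
  have "tight x = I" using x(3) e I by (force simp: tight_def)
  moreover have "\<bar>g i x\<bar> \<le> 1" if "i \<in> J" for i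
    using x(3) e that by (cases "i \<in> I") (auto intro: less_imp_le)
  then have "x \<in> body" using x(1) by (simp add: body_def)
  ultimately show ?thesis using that x(2) by blast
qed

text \<open>The upper bound holds for every body. For the lower bound, a witness of
  \<open>(I, e)\<close> is tight exactly on \<open>I\<close>, so two patterns with the same section
  have index sets contained in each other, and their signs are read off a common point.\<close>

lemma card_faces_eq:
  assumes hit: "hits_patterns k" and k: "k \<le> card J"
  shows "card (faces body (int (dim W) - int k)) = 2 ^ k * (card J choose k)"
proof (rule antisym)
  \<comment> \<open>One set of size \<open>k\<close> suffices to see that the codimension
    \<open>k\<close> does not exceed \<open>dim W\<close>.\<close>
  obtain I where "I \<subseteq> J" "card I = k" using k by (meson obtain_subset_with_card_n)
  then have kW: "k \<le> dim W" using hits_patterns_dim_kern[OF hit] by (metis le_add2)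
  show "card (faces body (int (dim W) - int k)) \<le> 2 ^ k * (card J choose k)"
    by (rule card_faces_le[OF kW])
  have "inj_on (\<lambda>(I, e). sect I e) (patterns k)"
  proof (rule inj_onI, clarify)
    fix I e I' e' assume p: "(I, e) \<in> patterns k" "(I', e') \<in> patterns k" and eq: "sect I e = sect I' e'"
    obtain x where x: "x \<in> body" "tight x = I" "\<And>i. i \<in> I \<Longrightarrow> g i x = e i"
      using hits_patterns_witness[OF hit p(1)] by metis
    obtain y where y: "y \<in> body" "tight y = I'" "\<And>i. i \<in> I' \<Longrightarrow> g i y = e' i"
      using hits_patterns_witness[OF hit p(2)] by metis
    have signs: "\<And>i. i \<in> I \<Longrightarrow> \<bar>e i\<bar> = 1" "\<And>i. i \<in> I' \<Longrightarrow> \<bar>e' i\<bar> = 1"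
      using p signsD by (fastforce simp: patterns_def)+
    have "x \<in> sect I' e'" using x eq by (auto simp: sect_def)
    then have xI': "g i x = e' i" if "i \<in> I'" for i using that by (auto simp: sect_def)
    have "y \<in> sect I e" using y eq by (auto simp: sect_def)
    then have yI: "g i y = e i" if "i \<in> I" for i using that by (auto simp: sect_def)
    have "I' \<subseteq> J" "I \<subseteq> J" using p by (auto simp: patterns_def)
    then have "I' \<subseteq> tight x" "I \<subseteq> tight y" using xI' yI signs by (auto simp: tight_def subset_iff)
    then have II: "I = I'" using x(2) y(2) by blast
    have "e \<in> extensional I" "e' \<in> extensional I'"
      using p by (auto simp: patterns_def signs_def PiE_def)
    then have "e = e'"
      using II xI' x(3) by (intro extensionalityI[of _ I]) auto
    with II show "I = I' \<and> e = e'" by blast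
  qed
  then have "2 ^ k * (card J choose k) = card ((\<lambda>(I, e). sect I e) ` patterns k)"
    by (simp add: card_image card_patterns)
  also have "\<dots> \<le> card (faces body (int (dim W) - int k))"
  proof (rule card_mono)
    show "finite (faces body (int (dim W) - int k))"
      using faces_subset_patterns[OF kW] finite_patterns finite_imageI finite_subset by metis
    show "(\<lambda>(I, e). sect I e) ` patterns k \<subseteq> faces body (int (dim W) - int k)"
    proof safe
      fix I e assume p: "(I, e) \<in> patterns k"
      then have I: "I \<subseteq> J" "card I = k" "e \<in> signs I" by (auto simp: patterns_def)
      obtain x where x: "x \<in> body" "tight x = I" "\<And>i. i \<in> I \<Longrightarrow> g i x = e i"
        using hits_patterns_witness[OF hit p] by metis
      have "sect I e = sect (tight x) (\<lambda>i. g i x)"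
        using x by (auto simp: sect_def)
      then have "affdim (sect I e) = int (dim (kern I))"
        using affdim_sect_tight[OF x(1)] x(2) by simp
      also have "\<dots> = int (dim W) - int k"
        using hits_patterns_dim_kern[OF hit I(1,2)] by simp
      finally show "sect I e \<in> faces body (int (dim W) - int k)"
        using sect_face[OF I(1), of e] signsD[OF I(3)] by (fastforce simp: faces_def)
    qed
  qed
  finally show "2 ^ k * (card J choose k) \<le> card (faces body (int (dim W) - int k))" .
qed

text \<open>Add an index \<open>i\<close> to \<open>I\<close> and take the midpoint of witnesses for
  the two signs at \<open>i\<close>: its value at \<open>i\<close> is 0, and the other constraints
  are preserved.\<close>

lemma hits_patterns_pred:
  assumes hit: "hits_patterns (Suc k)" and k: "Suc k \<le> card J"
  shows "hits_patterns k"
  unfolding hits_patterns_def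
proof (intro allI impI)
  fix I e assume "(I, e) \<in> patterns k"
  then have I: "I \<subseteq> J" "card I = k" "e \<in> signs I" by (auto simp: patterns_def)
  have "I \<noteq> J" using I k by auto
  then obtain i where i: "i \<in> J" "i \<notin> I" using I by blast
  have p: "(insert i I, e(i := s)) \<in> patterns (Suc k)" if "s = 1 \<or> s = -1" for s
    using that I i finite_subset_J[OF I(1)] by (auto simp: patterns_def signs_def PiE_def extensional_def)
  obtain x where x: "x \<in> W" "\<forall>j\<in>insert i I. g j x = (e(i := 1)) j" "\<forall>j\<in>J - insert i I. \<bar>g j x\<bar> < 1"
    using hit p[of 1] unfolding hits_patterns_def by blast
  obtain y where y: "y \<in> W" "\<forall>j\<in>insert i I. g j y = (e(i := -1)) j" "\<forall>j\<in>J - insert i I. \<bar>g j y\<bar> < 1"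
    using hit p[of "-1"] unfolding hits_patterns_def by blast
  let ?z = "(1 / 2) *\<^sub>R (x + y)"
  have z: "g j ?z = (g j x + g j y) / 2" if "j \<in> J" for j
    using that by (simp add: g_add g_scale)
  have "g j ?z = e j" if "j \<in> I" for j
    using that x(2) y(2) i I by (auto simp: z subset_iff)
  moreover have "\<bar>g j ?z\<bar> < 1" if "j \<in> J - I" for j
  proof (cases "j = i")
    case True
    then show ?thesis using x(2) y(2) i by (simp add: z)
  next
    case False
    then have "\<bar>g j x\<bar> < 1" "\<bar>g j y\<bar> < 1" using that x(3) y(3) by auto
    then show ?thesis using that by (simp add: z abs_less_iff)
  qed
  moreover have "?z \<in> W" using x y by (intro W_scale W_add)
  ultimately show "\<exists>x\<in>W. (\<forall>i\<in>I. g i x = e i) \<and> (\<forall>j\<in>J - I. \<bar>g j x\<bar> < 1)" by blast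
qed

lemma hits_patterns_mono:
  assumes "hits_patterns l" "k \<le> l" "l \<le> card J"
  shows "hits_patterns k"
  using assms(2,1,3) by (induction rule: inc_induct) (auto intro: hits_patterns_pred)

text \<open>Equality in the count forces each pattern to give a face and distinct patterns to give
  distinct faces. If a generic point of the face of \<open>(I, e)\<close> had a further tight
  constraint \<open>t\<close>, an independent family grown from \<open>t\<close> would label the
  same face by a second pattern.\<close>

lemma card_faces_eq_imp_hits:
  assumes k: "k \<le> dim W"
    and card: "card (faces body (int (dim W) - int k)) = 2 ^ k * (card J choose k)"
  shows "hits_patterns k"
  unfolding hits_patterns_def
proof (intro allI impI)
  let ?s = "\<lambda>(I, e). sect I e" and ?F = "faces body (int (dim W) - int k)"
  have sub: "?F \<subseteq> ?s ` patterns k" by (rule faces_subset_patterns[OF k])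
  have fin: "finite (?s ` patterns k)" using finite_patterns by simp
  have le: "card (?s ` patterns k) \<le> card (patterns k)" by (rule card_image_le[OF finite_patterns])
  have "card ?F = card (patterns k)" using card card_patterns by simp
  then have im: "?s ` patterns k = ?F" and inj: "inj_on ?s (patterns k)"
    using card_seteq[OF fin sub] le card_mono[OF fin sub] eq_card_imp_inj_on[OF finite_patterns, of ?s]
    by auto
  fix I e assume p: "(I, e) \<in> patterns k"
  then have I: "I \<subseteq> J" "card I = k" "e \<in> signs I" by (auto simp: patterns_def)
  have "sect I e \<in> ?F" using im p by force
  then have F: "sect I e face_of body" "affdim (sect I e) = int (dim W) - int k" by (auto simp: faces_def)
  then have "sect I e \<noteq> {}" using k by (auto simp: affdim_def)
  then obtain x where x: "x \<in> sect I e" "sect I e = sect (tight x) (\<lambda>i. g i x)"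
    using face_eq_sect[OF F(1)] by blast
  have xb: "x \<in> body" "\<And>i. i \<in> I \<Longrightarrow> g i x = e i" using x(1) by (auto simp: sect_def)
  have It: "I \<subseteq> tight x"
  proof
    fix i assume "i \<in> I"
    then show "i \<in> tight x" using xb(2)[of i] signsD[OF I(3), of i] I(1) by (auto simp: tight_def)
  qed
  have "tight x = I"
  proof (rule ccontr)
    assume "tight x \<noteq> I"
    then obtain t where t: "t \<in> tight x" "t \<notin> I" using It by blast
    have "g t x \<noteq> 0" "t \<in> J" using t by (auto simp: tight_def)
    \<comment> \<open>The functional \<open>g t\<close> is nonzero on \<open>W\<close>, so
      \<open>{t}\<close> is an independent family to start from.\<close>
    then have "dim (kern {}) = Suc (dim (kern {t}))"
      using xb(1) by (intro dim_kern_insert[of "{}" t x]) (auto simp: kern_def body_def)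
    then have "dim (kern {t}) + card {t} = dim W" by (simp add: kern_empty)
    then obtain I' where I': "{t} \<subseteq> I'" "I' \<subseteq> tight x" "kern I' = kern (tight x)"
        "dim (kern I') + card I' = dim W"
      using independent_extend[of "{t}" "tight x", OF _ tight_subset] t(1) by blast
    have "int (dim (kern I')) = int (dim W) - int k"
      using affdim_sect_tight[OF xb(1)] F(2) x(2) I'(3) by simp
    then have "card I' = k" using I'(4) by linarith
    let ?e = "restrict (\<lambda>i. g i x) I'"
    have p': "(I', ?e) \<in> patterns k"
      using order_trans[OF I'(2) tight_subset] \<open>card I' = k\<close> restrict_signs[OF I'(2)]
      by (simp add: patterns_def)
    have "sect I' ?e = sect I e"
      using x(2) sect_eq_sect_tight[OF xb(1) I'(2,3)] sect_cong[of I' ?e "\<lambda>i. g i x"] by simp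
    then have "?s (I', ?e) = ?s (I, e)" by simp
    then have "(I', ?e) = (I, e)" by (rule inj_onD[OF inj _ p' p])
    then show False using t(2) I'(1) by blast
  qed
  then have tI: "\<bar>g j x\<bar> \<noteq> 1" if "j \<in> J - I" for j
    using that by (auto simp: tight_def)
  have xW: "x \<in> W" "\<And>j. j \<in> J \<Longrightarrow> \<bar>g j x\<bar> \<le> 1" using xb(1) by (auto simp: body_def)
  have "\<bar>g j x\<bar> < 1" if "j \<in> J - I" for j
    using tI[OF that] xW(2)[of j] that by (simp add: order_less_le)
  then show "\<exists>x\<in>W. (\<forall>i\<in>I. g i x = e i) \<and> (\<forall>j\<in>J - I. \<bar>g j x\<bar> < 1)"
    using xb(2) xW(1) by blast
qed

text \<open>Move along \<open>v\<close> until a slack constraint first becomes tight; this happens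
  because some constraint is nonconstant along \<open>v\<close> by
  \<open>separating\<close>.\<close>

lemma advance:
  assumes x: "x \<in> body" and v: "v \<in> kern (tight x)" "v \<noteq> 0"
  obtains t where "0 < t" "x + t *\<^sub>R v \<in> body" "tight x \<subset> tight (x + t *\<^sub>R v)"
proof -
  have vW: "v \<in> W" and xW: "x \<in> W" using v x by (auto simp: kern_def body_def)
  define N where "N = {i \<in> J. g i v \<noteq> 0}"
  \<comment> \<open>The time at which constraint \<open>i\<close> becomes tight in direction
    \<open>v\<close>.\<close>
  define h where "h i = (1 - sgn (g i v) * g i x) / \<bar>g i v\<bar>" for i
  define t where "t = Min (h ` N)"
  have fin: "finite N" using finite_J by (auto simp: N_def)
  have ne: "N \<noteq> {}" using separating[OF vW] v(2) by (auto simp: N_def)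
  have lt: "\<bar>g i x\<bar> < 1" if "i \<in> N" for i
    using that v x by (force simp: N_def kern_def tight_def body_def)
  have h: "h i > 0" if "i \<in> N" for i
  proof -
    have "\<bar>sgn (g i v) * g i x\<bar> < 1"
      using lt[OF that] that by (simp add: abs_mult N_def)
    then show ?thesis using that by (simp add: h_def N_def)
  qed
  have "t \<in> h ` N" unfolding t_def using fin ne by (intro Min_in) auto
  then obtain k where k: "k \<in> N" "t = h k" by blast
  have t: "t > 0" using h k by simp
  have tle: "t \<le> h i" if "i \<in> N" for i using that fin by (simp add: t_def)
  have sgn_eq: "sgn (g i v) * g i (x + t *\<^sub>R v) = sgn (g i v) * g i x + t * \<bar>g i v\<bar>" if "i \<in> N" for i
    using that by (simp add: N_def g_add g_scale algebra_simps) (simp add: abs_sgn)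
  have absN: "\<bar>g i (x + t *\<^sub>R v)\<bar> = \<bar>sgn (g i v) * g i x + t * \<bar>g i v\<bar>\<bar>" if "i \<in> N" for i
    using that sgn_eq[OF that, symmetric] by (simp add: abs_mult N_def)
  have le: "\<bar>g i (x + t *\<^sub>R v)\<bar> \<le> 1" if "i \<in> N" for i
  proof -
    have "\<bar>sgn (g i v) * g i x\<bar> < 1"
      using lt[OF that] that by (simp add: abs_mult N_def)
    moreover have "t * \<bar>g i v\<bar> \<le> 1 - sgn (g i v) * g i x"
      using tle[OF that] that by (simp add: h_def N_def field_simps)
    moreover have "0 \<le> t * \<bar>g i v\<bar>" using t by simp
    ultimately show ?thesis unfolding absN[OF that] by linarith
  qed
  have off: "g i (x + t *\<^sub>R v) = g i x" if "i \<in> J" "i \<notin> N" for i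
    using that by (simp add: N_def g_add g_scale)
  have "x + t *\<^sub>R v \<in> body"
    using le off x vW by (auto simp: body_def W_add W_scale) (metis)
  moreover have "tight x \<subseteq> tight (x + t *\<^sub>R v)"
    using off lt by (fastforce simp: tight_def)
  moreover have "k \<in> tight (x + t *\<^sub>R v)"
  proof -
    have "t * \<bar>g k v\<bar> = 1 - sgn (g k v) * g k x" using k by (simp add: h_def N_def)
    then have "\<bar>g k (x + t *\<^sub>R v)\<bar> = 1" unfolding absN[OF k(1)] by simp
    then show ?thesis using k by (simp add: tight_def N_def)
  qed
  moreover have "k \<notin> tight x" using lt[OF k(1)] by (simp add: tight_def)
  ultimately show ?thesis using that[OF t] by blast
qed

text \<open>The points with trivial kernel are the vertices, finitely many because each is
  determined by its tight constraints and their signs. From any other point one can advance along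
  \<open>v\<close> and along \<open>- v\<close>, which exhibits it as a convex combination of points
  with more tight constraints.\<close>

lemma polytope_body: "polytope body"
proof -
  define V where "V = {x \<in> body. kern (tight x) = {0}}"
  have "finite V"
  proof (rule inj_on_finite)
    show "inj_on (\<lambda>x. (tight x, restrict (\<lambda>i. g i x) (tight x))) V"
    proof (rule inj_onI)
      fix x y assume V: "x \<in> V" "y \<in> V"
        and eq: "(tight x, restrict (\<lambda>i. g i x) (tight x)) = (tight y, restrict (\<lambda>i. g i y) (tight y))"
      then have gxy: "g i x = g i y" if "i \<in> tight x" for i
        using that by (metis Pair_inject restrict_apply')
      have "g i (x - y) = 0" if "i \<in> tight x" for i
        using gxy[OF that] subsetD[OF tight_subset that] by (simp add: g_diff)
      moreover have "x \<in> W" "y \<in> W" using V by (simp_all add: V_def body_def)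
      ultimately have "x - y \<in> kern (tight x)"
        by (simp add: kern_def W_diff)
      moreover have "kern (tight x) = {0}" using V by (simp add: V_def)
      ultimately show "x = y" by auto
    qed
    show "(\<lambda>x. (tight x, restrict (\<lambda>i. g i x) (tight x))) ` V \<subseteq> (SIGMA I : Pow J. signs I)"
      using restrict_signs[OF order_refl] tight_subset by auto
    show "finite (SIGMA I : Pow J. signs I)"
      using finite_J by (intro finite_SigmaI) (auto intro: finite_signs finite_subset_J)
  qed
  moreover have "x \<in> convex hull V" if "x \<in> body" for x
    using that
  proof (induction "card (J - tight x)" arbitrary: x rule: less_induct)
    case less
    show ?case
    proof (cases "kern (tight x) = {0}")
      case True
      then show ?thesis using less.prems by (auto simp: V_def intro: hull_inc)
    next
      case False
      have "0 \<in> kern (tight x)" by (rule subspace_0[OF subspace_kern[OF tight_subset]])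
      then obtain v where v: "v \<in> kern (tight x)" "v \<noteq> 0" using False by blast
      have mv: "- v \<in> kern (tight x)" by (rule subspace_neg[OF subspace_kern[OF tight_subset] v(1)])
      have IH: "y \<in> convex hull V" if "y \<in> body" "tight x \<subset> tight y" for y
      proof (rule less.hyps[OF _ that(1)])
        show "card (J - tight y) < card (J - tight x)"
          using that(2) tight_subset[of y] finite_J by (intro psubset_card_mono) auto
      qed
      obtain s where s: "0 < s" "x + s *\<^sub>R v \<in> body" "tight x \<subset> tight (x + s *\<^sub>R v)"
        using advance[OF less.prems v] by blast
      obtain t where t: "0 < t" "x + t *\<^sub>R - v \<in> body" "tight x \<subset> tight (x + t *\<^sub>R - v)"
        using advance[OF less.prems mv] v(2) by auto
      \<comment> \<open>The weights are chosen so that the displacements \<open>s\<close> along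
        \<open>v\<close> and \<open>t\<close> along \<open>- v\<close> cancel.\<close>
      have "(t / (s + t)) *\<^sub>R (x + s *\<^sub>R v) + (s / (s + t)) *\<^sub>R (x + t *\<^sub>R - v) \<in> convex hull V"
        using IH[OF s(2,3)] IH[OF t(2,3)] s(1) t(1)
        by (intro convexD[OF convex_convex_hull]) (auto simp: add_divide_distrib[symmetric])
      also have "(t / (s + t)) *\<^sub>R (x + s *\<^sub>R v) + (s / (s + t)) *\<^sub>R (x + t *\<^sub>R - v)
          = (t / (s + t) + s / (s + t)) *\<^sub>R x + (t / (s + t) * s - s / (s + t) * t) *\<^sub>R v"
        by (simp add: algebra_simps)
      also have "\<dots> = x"
        using s(1) t(1) by (simp add: add_divide_distrib[symmetric] add.commute)
      finally show ?thesis .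
    qed
  qed
  then have "body = convex hull V"
    using hull_minimal[of V body convex] convex_body by (auto simp: V_def)
  ultimately show ?thesis unfolding polytope_def by blast
qed

lemma sym_polytope_body_iff:
  "sym_polytope R n body \<longleftrightarrow> R = dim W \<and> card (faces body (int R - 1)) = 2 * n"
  by (auto simp: sym_polytope_def polytope_body affdim_body uminus_body)

text \<open>The facet count required by \<open>sym_polytope\<close> is the case
  \<open>k = 1\<close>, reached from \<open>k\<close> by \<open>hits_patterns_mono\<close>.\<close>

lemma hits_patterns_iff:
  assumes k: "0 < k" "k \<le> card J" "k \<le> dim W"
  shows "hits_patterns k \<longleftrightarrow> sym_polytope (dim W) (card J) body \<and>
    card (faces body (int (dim W) - int k)) = 2 ^ k * (card J choose k)"
proof
  assume hit: "hits_patterns k"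
  then have "hits_patterns 1" using k by (intro hits_patterns_mono[OF hit]) auto
  then show "sym_polytope (dim W) (card J) body \<and>
      card (faces body (int (dim W) - int k)) = 2 ^ k * (card J choose k)"
    using card_faces_eq[of 1] card_faces_eq[OF hit k(2)] k by (simp add: sym_polytope_body_iff)
qed (use card_faces_eq_imp_hits k in blast)

end

subsection \<open>Orthogonal projections of finitely supported sequences\<close>

abbreviation coord :: "rvec \<Rightarrow> nat \<Rightarrow> real" where
  "coord \<equiv> Poly_Mapping.lookup"

lemma coord_scaleR [simp]: "coord (c *\<^sub>R x) i = c * coord x i"
proof -
  have "finite {i. c * coord x i \<noteq> 0}"
    by (rule finite_subset[OF _ finite_keys[of x]]) (auto simp: in_keys_iff)
  then show ?thesis by (simp add: scaleR_poly_mapping_def)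
qed

lemma linear_coord: "linear (\<lambda>x. coord x i)"
  by (rule linearI) (simp_all add: lookup_add)

lemma Rspace_iff: "x \<in> Rspace m \<longleftrightarrow> (\<forall>i\<ge>m. coord x i = 0)"
  by (auto simp: Rspace_def in_keys_iff subset_iff) (metis not_le)

lemma subspace_Rspace: "subspace (Rspace m)"
  by (auto simp: subspace_def Rspace_iff lookup_add)

lemma Rspace_eqI: "x \<in> Rspace m \<Longrightarrow> y \<in> Rspace m \<Longrightarrow> (\<And>i. i < m \<Longrightarrow> coord x i = coord y i) \<Longrightarrow> x = y"
  by (rule poly_mapping_eqI) (metis Rspace_iff not_le)

definition rvec_of :: "nat \<Rightarrow> (nat \<Rightarrow> real) \<Rightarrow> rvec" where
  "rvec_of m f = (\<Sum>i<m. Poly_Mapping.single i (f i))"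

lemma coord_rvec_of: "coord (rvec_of m f) i = (if i < m then f i else 0)"
  by (simp add: rvec_of_def lookup_sum lookup_single when_def)

lemma rvec_of_in_Rspace [simp]: "rvec_of m f \<in> Rspace m"
  by (simp add: Rspace_iff coord_rvec_of)

lemma rvec_of_coord: "x \<in> Rspace m \<Longrightarrow> rvec_of m (coord x) = x"
  by (rule Rspace_eqI[of _ m]) (simp_all add: coord_rvec_of)

lemma Rspace_finite_span: "\<exists>B. finite B \<and> Rspace m \<subseteq> span B"
proof (intro exI conjI)
  let ?B = "(\<lambda>i. Poly_Mapping.single i (1::real)) ` {..<m}"
  show "Rspace m \<subseteq> span ?B"
  proof
    fix x assume x: "x \<in> Rspace m"
    have "Poly_Mapping.single i (coord x i) = coord x i *\<^sub>R Poly_Mapping.single i 1" for i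
      by (rule poly_mapping_eqI) (simp add: lookup_single when_def)
    then have "x = (\<Sum>i<m. coord x i *\<^sub>R Poly_Mapping.single i 1)"
      using rvec_of_coord[OF x] by (simp add: rvec_of_def)
    also have "\<dots> \<in> span ?B" by (intro span_sum span_scale span_base) auto
    finally show "x \<in> span ?B" .
  qed
qed simp

lemma dotp_eq_sum:
  assumes "finite S" "Poly_Mapping.keys x \<subseteq> S"
  shows "dotp x y = (\<Sum>i\<in>S. coord x i * coord y i)"
  unfolding dotp_def using assms
  by (intro sum.mono_neutral_left) (auto simp: in_keys_iff)

lemma dotp_Rspace: "x \<in> Rspace m \<Longrightarrow> dotp x y = (\<Sum>i<m. coord x i * coord y i)"
  by (rule dotp_eq_sum) (auto simp: Rspace_def)

lemma dotp_commute: "dotp x y = dotp y x"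
proof -
  let ?S = "Poly_Mapping.keys x \<union> Poly_Mapping.keys y"
  have "dotp x y = (\<Sum>i\<in>?S. coord x i * coord y i)" by (rule dotp_eq_sum) auto
  also have "\<dots> = dotp y x" by (subst dotp_eq_sum[of ?S y]) (auto simp: mult.commute)
  finally show ?thesis .
qed

lemma linear_dotp_right: "linear (dotp x)"
  by (rule linearI)
    (simp_all add: dotp_def lookup_add distrib_left sum.distrib sum_distrib_left mult_ac)

lemmas dotp_add_right = linear_add[OF linear_dotp_right]
lemmas dotp_diff_right = linear_diff[OF linear_dotp_right]
lemma dotp_scale_right: "dotp x (c *\<^sub>R y) = c * dotp x y"
  by (simp add: linear_scale[OF linear_dotp_right])
lemmas dotp_sum_right = linear_sum[OF linear_dotp_right]
lemmas dotp_zero_right = linear_0[OF linear_dotp_right]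

lemma linear_dotp_left: "linear (\<lambda>x. dotp x y)"
  unfolding dotp_commute[of _ y] by (rule linear_dotp_right)

lemmas dotp_add_left = linear_add[OF linear_dotp_left]
lemmas dotp_diff_left = linear_diff[OF linear_dotp_left]
lemma dotp_scale_left: "dotp (c *\<^sub>R x) y = c * dotp x y"
  by (simp add: linear_scale[OF linear_dotp_left])
lemmas dotp_sum_left = linear_sum[OF linear_dotp_left]
lemmas dotp_zero_left = linear_0[OF linear_dotp_left]

lemma dotp_self_nonneg: "0 \<le> dotp x x"
  by (simp add: dotp_def sum_nonneg)

lemma dotp_self_eq_0: "dotp x x = 0 \<longleftrightarrow> x = 0"
proof
  assume "dotp x x = 0"
  then have "\<forall>i\<in>Poly_Mapping.keys x. coord x i * coord x i = 0"
    unfolding dotp_def by (subst (asm) sum_nonneg_eq_0_iff) auto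
  then show "x = 0" by (intro poly_mapping_eqI) (auto simp: in_keys_iff)
qed (simp add: dotp_zero_right)

lemma dotp_self_pos: "x \<noteq> 0 \<Longrightarrow> 0 < dotp x x"
  using dotp_self_nonneg[of x] dotp_self_eq_0[of x] by linarith

section \<open>Orthonormal bases and projections\<close>

definition orthonormal_basis :: "rvec set \<Rightarrow> nat \<Rightarrow> (nat \<Rightarrow> rvec) \<Rightarrow> bool" where
  "orthonormal_basis E R u \<longleftrightarrow> E = span (u ` {..<R}) \<and>
     (\<forall>k<R. \<forall>l<R. dotp (u k) (u l) = (if k = l then 1 else 0))"

text \<open>A vector that depends on its predecessors contributes nothing, hence only
  \<open>n <= card B\<close>. For a basis, a dimension count in
  \<open>orthonormal_basis_exists\<close> turns this into equality.\<close>

lemma gram_schmidt: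
  assumes "finite B"
  shows "\<exists>n u. n \<le> card B \<and> orthonormal_basis (span B) n u"
  using assms
proof (induction B rule: finite_induct)
  case empty
  then show ?case by (auto simp: orthonormal_basis_def intro!: exI[of _ 0])
next
  case (insert b B)
  then obtain n u where n: "n \<le> card B" and u: "span B = span (u ` {..<n})"
    "\<And>k l. k < n \<Longrightarrow> l < n \<Longrightarrow> dotp (u k) (u l) = (if k = l then 1 else 0)"
    unfolding orthonormal_basis_def by metis
  define p where "p = (\<Sum>k<n. dotp b (u k) *\<^sub>R u k)"
  define w where "w = b - p"
  have "p \<in> span B"
    unfolding p_def u(1) by (intro span_sum span_scale span_base) auto
  have perp: "dotp w (u l) = 0" if "l < n" for l
  proof -
    have "dotp p (u l) = (\<Sum>k<n. if k = l then dotp b (u k) else 0)"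
      unfolding p_def dotp_sum_left dotp_scale_left using u(2) that by (intro sum.cong) auto
    then show ?thesis using that by (simp add: w_def dotp_diff_left)
  qed
  have b: "b = w + p" by (simp add: w_def)
  show ?case
  proof (cases "w = 0")
    case True
    then have "span (insert b B) = span B"
      using \<open>p \<in> span B\<close> b by (intro span_redundant) simp
    then show ?thesis using n u insert by (intro exI[of _ n] exI[of _ u]) (auto simp: orthonormal_basis_def)
  next
    case False
    define e where "e = (1 / sqrt (dotp w w)) *\<^sub>R w"
    have s: "sqrt (dotp w w) > 0" using dotp_self_pos[OF False] by simp
    have ee: "dotp e e = 1"
      using dotp_self_pos[OF False] s by (simp add: e_def dotp_scale_left dotp_scale_right)
    have eu: "dotp e (u l) = 0" "dotp (u l) e = 0" if "l < n" for l
      using perp[OF that] by (simp_all add: e_def dotp_scale_left dotp_scale_right dotp_commute)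
    let ?u = "u(n := e)"
    have im: "?u ` {..<Suc n} = insert e (u ` {..<n})"
      by (auto simp: lessThan_Suc)
    have "span (insert b B) = span (insert e (u ` {..<n}))"
    proof (rule span_eq[THEN iffD2], intro conjI insert_subsetI)
      have "w = sqrt (dotp w w) *\<^sub>R e" using s by (simp add: e_def)
      then have "w \<in> span (insert e (u ` {..<n}))"
        by (metis insertI1 span_base span_scale)
      moreover have "p \<in> span (insert e (u ` {..<n}))"
        using \<open>p \<in> span B\<close> unfolding u(1) by (rule rev_subsetD) (intro span_mono subset_insertI)
      ultimately show "b \<in> span (insert e (u ` {..<n}))" unfolding b by (rule span_add)
      have "B \<subseteq> span (u ` {..<n})" unfolding u(1)[symmetric] by (rule span_superset)
      then show "B \<subseteq> span (insert e (u ` {..<n}))"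
        using span_mono[of "u ` {..<n}" "insert e (u ` {..<n})"] by blast
      have "p \<in> span (insert b B)"
        using \<open>p \<in> span B\<close> span_mono[of B "insert b B"] by blast
      then have "w \<in> span (insert b B)"
        unfolding w_def by (intro span_diff) (auto intro: span_base)
      then show "e \<in> span (insert b B)" unfolding e_def by (rule span_scale)
      have "u ` {..<n} \<subseteq> span B" unfolding u(1) by (rule span_superset)
      then show "u ` {..<n} \<subseteq> span (insert b B)" using span_mono[of B "insert b B"] by blast
    qed
    then have "orthonormal_basis (span (insert b B)) (Suc n) ?u"
      unfolding orthonormal_basis_def im using u(2) ee eu by (auto simp: less_Suc_eq)
    moreover have "Suc n \<le> card (insert b B)" using n insert by simp
    ultimately show ?thesis by blast
  qed
qed

lemma orthonormal_basis_exists: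
  assumes E: "subspace E" "E \<subseteq> Rspace m"
  shows "\<exists>u. orthonormal_basis E (dim E) u"
proof -
  obtain B where B: "B \<subseteq> E" "independent B" "E \<subseteq> span B" "card B = dim E"
    using basis_exists by blast
  obtain S :: "rvec set" where S: "finite S" "Rspace m \<subseteq> span S" using Rspace_finite_span by blast
  have "B \<subseteq> span S" using B(1) E(2) S(2) by blast
  then have fin: "finite B" using independent_span_bound[OF S(1) B(2)] by blast
  have sB: "span B = E" using B(1,3) E(1) by (meson span_minimal subset_antisym)
  obtain n u where n: "n \<le> card B" and u: "orthonormal_basis (span B) n u"
    using gram_schmidt[OF fin] by blast
  have "dim E \<le> card (u ` {..<n})"
    using u sB by (intro dim_le_card) (auto simp: orthonormal_basis_def)
  also have "\<dots> \<le> n" using card_image_le[of "{..<n}" u] by simp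
  finally have "n = dim E" using n B(4) by simp
  then show ?thesis using u sB by blast
qed

context
  fixes E :: "rvec set" and m R :: nat and u :: "nat \<Rightarrow> rvec"
  assumes E: "E \<subseteq> Rspace m" and basis: "orthonormal_basis E R u"
begin

lemma basis_in: "k < R \<Longrightarrow> u k \<in> E"
  using basis by (auto simp: orthonormal_basis_def intro: span_base)

lemma basis_dotp: "k < R \<Longrightarrow> l < R \<Longrightarrow> dotp (u k) (u l) = (if k = l then 1 else 0)"
  using basis by (auto simp: orthonormal_basis_def)

lemma basis_subspace: "subspace E"
  using basis by (auto simp: orthonormal_basis_def)

lemma orth_proj_residual:
  assumes "z \<in> E"
  shows "dotp (x - (\<Sum>k<R. dotp x (u k) *\<^sub>R u k)) z = 0"
proof -
  let ?p = "\<Sum>k<R. dotp x (u k) *\<^sub>R u k"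
  have "dotp (x - ?p) (u l) = 0" if "l < R" for l
  proof -
    have "dotp ?p (u l) = (\<Sum>k<R. if k = l then dotp x (u k) else 0)"
      unfolding dotp_sum_left dotp_scale_left using basis_dotp that by (intro sum.cong) auto
    then show ?thesis using that by (simp add: dotp_diff_left)
  qed
  then have "u ` {..<R} \<subseteq> {z. dotp (x - ?p) z = 0}" by auto
  moreover have "subspace {z. dotp (x - ?p) z = 0}"
    using linear_dotp_right by (rule linear_subspace_kernel)
  ultimately have "span (u ` {..<R}) \<subseteq> {z. dotp (x - ?p) z = 0}" by (rule span_minimal)
  then show ?thesis using assms basis by (auto simp: orthonormal_basis_def)
qed

text \<open>Gives the definite description its value: the difference of two candidates lies in
  \<open>E\<close> and is orthogonal to \<open>E\<close>, so it is zero.\<close>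

lemma orth_proj_eq: "orth_proj E x = (\<Sum>k<R. dotp x (u k) *\<^sub>R u k)"
  unfolding orth_proj_def
proof (rule the_equality)
  let ?p = "\<Sum>k<R. dotp x (u k) *\<^sub>R u k"
  have pE: "?p \<in> E"
    by (rule subspace_sum[OF basis_subspace]) (auto intro: subspace_scale[OF basis_subspace] basis_in)
  show "?p \<in> E \<and> (\<forall>z\<in>E. dotp (x - ?p) z = 0)"
    using pE orth_proj_residual by blast
  fix y assume y: "y \<in> E \<and> (\<forall>z\<in>E. dotp (x - y) z = 0)"
  have d: "y - ?p \<in> E" using y pE subspace_diff[OF basis_subspace] by blast
  have "dotp (y - ?p) (y - ?p) = dotp (x - ?p) (y - ?p) - dotp (x - y) (y - ?p)"
    by (simp add: dotp_diff_left)
  also have "\<dots> = 0" using y d orth_proj_residual[OF d] by simp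
  finally show "y = ?p" by (simp add: dotp_self_eq_0)
qed

lemma orth_proj_in: "orth_proj E x \<in> E"
  unfolding orth_proj_eq
  by (rule subspace_sum[OF basis_subspace]) (auto intro: subspace_scale[OF basis_subspace] basis_in)

lemma orth_proj_perp: "z \<in> E \<Longrightarrow> dotp (x - orth_proj E x) z = 0"
  unfolding orth_proj_eq by (rule orth_proj_residual)

lemma proj_matrix_eq: "proj_matrix E i j = (\<Sum>k<R. coord (u k) i * coord (u k) j)"
  unfolding proj_matrix_def orth_proj_eq
  by (simp add: lookup_sum dotp_def mult.commute)

lemma coord_orth_proj:
  assumes "x \<in> Rspace m"
  shows "coord (orth_proj E x) i = (\<Sum>j<m. proj_matrix E i j * coord x j)"
proof -
  have "coord (orth_proj E x) i = (\<Sum>k<R. \<Sum>j<m. coord x j * coord (u k) j * coord (u k) i)"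
    by (simp add: orth_proj_eq lookup_sum dotp_Rspace[OF assms] sum_distrib_right)
  also have "\<dots> = (\<Sum>j<m. proj_matrix E i j * coord x j)"
    by (subst sum.swap) (simp add: proj_matrix_eq sum_distrib_left sum_distrib_right mult_ac)
  finally show ?thesis .
qed

lemma orth_proj_id:
  assumes "x \<in> E"
  shows "orth_proj E x = x"
proof -
  have "x - orth_proj E x \<in> E" by (rule subspace_diff[OF basis_subspace assms orth_proj_in])
  then have "dotp (x - orth_proj E x) (x - orth_proj E x) = 0" by (rule orth_proj_perp)
  then show ?thesis by (simp add: dotp_self_eq_0)
qed

lemma sum_dotp_basis_square: "(\<Sum>k<R. (dotp x (u k))\<^sup>2) = dotp x (orth_proj E x)"
  by (simp add: orth_proj_eq dotp_sum_right dotp_scale_right power2_eq_square)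

lemma dotp_residual_self:
  "dotp (x - orth_proj E x) (x - orth_proj E x) = dotp x x - (\<Sum>k<R. (dotp x (u k))\<^sup>2)"
proof -
  have "dotp (x - orth_proj E x) (x - orth_proj E x)
      = dotp x x - dotp x (orth_proj E x) - dotp (x - orth_proj E x) (orth_proj E x)"
    by (simp add: dotp_diff_left dotp_diff_right dotp_commute)
  then show ?thesis using orth_proj_perp[OF orth_proj_in] by (simp add: sum_dotp_basis_square)
qed

lemma linear_orth_proj: "linear (orth_proj E)"
  unfolding orth_proj_eq
  by (rule linearI)
    (simp_all add: dotp_add_left dotp_scale_left scaleR_left_distrib sum.distrib scaleR_sum_right)

end

subsection \<open>Generic sections of the cube\<close>

abbreviation generic_section :: "nat \<Rightarrow> nat \<Rightarrow> rvec set \<Rightarrow> bool" where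
  "generic_section m r E \<equiv> sym_polyhedron.hits_patterns E {..<m} (\<lambda>i x. coord x i) r"

lemma sym_polyhedron_section:
  assumes "subspace E" "E \<subseteq> Rspace m"
  shows "sym_polyhedron E {..<m} (\<lambda>i x. coord x i)"
proof (rule sym_polyhedron.intro)
  fix x assume "x \<in> E" "\<And>i. i \<in> {..<m} \<Longrightarrow> coord x i = 0"
  then show "x = 0" using assms by (intro Rspace_eqI[of _ m]) (auto simp: subspace_0[OF subspace_Rspace])
qed (use assms linear_coord in auto)

lemma body_section:
  assumes "subspace E" "E \<subseteq> Rspace m"
  shows "sym_polyhedron.body E {..<m} (\<lambda>i x. coord x i) = E \<inter> cube m"
  unfolding sym_polyhedron.body_def[OF sym_polyhedron_section[OF assms]]
  using assms by (auto simp: cube_def abs_le_iff)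

lemma generic_section_iff:
  assumes E: "E \<in> Grassmannian m R" and r: "0 < r" "r \<le> m" "r \<le> R"
  shows "generic_section m r E \<longleftrightarrow> sym_polytope R m (E \<inter> cube m) \<and>
    card (faces (E \<inter> cube m) (int R - int r)) = 2 ^ r * (m choose r)"
proof -
  have E': "subspace E" "E \<subseteq> Rspace m" "dim E = R" using E by (auto simp: Grassmannian_def)
  show ?thesis
    using sym_polyhedron.hits_patterns_iff[OF sym_polyhedron_section[OF E'(1,2)], of r] r E'(3)
    by (simp add: body_section[OF E'(1,2)])
qed

lemma generic_sectionI:
  assumes "subspace E" "E \<subseteq> Rspace m"
    and "\<And>I e. I \<subseteq> {..<m} \<Longrightarrow> card I = r \<Longrightarrow> e \<in> signs I \<Longrightarrow>
      \<exists>x\<in>E. (\<forall>i\<in>I. coord x i = e i) \<and> (\<forall>j\<in>{..<m} - I. \<bar>coord x j\<bar> < 1)"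
  shows "generic_section m r E"
  using assms sym_polyhedron_section[OF assms(1,2)]
  by (auto simp: sym_polyhedron.hits_patterns_def sym_polyhedron.patterns_def)

lemma generic_sectionD:
  assumes "subspace E" "E \<subseteq> Rspace m" "generic_section m r E"
    and "I \<subseteq> {..<m}" "card I = r" "e \<in> signs I"
  shows "\<exists>x\<in>E. (\<forall>i\<in>I. coord x i = e i) \<and> (\<forall>j\<in>{..<m} - I. \<bar>coord x j\<bar> < 1)"
  using assms sym_polyhedron_section[OF assms(1,2)]
  by (auto simp: sym_polyhedron.hits_patterns_def sym_polyhedron.patterns_def)

lemma quadratic_nonneg_imp_linear_nonneg:
  assumes b: "0 \<le> (b::real)" and nonneg: "\<And>s. 0 < s \<Longrightarrow> s \<le> 1 \<Longrightarrow> 0 \<le> 2 * s * a + s\<^sup>2 * b"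
  shows "0 \<le> a"
proof (rule ccontr)
  assume "\<not> 0 \<le> a"
  then have a: "a < 0" by simp
  \<comment> \<open>For negative \<open>a\<close> this lies between 0 and 1 and makes
    \<open>2 * a + s * b\<close> equal to \<open>a + s * a\<close>, which is negative.\<close>
  define s where "s = - a / (b - a)"
  have s: "0 < s" "s \<le> 1" using a b by (auto simp: s_def field_simps)
  have "0 \<le> s * (2 * a + s * b)" using nonneg[OF s] by (simp add: power2_eq_square algebra_simps)
  then have "0 \<le> 2 * a + s * b" using s by (simp add: zero_le_mult_iff)
  moreover have "s * (b - a) = - a" using a b by (simp add: s_def)
  then have "s * b = - a + s * a" by (simp add: algebra_simps)
  moreover have "s * a < 0" using s(1) a by (rule mult_pos_neg)
  ultimately show False using a by linarith
qed

text \<open>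
  The point of the box \<open>y = e\<close> on \<open>I\<close>, \<open>\<bar>y\<bar> \<le> 1/2\<close> off \<open>I\<close> that is closest to \<open>E\<close>
  lies on \<open>E\<close>: its residual is orthogonal to \<open>E\<close>, and the first-order condition for the
  minimum contradicts the null space property unless the residual vanishes.
\<close>

lemma null_space_property_imp_generic:
  assumes E: "E \<subseteq> Rspace m" and basis: "orthonormal_basis E R u"
    and nsp: "\<And>z I. z \<in> Rspace m \<Longrightarrow> (\<And>x. x \<in> E \<Longrightarrow> dotp z x = 0) \<Longrightarrow> I \<subseteq> {..<m} \<Longrightarrow> card I = r \<Longrightarrow>
      2 * (\<Sum>i\<in>I. \<bar>coord z i\<bar>) \<le> (\<Sum>i\<in>{..<m} - I. \<bar>coord z i\<bar>)"
  shows "generic_section m r E"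
proof (rule generic_sectionI[OF basis_subspace[OF E basis] E])
  fix I e assume I: "I \<subseteq> {..<m}" "card I = r" and e: "e \<in> signs I"
  \<comment> \<open>The factors beyond \<open>m\<close> are single points, so that the box is a
    compact product over all indices. The radius 1/2 is below 1, which gives strict inequalities off
    \<open>I\<close>, and it matches the factor 2 in the null space property.\<close>
  define T where "T i = (if i \<in> I then {e i} else if i < m then {-1/2..1/2} else {0 :: real})" for i
  define S where "S = PiE UNIV T"
  define res where "res x = x - orth_proj E x" for x
  \<comment> \<open>The squared distance to \<open>E\<close>, written as a polynomial in finitely
    many coordinates so that continuity in the product topology is immediate.\<close>
  define f where "f y = (\<Sum>i<m. (y i)\<^sup>2) - (\<Sum>k<R. (\<Sum>i<m. y i * coord (u k) i)\<^sup>2)" for y :: "nat \<Rightarrow> real"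
  have f: "f y = dotp (res (rvec_of m y)) (res (rvec_of m y))" for y
    unfolding res_def dotp_residual_self[OF E basis]
    by (simp add: f_def dotp_Rspace[of _ m] coord_rvec_of power2_eq_square)
  have lin: "linear res"
    unfolding res_def[abs_def] by (intro linear_compose_sub linear_id[unfolded id_def] linear_orth_proj[OF E basis])
  have res_perp: "dotp (res x) p = 0" if "p \<in> E" for x p
    unfolding res_def by (rule orth_proj_perp[OF E basis that])
  have res_res: "dotp (res x) (res d) = dotp (res x) d" for x d
    using res_perp[OF orth_proj_in[OF E basis]] by (simp add: res_def[of d] dotp_diff_right)
  have "compactin (product_topology (\<lambda>i. euclidean) UNIV) S"
    unfolding S_def compactin_PiE by (auto simp: T_def)
  then have "compact S"
    by (simp add: euclidean_product_topology)
  moreover have "S \<noteq> {}" by (auto simp: S_def T_def PiE_eq_empty_iff)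
  moreover have "continuous_on S f"
    unfolding f_def
    by (intro continuous_intros continuous_on_subset[OF continuous_on_product_coordinates] subset_UNIV)
  ultimately obtain y where y: "y \<in> S" and min: "\<And>y'. y' \<in> S \<Longrightarrow> f y \<le> f y'"
    using continuous_attains_inf[of S f] by blast
  define z where "z = res (rvec_of m y)"
  have zR: "z \<in> Rspace m"
    using orth_proj_in[OF E basis] E unfolding z_def res_def
    by (intro subspace_diff[OF subspace_Rspace]) auto
  \<comment> \<open>The point of the box with the smallest inner product with the residual
    \<open>z\<close> off \<open>I\<close>.\<close>
  define y' where "y' i = (if i \<in> I then e i else if i < m then - sgn (coord z i) / 2 else 0)" for i
  have "y' i \<in> T i" for i
    by (auto simp: y'_def T_def sgn_if)
  then have y': "y' \<in> S" by (simp add: S_def PiE_UNIV_domain)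
  have yT: "y i \<in> T i" for i using y by (auto simp: S_def)
  define d where "d i = y' i - y i" for i
  have "0 \<le> dotp z (rvec_of m d)"
  proof (rule quadratic_nonneg_imp_linear_nonneg)
    show "0 \<le> dotp (res (rvec_of m d)) (res (rvec_of m d))" by (rule dotp_self_nonneg)
    fix s :: real assume s: "0 < s" "s \<le> 1"
    have "y i + s * d i \<in> T i" for i
    proof -
      have "convex (T i)" by (simp add: T_def)
      then have "(1 - s) *\<^sub>R y i + s *\<^sub>R y' i \<in> T i"
        using s yT \<open>\<And>i. y' i \<in> T i\<close> by (intro convexD) auto
      then show ?thesis by (simp add: d_def algebra_simps)
    qed
    then have "(\<lambda>i. y i + s * d i) \<in> S" by (simp add: S_def PiE_UNIV_domain)
    from min[OF this] have "dotp z z \<le> f (\<lambda>i. y i + s * d i)"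
      unfolding f[of y] z_def[symmetric] .
    also have "rvec_of m (\<lambda>i. y i + s * d i) = rvec_of m y + s *\<^sub>R rvec_of m d"
      by (rule poly_mapping_eqI) (simp add: coord_rvec_of lookup_add)
    then have "f (\<lambda>i. y i + s * d i) = dotp (z + s *\<^sub>R res (rvec_of m d)) (z + s *\<^sub>R res (rvec_of m d))"
      unfolding f by (simp add: z_def linear_add[OF lin] linear_scale[OF lin])
    also have "\<dots> = dotp z z + 2 * s * dotp z (res (rvec_of m d))
        + s\<^sup>2 * dotp (res (rvec_of m d)) (res (rvec_of m d))"
      by (simp add: dotp_add_left dotp_add_right dotp_scale_left dotp_scale_right
          dotp_commute[of "res (rvec_of m d)" z] power2_eq_square algebra_simps)
    also have "dotp z (res (rvec_of m d)) = dotp z (rvec_of m d)"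
      unfolding z_def by (rule res_res)
    finally show "0 \<le> 2 * s * dotp z (rvec_of m d) + s\<^sup>2 * dotp (res (rvec_of m d)) (res (rvec_of m d))"
      by simp
  qed
  also have "dotp z (rvec_of m d) = dotp z (rvec_of m y') - dotp z (rvec_of m y)"
    using zR by (simp add: dotp_Rspace coord_rvec_of d_def right_diff_distrib sum_subtractf)
  also have "dotp z (rvec_of m y) = dotp z z"
    unfolding z_def using res_res by simp
  also have "dotp z (rvec_of m y') = (\<Sum>i\<in>I. coord z i * e i) + (\<Sum>i\<in>{..<m} - I. - \<bar>coord z i\<bar> / 2)"
  proof -
    have "dotp z (rvec_of m y') = (\<Sum>i<m. coord z i * y' i)"
      using zR by (simp add: dotp_Rspace coord_rvec_of)
    also have "\<dots> = (\<Sum>i\<in>I. coord z i * y' i) + (\<Sum>i\<in>{..<m} - I. coord z i * y' i)"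
      using I by (subst sum.subset_diff[of I]) auto
    also have "(\<Sum>i\<in>{..<m} - I. coord z i * y' i) = (\<Sum>i\<in>{..<m} - I. - \<bar>coord z i\<bar> / 2)"
      by (intro sum.cong refl) (simp add: y'_def abs_sgn)
    also have "(\<Sum>i\<in>I. coord z i * y' i) = (\<Sum>i\<in>I. coord z i * e i)"
      by (intro sum.cong refl) (simp add: y'_def)
    finally show ?thesis .
  qed
  \<comment> \<open>The first-order condition reads \<open>dotp z y <= dotp z y'\<close>, and
    \<open>dotp z y = dotp z z\<close> because \<open>z\<close> is the residual of
    \<open>y\<close>.\<close>
  finally have "dotp z z \<le> (\<Sum>i\<in>I. coord z i * e i) - (\<Sum>i\<in>{..<m} - I. \<bar>coord z i\<bar>) / 2"
    by (simp add: sum_negf sum_divide_distrib)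
  moreover have "(\<Sum>i\<in>I. coord z i * e i) \<le> (\<Sum>i\<in>I. \<bar>coord z i\<bar>)"
    by (intro sum_mono) (use signsD[OF e] in fastforce)
  moreover have "2 * (\<Sum>i\<in>I. \<bar>coord z i\<bar>) \<le> (\<Sum>i\<in>{..<m} - I. \<bar>coord z i\<bar>)"
    using res_perp by (intro nsp zR I) (simp add: z_def)
  ultimately have "dotp z z \<le> 0" by linarith
  then have "z = 0" using dotp_self_nonneg[of z] dotp_self_eq_0[of z] by linarith
  then have "rvec_of m y = orth_proj E (rvec_of m y)" by (simp add: z_def res_def)
  then have "rvec_of m y \<in> E" using orth_proj_in[OF E basis] by metis
  moreover have "coord (rvec_of m y) i = e i" if "i \<in> I" for i
    using yT[of i] that I by (auto simp: coord_rvec_of T_def)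
  moreover have "\<bar>coord (rvec_of m y) j\<bar> < 1" if "j \<in> {..<m} - I" for j
    using yT[of j] that by (auto simp: coord_rvec_of T_def)
  ultimately show "\<exists>x\<in>E. (\<forall>i\<in>I. coord x i = e i) \<and> (\<forall>j\<in>{..<m} - I. \<bar>coord x j\<bar> < 1)"
    by blast
qed

text \<open>Coordinates are fixed one at a time: for given signs on the rest, a segment joins a
  point with \<open>g i >= 1\<close> to one with \<open>g i <= -1\<close>, so it meets
  \<open>g i = y i\<close>, and the inequalities for the other indices survive on the segment. The
  lemma recovers equations from inequalities over all sign vectors.\<close>

lemma convex_contains_cube:
  fixes g :: "'i \<Rightarrow> 'a::real_vector \<Rightarrow> real"
  assumes "finite I" "convex K" "\<And>i. i \<in> I \<Longrightarrow> linear (g i)"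
    and "\<And>e. e \<in> signs I \<Longrightarrow> \<exists>x\<in>K. \<forall>i\<in>I. 1 \<le> e i * g i x"
    and "\<And>i. i \<in> I \<Longrightarrow> \<bar>y i\<bar> \<le> 1"
  shows "\<exists>x\<in>K. \<forall>i\<in>I. g i x = y i"
  using assms
proof (induction I arbitrary: K rule: finite_induct)
  case empty
  have "(\<lambda>_. undefined) \<in> signs ({} :: 'i set)" by (simp add: signs_def)
  then show ?case using empty.prems(3) by blast
next
  case (insert i I)
  let ?K = "{x \<in> K. g i x = y i}"
  have lin: "linear (g j)" if "j \<in> insert i I" for j using insert.prems(2) that by blast
  have "convex ?K"
    using insert.prems(1) lin[of i]
    by (auto simp: convex_def linear_add linear_scale simp flip: distrib_right)
  moreover have "\<exists>x\<in>?K. \<forall>j\<in>I. 1 \<le> e j * g j x" if e: "e \<in> signs I" for e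
  proof -
    have es: "e(i := s) \<in> signs (insert i I)" if "s = 1 \<or> s = -1" for s
      using e that insert.hyps by (auto simp: signs_def PiE_def extensional_def)
    obtain x where x: "x \<in> K" "\<forall>j\<in>insert i I. 1 \<le> (e(i := 1)) j * g j x"
      using insert.prems(3)[OF es[of 1]] by blast
    obtain x' where x': "x' \<in> K" "\<forall>j\<in>insert i I. 1 \<le> (e(i := -1)) j * g j x'"
      using insert.prems(3)[OF es[of "-1"]] by blast
    have gi: "1 \<le> g i x" "g i x' \<le> -1" using x(2) x'(2) by auto
    have yi: "-1 \<le> y i" "y i \<le> 1" using insert.prems(4)[of i] by (auto simp: abs_le_iff)
    define t where "t = (y i - g i x') / (g i x - g i x')"
    have t: "0 \<le> t" "t \<le> 1" using gi yi by (auto simp: t_def field_simps)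
    let ?w = "t *\<^sub>R x + (1 - t) *\<^sub>R x'"
    have gw: "g j ?w = t * g j x + (1 - t) * g j x'" if "j \<in> insert i I" for j
      using lin[OF that] by (simp add: linear_add linear_scale)
    have "?w \<in> K" using insert.prems(1) x x' t by (intro convexD) auto
    moreover have "g i ?w = y i"
    proof -
      have "g i ?w = g i x' + t * (g i x - g i x')" using gw[of i] by (simp add: algebra_simps)
      then show ?thesis using gi by (simp add: t_def)
    qed
    moreover have "1 \<le> e j * g j ?w" if j: "j \<in> I" for j
    proof -
      have "j \<noteq> i" using j insert.hyps by blast
      then have "1 \<le> e j * g j x" "1 \<le> e j * g j x'" using x(2) x'(2) j by auto
      then have "t * 1 + (1 - t) * 1 \<le> t * (e j * g j x) + (1 - t) * (e j * g j x')"
        using t by (intro add_mono mult_left_mono) auto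
      also have "\<dots> = e j * (t * g j x + (1 - t) * g j x')" by (simp add: algebra_simps)
      also have "\<dots> = e j * g j ?w" using gw[of j] j by simp
      finally show ?thesis by simp
    qed
    ultimately show ?thesis by blast
  qed
  ultimately obtain x where "x \<in> ?K" "\<forall>j\<in>I. g j x = y j"
    using insert.IH[of ?K] lin insert.prems(4) by auto
  then show ?case by auto
qed

text \<open>
  Only strict inequalities occur on the right-hand side, so that genericity is an open condition.
\<close>

lemma generic_section_iff_strict:
  assumes E: "E \<in> Grassmannian m R"
  shows "generic_section m r E \<longleftrightarrow> (\<forall>I e. I \<subseteq> {..<m} \<longrightarrow> card I = r \<longrightarrow> e \<in> signs I \<longrightarrow>
    (\<exists>q. (\<forall>i\<in>I. 1 < e i * (\<Sum>j<m. proj_matrix E i j * q j)) \<and>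
      (\<forall>j\<in>{..<m} - I. \<bar>\<Sum>k<m. proj_matrix E j k * q k\<bar> < 1)))"
    (is "_ \<longleftrightarrow> ?R")
proof
  have sub: "subspace E" and ER: "E \<subseteq> Rspace m" and dimE: "dim E = R"
    using E by (auto simp: Grassmannian_def)
  obtain u where u: "orthonormal_basis E R u" using orthonormal_basis_exists[OF sub ER] dimE by blast
  have proj: "coord (orth_proj E (rvec_of m q)) i = (\<Sum>j<m. proj_matrix E i j * q j)" for q i
    unfolding coord_orth_proj[OF ER u rvec_of_in_Rspace] by (simp add: coord_rvec_of)
  {
    assume gen: "generic_section m r E"
    show ?R
    proof (intro allI impI)
      fix I e assume I: "I \<subseteq> {..<m}" "card I = r" and e: "e \<in> signs I"
      obtain x where x: "x \<in> E" "\<forall>i\<in>I. coord x i = e i" "\<forall>j\<in>{..<m} - I. \<bar>coord x j\<bar> < 1"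
        using generic_sectionD[OF sub ER gen I e] by blast
      \<comment> \<open>Zero is inserted because the complement of \<open>I\<close> may be
        empty.\<close>
      define b where "b = Max (insert 0 ((\<lambda>j. \<bar>coord x j\<bar>) ` ({..<m} - I)))"
      have b: "b < 1" "0 \<le> b" using x(3) by (auto simp: b_def)
      have bj: "\<bar>coord x j\<bar> \<le> b" if "j \<in> {..<m} - I" for j using that by (simp add: b_def)
      \<comment> \<open>Scaling by \<open>t\<close> pushes the coordinates on \<open>I\<close>
        beyond 1 in absolute value while \<open>t * b\<close> is still below 1.\<close>
      define t where "t = 2 / (1 + b)"
      have t: "1 < t" "t * b < 1" using b by (auto simp: t_def field_simps)
      have tx: "t *\<^sub>R x \<in> E" using x(1) subspace_scale[OF sub] by blast
      have eq: "(\<Sum>j<m. proj_matrix E i j * (t * coord x j)) = t * coord x i" for i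
      proof -
        have "rvec_of m (\<lambda>j. t * coord x j) = t *\<^sub>R x"
          by (rule Rspace_eqI[of _ m]) (use ER tx in \<open>auto simp: coord_rvec_of\<close>)
        then show ?thesis
          using proj[of "\<lambda>j. t * coord x j" i] orth_proj_id[OF ER u tx] by simp
      qed
      show "\<exists>q. (\<forall>i\<in>I. 1 < e i * (\<Sum>j<m. proj_matrix E i j * q j)) \<and>
          (\<forall>j\<in>{..<m} - I. \<bar>\<Sum>k<m. proj_matrix E j k * q k\<bar> < 1)"
      proof (intro exI[of _ "\<lambda>j. t * coord x j"] conjI ballI)
        fix i assume "i \<in> I"
        then show "1 < e i * (\<Sum>j<m. proj_matrix E i j * (t * coord x j))"
          unfolding eq using x(2) t(1) signs_square[OF e] by (simp add: mult.left_commute)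
      next
        fix j assume "j \<in> {..<m} - I"
        then have "t * \<bar>coord x j\<bar> \<le> t * b" using bj t by (intro mult_left_mono) auto
        then have "t * \<bar>coord x j\<bar> < 1" using t(2) by linarith
        then show "\<bar>\<Sum>k<m. proj_matrix E j k * (t * coord x k)\<bar> < 1"
          unfolding eq using t(1) by (simp add: abs_mult)
      qed
    qed
  next
    assume R: ?R
    show "generic_section m r E"
    proof (rule generic_sectionI[OF sub ER])
      fix I e assume I: "I \<subseteq> {..<m}" "card I = r" and e: "e \<in> signs I"
      let ?K = "{x \<in> E. \<forall>j\<in>{..<m} - I. \<bar>coord x j\<bar> < 1}"
      have "\<exists>x\<in>?K. \<forall>i\<in>I. coord x i = e i"
      proof (rule convex_contains_cube)
        show "finite I" using I finite_subset by blast
        show "convex ?K"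
        proof (rule convexI)
          fix x y and s t :: real
          assume xy: "x \<in> ?K" "y \<in> ?K" and st: "0 \<le> s" "0 \<le> t" "s + t = 1"
          have "\<bar>coord (s *\<^sub>R x + t *\<^sub>R y) j\<bar> < 1" if j: "j \<in> {..<m} - I" for j
          proof -
            have "coord x j \<in> ball 0 1" "coord y j \<in> ball 0 1" using xy j by auto
            then have "s *\<^sub>R coord x j + t *\<^sub>R coord y j \<in> ball 0 1"
              using st by (intro convexD[OF convex_ball])
            then show ?thesis by (simp add: lookup_add)
          qed
          moreover have "s *\<^sub>R x + t *\<^sub>R y \<in> E"
            using xy sub by (auto intro: subspace_add subspace_scale)
          ultimately show "s *\<^sub>R x + t *\<^sub>R y \<in> ?K" by blast
        qed
        show "linear (\<lambda>x. coord x i)" for i by (rule linear_coord)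
        show "\<bar>e i\<bar> \<le> 1" if "i \<in> I" for i using signsD[OF e that] by auto
        fix e' assume e': "e' \<in> signs I"
        obtain q where q: "\<forall>i\<in>I. 1 < e' i * (\<Sum>j<m. proj_matrix E i j * q j)"
          "\<forall>j\<in>{..<m} - I. \<bar>\<Sum>k<m. proj_matrix E j k * q k\<bar> < 1"
          using R I e' by blast
        have "orth_proj E (rvec_of m q) \<in> ?K"
          using q(2) orth_proj_in[OF ER u] by (simp add: proj)
        moreover have "\<forall>i\<in>I. 1 \<le> e' i * coord (orth_proj E (rvec_of m q)) i"
          using q(1) by (auto simp: proj intro: less_imp_le)
        ultimately show "\<exists>x\<in>?K. \<forall>i\<in>I. 1 \<le> e' i * coord x i" by blast
      qed
      then show "\<exists>x\<in>E. (\<forall>i\<in>I. coord x i = e i) \<and> (\<forall>j\<in>{..<m} - I. \<bar>coord x j\<bar> < 1)" by blast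
    qed
  }
qed

lemma continuous_on_matrix_row:
  "continuous_on UNIV (\<lambda>M :: nat \<Rightarrow> nat \<Rightarrow> real. \<Sum>j<m. M i j * q j)"
proof (intro continuous_intros)
  fix j
  have "continuous_on UNIV (\<lambda>M :: nat \<Rightarrow> nat \<Rightarrow> real. M i)"
    by (rule continuous_on_product_coordinates)
  then show "continuous_on UNIV (\<lambda>M :: nat \<Rightarrow> nat \<Rightarrow> real. M i j)"
    by (rule continuous_on_product_then_coordinatewise)
qed

text \<open>For a fixed witness \<open>q\<close> the conditions are open in the projection matrix;
  witnesses enter through a union, patterns through a finite intersection.\<close>

lemma openin_generic_sections:
  assumes r: "r \<le> m"
  shows "openin (Grassmannian_topology m R) {E \<in> Grassmannian m R. generic_section m r E}"
proof -
  let ?row = "\<lambda>(M :: nat \<Rightarrow> nat \<Rightarrow> real) q i. \<Sum>j<m. M i j * q j"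
  let ?U = "\<lambda>I e q. {M. (\<forall>i\<in>I. 1 < e i * ?row M q i) \<and> (\<forall>j\<in>{..<m} - I. \<bar>?row M q j\<bar> < 1)}"
  let ?F = "{(I, e). I \<subseteq> {..<m} \<and> card I = r \<and> e \<in> signs I}"
  let ?V = "\<Inter>(I, e)\<in>?F. \<Union>q. ?U I e q"
  have "open (?U I e q)" if "I \<subseteq> {..<m}" for I e q
  proof -
    have fin: "finite I" using that finite_subset by blast
    have "?U I e q = (\<Inter>i\<in>I. {M. 1 < e i * ?row M q i}) \<inter> (\<Inter>j\<in>{..<m} - I. {M. \<bar>?row M q j\<bar> < 1})"
      by auto
    moreover have "open {M. 1 < e i * ?row M q i}" "open {M. \<bar>?row M q i\<bar> < 1}" for i
      by (intro open_Collect_less continuous_intros continuous_on_matrix_row)+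
    ultimately show ?thesis using fin by (simp only:) (intro open_Int open_INT; simp)
  qed
  moreover have "finite ?F"
  proof (rule finite_subset)
    show "?F \<subseteq> (SIGMA I : Pow {..<m}. signs I)" by auto
    show "finite (SIGMA I : Pow {..<m}. signs I)"
      by (intro finite_SigmaI) (auto intro: finite_signs finite_subset)
  qed
  ultimately have "open ?V" by (intro open_INT ballI) (auto intro!: open_UN)
  moreover have "{E \<in> Grassmannian m R. generic_section m r E} = proj_matrix -` ?V \<inter> Grassmannian m R"
  proof (rule set_eqI)
    fix E
    show "E \<in> {E \<in> Grassmannian m R. generic_section m r E} \<longleftrightarrow> E \<in> proj_matrix -` ?V \<inter> Grassmannian m R"
      using generic_section_iff_strict[of E m R r] by auto
  qed
  ultimately show ?thesis
    unfolding Grassmannian_topology_def openin_pullback_topology by auto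
qed

subsection \<open>Symmetric polytopes\<close>

context sym_polyhedron
begin

text \<open>A point violating only constraint \<open>i\<close> is scaled back until \<open>i\<close>
  is tight; all other constraints then become strict.\<close>

lemma irredundant_imp_hits_patterns:
  assumes irr: "\<And>i. i \<in> J \<Longrightarrow> \<exists>y\<in>W. (\<forall>j\<in>J - {i}. \<bar>g j y\<bar> \<le> 1) \<and> 1 < \<bar>g i y\<bar>"
  shows "hits_patterns 1"
  unfolding hits_patterns_def
proof (intro allI impI)
  fix I e assume "(I, e) \<in> patterns 1"
  then obtain i where I: "I = {i}" "i \<in> J" "e \<in> signs I"
    by (auto simp: patterns_def card_1_singleton_iff)
  obtain y where y: "y \<in> W" "\<forall>j\<in>J - {i}. \<bar>g j y\<bar> \<le> 1" "1 < \<bar>g i y\<bar>"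
    using irr[OF I(2)] by blast
  have ei: "\<bar>e i\<bar> = 1" using signsD[OF I(3)] I(1) by auto
  let ?x = "(e i / g i y) *\<^sub>R y"
  have "g i ?x = e i" using y(3) I(2) by (auto simp: g_scale)
  moreover have "\<bar>g j ?x\<bar> < 1" if j: "j \<in> J - {i}" for j
  proof -
    have "\<bar>g j ?x\<bar> = \<bar>g j y\<bar> / \<bar>g i y\<bar>"
      using j ei by (simp add: g_scale abs_mult abs_divide)
    also have "\<dots> < 1"
    proof -
      have "\<bar>g j y\<bar> < \<bar>g i y\<bar>" using y(2,3) j by force
      then show ?thesis using y(3) by (simp add: divide_less_eq)
    qed
    finally show ?thesis .
  qed
  ultimately show "\<exists>x\<in>W. (\<forall>i\<in>I. g i x = e i) \<and> (\<forall>j\<in>J - I. \<bar>g j x\<bar> < 1)"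
    using y(1) I(1) W_scale by blast
qed

lemma remove_redundant:
  assumes i: "i \<in> J" and red: "\<And>y. y \<in> W \<Longrightarrow> (\<forall>j\<in>J - {i}. \<bar>g j y\<bar> \<le> 1) \<Longrightarrow> \<bar>g i y\<bar> \<le> 1"
  shows "sym_polyhedron W (J - {i}) g" "sym_polyhedron.body W (J - {i}) g = body"
proof -
  show loc: "sym_polyhedron W (J - {i}) g"
  proof (rule sym_polyhedron.intro)
    fix x assume x: "x \<in> W" "\<And>j. j \<in> J - {i} \<Longrightarrow> g j x = 0"
    have "g i x = 0"
    proof (rule ccontr)
      assume nz: "g i x \<noteq> 0"
      \<comment> \<open>If \<open>g i x\<close> were nonzero, this multiple of \<open>x\<close>
        would have value 2 at \<open>i\<close> while satisfying all other constraints, so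
        \<open>i\<close> would not be redundant.\<close>
      have "\<bar>g i ((2 / g i x) *\<^sub>R x)\<bar> \<le> 1"
        using x by (intro red W_scale) (auto simp: g_scale)
      then show False using nz i by (simp add: g_scale)
    qed
    then show "x = 0" using x by (intro separating) auto
  qed (use subspace_W finite_J linear_g in auto)
  show "sym_polyhedron.body W (J - {i}) g = body"
    unfolding sym_polyhedron.body_def[OF loc] body_def using red i by auto
qed

end

section \<open>Finitely generated cones and half-space descriptions\<close>

definition nonneg_span :: "'a::real_vector set \<Rightarrow> 'a set" where
  "nonneg_span S = {\<Sum>v\<in>S. c v *\<^sub>R v |c. \<forall>v\<in>S. 0 \<le> c v}"

lemma nonneg_span_insert:
  assumes "finite S" "v \<notin> S"
  shows "x \<in> nonneg_span (insert v S) \<longleftrightarrow> (\<exists>t\<ge>0. x - t *\<^sub>R v \<in> nonneg_span S)"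
proof
  assume "x \<in> nonneg_span (insert v S)"
  then obtain c where c: "x = (\<Sum>w\<in>insert v S. c w *\<^sub>R w)" "\<forall>w\<in>insert v S. 0 \<le> c w"
    unfolding nonneg_span_def by blast
  have "x - c v *\<^sub>R v = (\<Sum>w\<in>S. c w *\<^sub>R w)" using c(1) assms by simp
  then show "\<exists>t\<ge>0. x - t *\<^sub>R v \<in> nonneg_span S"
    using c(2) unfolding nonneg_span_def by blast
next
  assume "\<exists>t\<ge>0. x - t *\<^sub>R v \<in> nonneg_span S"
  then obtain t c where t: "t \<ge> 0" "x - t *\<^sub>R v = (\<Sum>w\<in>S. c w *\<^sub>R w)" "\<forall>w\<in>S. 0 \<le> c w"
    unfolding nonneg_span_def by blast
  have "(\<Sum>w\<in>S. c w *\<^sub>R w) = (\<Sum>w\<in>S. (c(v := t)) w *\<^sub>R w)"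
    using assms by (intro sum.cong) auto
  then have "x = (\<Sum>w\<in>insert v S. (c(v := t)) w *\<^sub>R w)"
    using assms t(2) by (simp add: algebra_simps)
  moreover have "\<forall>w\<in>insert v S. 0 \<le> (c(v := t)) w" using t by simp
  ultimately show "x \<in> nonneg_span (insert v S)" unfolding nonneg_span_def by blast
qed

text \<open>Fourier--Motzkin elimination, one generator at a time.\<close>

lemma nonneg_span_halfspaces:
  fixes X :: "'a::real_vector set" and \<Phi> :: "('a \<Rightarrow> real) set"
  assumes X: "subspace X" and \<Phi>: "finite \<Phi>" "\<And>f. f \<in> \<Phi> \<Longrightarrow> linear f"
    "\<And>x. x \<in> X \<Longrightarrow> (\<And>f. f \<in> \<Phi> \<Longrightarrow> f x = 0) \<Longrightarrow> x = 0"
    and S: "finite S" "S \<subseteq> X"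
  shows "\<exists>G :: ('a \<Rightarrow> real) set. finite G \<and> (\<forall>f\<in>G. linear f) \<and>
    nonneg_span S = {x \<in> X. \<forall>f\<in>G. f x \<le> 0}"
  using S
proof (induction S rule: finite_induct)
  case empty
  \<comment> \<open>The zero cone is cut out by requiring both signs of every separating functional
    to be nonpositive.\<close>
  let ?G = "\<Phi> \<union> (\<lambda>f x. - f x) ` \<Phi>"
  have "{x \<in> X. \<forall>f\<in>?G. f x \<le> 0} = {0}"
  proof (intro equalityI subsetI)
    fix x assume "x \<in> {x \<in> X. \<forall>f\<in>?G. f x \<le> 0}"
    then have "x \<in> X" and le: "\<forall>f\<in>?G. f x \<le> 0" by auto
    have "f x = 0" if "f \<in> \<Phi>" for f
    proof -
      have "f x \<le> 0" using le that by blast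
      moreover have "(\<lambda>x. - f x) x \<le> 0" using le by (rule bspec) (use that in blast)
      ultimately show ?thesis by simp
    qed
    then have "x = 0" using \<open>x \<in> X\<close> by (rule \<Phi>(3)[rotated])
    then show "x \<in> {0}" by simp
  qed (use X \<Phi>(2) in \<open>auto simp: subspace_0 linear_0\<close>)
  moreover have "nonneg_span {} = {0 :: 'a}" by (auto simp: nonneg_span_def)
  moreover have "\<forall>f\<in>?G. linear f" using \<Phi>(2) by (auto intro: linear_compose_neg)
  moreover have "finite ?G" using \<Phi>(1) by simp
  ultimately show ?case by (intro exI[of _ ?G] conjI) (simp_all only:)
next
  case (insert v S)
  then obtain G :: "('a \<Rightarrow> real) set" where G: "finite G" "\<forall>f\<in>G. linear f"
    "nonneg_span S = {x \<in> X. \<forall>f\<in>G. f x \<le> 0}"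
    by auto
  have v: "v \<in> X" using insert by simp
  define Z where "Z = {f \<in> G. f v \<le> 0}"
  define P where "P = {f \<in> G. f v > 0}"
  define N where "N = {f \<in> G. f v < 0}"
  \<comment> \<open>Membership means that some \<open>t >= 0\<close> satisfies
    \<open>f x <= t * f v\<close> for all \<open>f\<close>. Functionals in \<open>P\<close> bound
    \<open>t\<close> from below and those in \<open>N\<close> from above; the pairs compare these
    bounds, and \<open>Z\<close> compares the upper ones with 0.\<close>
  define G' where "G' = Z \<union> (\<lambda>(p, n) x. p v * n x - n v * p x) ` (P \<times> N)"
  have lin: "f (x - t *\<^sub>R v) = f x - t * f v" if "f \<in> G" for f x t
    using G(2) that by (simp add: linear_diff linear_scale)
  have "(\<exists>t\<ge>0. \<forall>f\<in>G. f x \<le> t * f v) \<longleftrightarrow> (\<forall>f\<in>G'. f x \<le> 0)" for x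
  proof
    assume "\<exists>t\<ge>0. \<forall>f\<in>G. f x \<le> t * f v"
    then obtain t where t: "t \<ge> 0" "\<And>f. f \<in> G \<Longrightarrow> f x \<le> t * f v" by blast
    show "\<forall>f\<in>G'. f x \<le> 0"
    proof
      fix f assume "f \<in> G'"
      then consider "f \<in> Z" | p n where "p \<in> P" "n \<in> N" "f = (\<lambda>x. p v * n x - n v * p x)"
        by (auto simp: G'_def)
      then show "f x \<le> 0"
      proof cases
        case 1
        then have "f x \<le> t * f v" "f v \<le> 0" using t(2) by (auto simp: Z_def)
        then show ?thesis using t(1) mult_nonneg_nonpos[of t "f v"] by linarith
      next
        case 2
        then have "p v > 0" "n v < 0" "p x \<le> t * p v" "n x \<le> t * n v"
          using t(2) by (auto simp: P_def N_def)
        then have "p v * n x \<le> p v * (t * n v)" "n v * (t * p v) \<le> n v * p x"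
          by (auto intro: mult_left_mono mult_left_mono_neg)
        then show ?thesis unfolding 2(3) by (simp add: mult_ac)
      qed
    qed
  next
    assume le: "\<forall>f\<in>G'. f x \<le> 0"
    \<comment> \<open>The largest of the lower bounds on \<open>t\<close>, including 0.\<close>
    define t where "t = Max (insert 0 ((\<lambda>p. p x / p v) ` P))"
    have finP: "finite P" using G(1) by (simp add: P_def)
    have t0: "0 \<le> t" unfolding t_def using finP by (intro Max_ge) auto
    have tp: "p x / p v \<le> t" if "p \<in> P" for p unfolding t_def using finP that by (intro Max_ge) auto
    have "t \<in> insert 0 ((\<lambda>p. p x / p v) ` P)" unfolding t_def using finP by (intro Max_in) auto
    then have t_cases: "t = 0 \<or> (\<exists>p\<in>P. t = p x / p v)" by blast
    have "f x \<le> t * f v" if f: "f \<in> G" for f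
    proof -
      consider "f v > 0" | "f v = 0" | "f v < 0" by linarith
      then show ?thesis
      proof cases
        case 1
        then show ?thesis using tp[of f] f by (simp add: P_def divide_le_eq)
      next
        case 2
        then show ?thesis using le f by (simp add: G'_def Z_def)
      next
        case 3
        then have fN: "f \<in> N" "f \<in> Z" using f by (auto simp: N_def Z_def)
        show ?thesis
          using t_cases
        proof
          assume "t = 0"
          then show ?thesis using le fN by (simp add: G'_def)
        next
          assume "\<exists>p\<in>P. t = p x / p v"
          then obtain p where p: "p \<in> P" "t = p x / p v" by blast
          then have pv: "p v > 0" by (simp add: P_def)
          have "(\<lambda>x. p v * f x - f v * p x) \<in> G'" using p(1) fN(1) by (force simp: G'_def)
          with le have "(\<lambda>x. p v * f x - f v * p x) x \<le> 0" by (rule bspec)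
          then show ?thesis using pv p(2) by (simp add: le_divide_eq mult_ac)
        qed
      qed
    qed
    then show "\<exists>t\<ge>0. \<forall>f\<in>G. f x \<le> t * f v" using t0 by blast
  qed
  moreover have "x \<in> nonneg_span (insert v S) \<longleftrightarrow> x \<in> X \<and> (\<exists>t\<ge>0. \<forall>f\<in>G. f x \<le> t * f v)" for x
  proof -
    have "x - t *\<^sub>R v \<in> X \<longleftrightarrow> x \<in> X" for t
      using subspace_add[OF X, of "x - t *\<^sub>R v" "t *\<^sub>R v"] subspace_diff[OF X, of x "t *\<^sub>R v"]
        subspace_scale[OF X v] by auto
    moreover have "(\<forall>f\<in>G. f (x - t *\<^sub>R v) \<le> 0) \<longleftrightarrow> (\<forall>f\<in>G. f x \<le> t * f v)" for t
      by (intro ball_cong refl) (simp add: lin[of _ x t])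
    ultimately show ?thesis
      unfolding nonneg_span_insert[OF insert.hyps] G(3) mem_Collect_eq by blast
  qed
  ultimately have "nonneg_span (insert v S) = {x \<in> X. \<forall>f\<in>G'. f x \<le> 0}" by auto
  moreover have "finite G'" using G(1) by (simp add: G'_def Z_def P_def N_def)
  moreover have "\<forall>f\<in>G'. linear f"
    using G(2) unfolding G'_def Z_def P_def N_def
    by (auto intro!: linear_compose_sub linear_compose_scale_right[where 'b = real, simplified])
  ultimately show ?case by blast
qed

lemma finite_subset_Rspace: "finite V \<Longrightarrow> \<exists>M. V \<subseteq> Rspace M"
proof -
  assume "finite V"
  then have "finite (\<Union>v\<in>V. Poly_Mapping.keys v)" by simp
  then obtain M where "\<forall>n\<in>(\<Union>v\<in>V. Poly_Mapping.keys v). n < M"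
    using finite_nat_set_iff_bounded by blast
  then show ?thesis by (intro exI[of _ M]) (auto simp: Rspace_def)
qed

text \<open>Homogenisation: \<open>x\<close> lies in the convex hull of \<open>V\<close> iff
  \<open>(x, 1)\<close> lies in the cone generated by the points \<open>(v, 1)\<close>. The finitely
  many vertices have a common bound on their supports, which places everything in some
  \<open>Rspace M\<close>.\<close>

lemma polytope_halfspaces:
  fixes Q :: "rvec set"
  assumes "polytope Q"
  shows "\<exists>M G. finite G \<and> (\<forall>f\<in>G. linear (f :: rvec \<times> real \<Rightarrow> real)) \<and> Q = {x \<in> Rspace M. \<forall>f\<in>G. f (x, 1) \<le> 0}"
proof -
  obtain V where V: "finite V" "Q = convex hull V" using assms by (auto simp: polytope_def)
  obtain M where M: "V \<subseteq> Rspace M" using finite_subset_Rspace[OF V(1)] by blast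
  let ?h = "\<lambda>v :: rvec. (v, 1 :: real)"
  let ?X = "Rspace M \<times> (UNIV :: real set)"
  let ?\<Phi> = "insert snd ((\<lambda>i p. coord (fst p) i) ` {..<M}) :: (rvec \<times> real \<Rightarrow> real) set"
  have "\<exists>G :: (rvec \<times> real \<Rightarrow> real) set. finite G \<and> (\<forall>f\<in>G. linear f) \<and>
      nonneg_span (?h ` V) = {x \<in> ?X. \<forall>f\<in>G. f x \<le> 0}"
  proof (rule nonneg_span_halfspaces)
    show "subspace ?X" using subspace_Rspace subspace_UNIV by (rule subspace_Times)
    show "linear f" if "f \<in> ?\<Phi>" for f
      using that linear_compose[OF linear_fst linear_coord] by (auto simp: linear_snd o_def)
    show "x = 0" if "x \<in> ?X" "\<And>f. f \<in> ?\<Phi> \<Longrightarrow> f x = 0" for x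
    proof -
      have "snd x = 0" "\<And>i. i < M \<Longrightarrow> coord (fst x) i = 0" using that(2) by auto
      moreover have "fst x \<in> Rspace M" using that(1) by auto
      ultimately have "fst x = 0" "snd x = 0"
        using subspace_0[OF subspace_Rspace] by (auto intro!: Rspace_eqI[of _ M])
      then show ?thesis by (simp add: prod_eq_iff)
    qed
  qed (use V M in auto)
  then obtain G :: "(rvec \<times> real \<Rightarrow> real) set" where G: "finite G" "\<forall>f\<in>G. linear f"
    "nonneg_span (?h ` V) = {x \<in> ?X. \<forall>f\<in>G. f x \<le> 0}"
    by blast
  have "x \<in> Q \<longleftrightarrow> (x, 1) \<in> nonneg_span (?h ` V)" for x
  proof -
    have inj: "inj_on ?h V" by (auto intro: inj_onI)
    have sum: "(\<Sum>w\<in>?h ` V. c w *\<^sub>R w) = (\<Sum>v\<in>V. c (v, 1) *\<^sub>R v, \<Sum>v\<in>V. c (v, 1))" for c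
      unfolding sum.reindex[OF inj] by (simp add: sum_prod)
    show ?thesis
    proof
      assume "x \<in> Q"
      then obtain c where "\<forall>v\<in>V. 0 \<le> c v" "sum c V = 1" "(\<Sum>v\<in>V. c v *\<^sub>R v) = x"
        unfolding V(2) convex_hull_finite[OF V(1)] by blast
      then show "(x, 1) \<in> nonneg_span (?h ` V)"
        unfolding nonneg_span_def mem_Collect_eq
        by (intro exI[of _ "\<lambda>w. c (fst w)"]) (auto simp: sum)
    next
      assume "(x, 1) \<in> nonneg_span (?h ` V)"
      then obtain c where "(x, 1) = (\<Sum>w\<in>?h ` V. c w *\<^sub>R w)" "\<forall>w\<in>?h ` V. 0 \<le> c w"
        unfolding nonneg_span_def by blast
      then show "x \<in> Q"
        unfolding V(2) convex_hull_finite[OF V(1)] sum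
        by (intro CollectI exI[of _ "\<lambda>v. c (v, 1)"]) auto
    qed
  qed
  then have "Q = {x \<in> Rspace M. \<forall>f\<in>G. f (x, 1) \<le> 0}" using G(3) by auto
  then show ?thesis using G by blast
qed

text \<open>Write each half-space as \<open>a f x <= b f\<close>. Symmetry upgrades it to a bound on
  the absolute value; if \<open>b f = 0\<close> then \<open>a f\<close> vanishes on the whole span,
  and otherwise dividing by \<open>b f\<close> normalises the constraint. Each remaining constraint
  indexes itself.\<close>

lemma sym_polytope_is_body:
  fixes Q :: "rvec set"
  assumes Q: "sym_polytope R n Q"
  shows "\<exists>W J. sym_polyhedron W J (\<lambda>f x. f x) \<and> sym_polyhedron.body W J (\<lambda>f x. f x) = Q"
proof -
  have poly: "polytope Q" and aff: "affdim Q = int R" and sym: "uminus ` Q = Q"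
    using Q by (auto simp: sym_polytope_def)
  have neg: "- x \<in> Q" if "x \<in> Q" for x using sym that by blast
  obtain V where V: "finite V" "Q = convex hull V" using poly by (auto simp: polytope_def)
  have "Q \<noteq> {}" using aff by (auto simp: affdim_def)
  then obtain q where q: "q \<in> Q" by blast
  have "convex Q" unfolding V(2) by (rule convex_convex_hull)
  from convexD[OF this q neg[OF q], of "1 / 2" "1 / 2"] have zero: "0 \<in> Q" by simp
  obtain M G where G: "finite G" "\<forall>f\<in>G. linear (f :: rvec \<times> real \<Rightarrow> real)"
    "Q = {x \<in> Rspace M. \<forall>f\<in>G. f (x, 1) \<le> 0}"
    using polytope_halfspaces[OF poly] by blast
  define a where "a f x = f (x, 0 :: real)" for f :: "rvec \<times> real \<Rightarrow> real" and x
  define b where "b f = - f (0, 1)" for f :: "rvec \<times> real \<Rightarrow> real"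
  have split: "f (x, 1) = a f x - b f" if "f \<in> G" for f x
  proof -
    have "f (x, 1) = f ((x, 0) + (0, 1))" by simp
    then show ?thesis using G(2) that unfolding a_def b_def by (simp only: linear_add)
  qed
  have lin_a: "linear (a f)" if "f \<in> G" for f
    unfolding a_def[abs_def] using G(2) that
    by (intro linear_compose[of "\<lambda>x. (x, 0)" f, unfolded o_def]) (auto intro: linearI)
  have QI: "x \<in> Q \<longleftrightarrow> x \<in> Rspace M \<and> (\<forall>f\<in>G. a f x \<le> b f)" for x
  proof -
    have "(\<forall>f\<in>G. f (x, 1) \<le> 0) \<longleftrightarrow> (\<forall>f\<in>G. a f x \<le> b f)"
      by (intro ball_cong refl) (simp add: split)
    then show ?thesis unfolding G(3) by simp
  qed
  have b0: "0 \<le> b f" if "f \<in> G" for f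
    using zero that lin_a[OF that] by (auto simp: QI linear_0)
  define W where "W = span Q"
  have WM: "W \<subseteq> Rspace M" unfolding W_def by (rule span_minimal[OF _ subspace_Rspace]) (auto simp: QI)
  have abs_le: "\<bar>a f x\<bar> \<le> b f" if "x \<in> Q" "f \<in> G" for x f
    using that neg[OF that(1)] lin_a[OF that(2)] by (auto simp: QI abs_le_iff linear_neg)
  have a_zero: "a f x = 0" if "f \<in> G" "b f = 0" "x \<in> W" for f x
  proof -
    have "span Q \<subseteq> {x. a f x = 0}"
      using abs_le[OF _ that(1)] that(2)
      by (intro span_minimal linear_subspace_kernel lin_a that(1)) auto
    then show ?thesis using that(3) by (auto simp: W_def)
  qed
  define J where "J = (\<lambda>f x. a f x / b f) ` {f \<in> G. b f > 0}"
  have mem: "x \<in> Q \<longleftrightarrow> x \<in> W \<and> (\<forall>h\<in>J. \<bar>h x\<bar> \<le> 1)" for x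
  proof
    assume x: "x \<in> Q"
    then show "x \<in> W \<and> (\<forall>h\<in>J. \<bar>h x\<bar> \<le> 1)"
      using abs_le[OF x] by (auto simp: W_def J_def span_base divide_le_eq)
  next
    assume x: "x \<in> W \<and> (\<forall>h\<in>J. \<bar>h x\<bar> \<le> 1)"
    have "a f x \<le> b f" if f: "f \<in> G" for f
    proof (cases "b f = 0")
      case True
      then show ?thesis using a_zero[OF f] x by simp
    next
      case False
      then have "b f > 0" using b0[OF f] by simp
      then have "(\<lambda>x. a f x / b f) \<in> J" using f unfolding J_def by blast
      from bspec[OF conjunct2[OF x] this] have "\<bar>a f x / b f\<bar> \<le> 1" .
      then show ?thesis using \<open>b f > 0\<close> by (simp add: divide_le_eq)
    qed
    then show "x \<in> Q" using x WM by (auto simp: QI)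
  qed
  have loc: "sym_polyhedron W J (\<lambda>f x. f x)"
  proof (rule sym_polyhedron.intro)
    show "subspace W" by (simp add: W_def)
    show "finite J" using G(1) by (simp add: J_def)
    show "linear (\<lambda>x. h x)" if "h \<in> J" for h
      using that lin_a linear_compose_scale_right[of "a _" "1 / b _"]
      by (auto simp: J_def divide_inverse mult.commute)
    fix x assume x: "x \<in> W" "\<And>h. h \<in> J \<Longrightarrow> h x = 0"
    have hlin: "h (t *\<^sub>R x) = 0" if "h \<in> J" for h t
    proof -
      obtain f where f: "f \<in> G" "h = (\<lambda>x. a f x / b f)" using \<open>h \<in> J\<close> by (auto simp: J_def)
      then show ?thesis using x(2)[OF \<open>h \<in> J\<close>] lin_a[OF f(1)] by (simp add: linear_scale)
    qed
    \<comment> \<open>If all functionals vanish at \<open>x\<close>, the whole line through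
      \<open>x\<close> lies in \<open>Q\<close>; boundedness of \<open>Q\<close> then forces
      \<open>x = 0\<close>.\<close>
    have "t *\<^sub>R x \<in> Q" for t
      unfolding mem
    proof (intro conjI ballI)
      show "t *\<^sub>R x \<in> W" using x(1) by (simp add: W_def span_scale)
      show "\<bar>h (t *\<^sub>R x)\<bar> \<le> 1" if "h \<in> J" for h using hlin[OF that, of t] by simp
    qed
    moreover have "bounded Q"
      unfolding V(2) by (intro bounded_convex_hull finite_imp_bounded V(1))
    then obtain B where B: "\<And>y. y \<in> Q \<Longrightarrow> norm y \<le> B" unfolding bounded_iff by blast
    ultimately have le: "\<bar>t\<bar> * norm x \<le> B" for t
      by (metis norm_scaleR)
    show "x = 0"
    proof (rule ccontr)
      assume "x \<noteq> 0"
      then show False using le[of "(\<bar>B\<bar> + 1) / norm x"] by (simp add: abs_divide)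
    qed
  qed
  moreover have "sym_polyhedron.body W J (\<lambda>f x. f x) = Q"
    unfolding sym_polyhedron.body_def[OF loc] using mem by blast
  ultimately show ?thesis by blast
qed

lemma sym_polytope_card_faces_le:
  fixes Q :: "rvec set"
  assumes Q: "sym_polytope R n Q" and R: "0 < R" and k: "k \<le> R"
  shows "card (faces Q (int R - int k)) \<le> 2 ^ k * (n choose k)"
proof -
  let ?rep = "\<lambda>W J. sym_polyhedron W J (\<lambda>f x. f x) \<and> sym_polyhedron.body W J (\<lambda>f x. f x) = Q"
  obtain W J0 where "?rep W J0" using sym_polytope_is_body[OF Q] by blast
  then obtain J where J: "?rep W J" and min: "\<And>J'. ?rep W J' \<Longrightarrow> card J \<le> card J'"
    using ex_has_least_nat[of "?rep W" J0 card] by blast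
  interpret sym_polyhedron W J "\<lambda>f x. f x" using J by blast
  have body: "body = Q" using J by blast
  have dimW: "dim W = R" using affdim_body Q body by (simp add: sym_polytope_def)
  have "hits_patterns 1"
  proof (rule irredundant_imp_hits_patterns)
    fix i assume i: "i \<in> J"
    show "\<exists>y\<in>W. (\<forall>j\<in>J - {i}. \<bar>j y\<bar> \<le> 1) \<and> 1 < \<bar>i y\<bar>"
    proof (rule ccontr)
      assume "\<not> ?thesis"
      then have "\<And>y. y \<in> W \<Longrightarrow> (\<forall>j\<in>J - {i}. \<bar>j y\<bar> \<le> 1) \<Longrightarrow> \<bar>i y\<bar> \<le> 1" by force
      from remove_redundant[OF i this] have "card J \<le> card (J - {i})"
        using body by (intro min) auto
      then show False using i finite_J card_Diff1_less[of J i] by simp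
    qed
  qed
  \<comment> \<open>Without constraints \<open>W\<close> would be zero, against
    \<open>0 < R\<close>.\<close>
  moreover have "1 \<le> card J"
  proof (rule ccontr)
    assume "\<not> 1 \<le> card J"
    then have "J = {}" using finite_J by (simp add: not_le)
    then have "W \<subseteq> {0}" using separating by blast
    then have "dim W \<le> card ({} :: rvec set)" by (intro dim_le_card) (auto simp: span_zero)
    then show False using dimW R by simp
  qed
  ultimately have "card (faces body (int (dim W) - int 1)) = 2 ^ 1 * (card J choose 1)"
    by (rule card_faces_eq)
  moreover have "card (faces Q (int R - 1)) = 2 * n" using Q by (simp add: sym_polytope_def)
  ultimately have "card J = n" using body dimW by simp
  then show ?thesis using card_faces_le[of k] k body dimW by simp
qed

text \<open>Common to both random models: \<open>Q\<close> is \<open>m/R\<close> times the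
  projection matrix in one, and a normalised Gram matrix of sign vectors in the other. The
  approximation is demanded only on a finite set, so that a union bound can provide it.\<close>

lemma near_isometry_imp_generic_section:
  assumes E: "subspace E" "E \<subseteq> Rspace m" and r: "0 < r"
    and near: "\<And>w. w \<in> integer_vectors m (10 * r) \<Longrightarrow>
      \<bar>bform m Q (\<lambda>i. real_of_int (w i)) (\<lambda>i. real_of_int (w i)) - (\<Sum>i<m. (real_of_int (w i))\<^sup>2)\<bar>
        \<le> (\<Sum>i<m. (real_of_int (w i))\<^sup>2) / 3"
    and ker: "\<And>z. z \<in> Rspace m \<Longrightarrow> (\<And>x. x \<in> E \<Longrightarrow> dotp z x = 0) \<Longrightarrow> bform m Q (coord z) (coord z) = 0"
  shows "generic_section m r E"
proof -
  obtain u where u: "orthonormal_basis E (dim E) u" using orthonormal_basis_exists[OF E] by blast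
  show ?thesis
  proof (rule null_space_property_imp_generic[OF E(2) u])
    fix z I assume z: "z \<in> Rspace m" "\<And>x. x \<in> E \<Longrightarrow> dotp z x = 0" and I: "I \<subseteq> {..<m}" "card I = r"
    show "2 * (\<Sum>i\<in>I. \<bar>coord z i\<bar>) \<le> (\<Sum>i\<in>{..<m} - I. \<bar>coord z i\<bar>)"
    proof (rule kernel_null_space_property[OF _ r ker[OF z] I])
      fix w :: "nat \<Rightarrow> int" assume w: "(\<Sum>i<m. \<bar>w i\<bar>) \<le> int (10 * r)"
      define v where "v = restrict w {..<m}"
      have "w i \<in> {- int (10 * r)..int (10 * r)}" if "i < m" for i
      proof -
        have "\<bar>w i\<bar> \<le> int (10 * r)"
          using member_le_sum[of i "{..<m}" "\<lambda>i. \<bar>w i\<bar>"] that w by auto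
        then show ?thesis unfolding atLeastAtMost_iff by linarith
      qed
      then have "v \<in> {..<m} \<rightarrow>\<^sub>E {- int (10 * r)..int (10 * r)}"
        unfolding v_def by (simp only: restrict_PiE_iff lessThan_iff) blast
      moreover have "(\<Sum>i<m. \<bar>v i\<bar>) \<le> int (10 * r)" using w by (simp add: v_def)
      ultimately have "v \<in> integer_vectors m (10 * r)" by (simp add: integer_vectors_def)
      from near[OF this] have "\<bar>bform m Q (\<lambda>i. real_of_int (v i)) (\<lambda>i. real_of_int (v i)) - (\<Sum>i<m. (real_of_int (v i))\<^sup>2)\<bar>
        \<le> (\<Sum>i<m. (real_of_int (v i))\<^sup>2) / 3" .
      also have "bform m Q (\<lambda>i. real_of_int (v i)) (\<lambda>i. real_of_int (v i))
          = bform m Q (\<lambda>i. real_of_int (w i)) (\<lambda>i. real_of_int (w i))"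
        by (rule bform_cong) (simp_all add: v_def)
      also have "(\<Sum>i<m. (real_of_int (v i))\<^sup>2) = (\<Sum>i<m. (real_of_int (w i))\<^sup>2)"
        by (intro sum.cong refl) (simp add: v_def)
      finally show "\<bar>bform m Q (\<lambda>i. real_of_int (w i)) (\<lambda>i. real_of_int (w i)) - (\<Sum>i<m. (real_of_int (w i))\<^sup>2)\<bar>
        \<le> (\<Sum>i<m. (real_of_int (w i))\<^sup>2) / 3" .
    qed
  qed
qed

text \<open>With \<open>l = ln (m/r) >= 1\<close> the integer vectors number at most
  \<open>exp (10 * r * l + 40 * r)\<close>, and the factor 2 costs at most \<open>exp r\<close>. The
  total exponent is at most \<open>51 * r * l\<close>, hence below \<open>R/1152\<close>, half of
  the available \<open>R/576\<close>.\<close>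

lemma net_bound:
  fixes m r R :: nat
  assumes r: "0 < r" "real r < 1 / 1152 * real m"
    and R: "real R \<ge> 100000 * real r * ln (real m / real r)"
  shows "1 \<le> ln (real m / real r)" "r \<le> m" "r \<le> R"
    "real (card (integer_vectors m (10 * r))) * (2 * exp (- (real R / 576))) \<le> exp (- (1 / 1152) * real R)"
proof -
  define l where "l = ln (real m / real r)"
  have mr: "1152 < real m / real r" using r by (simp add: field_simps)
  show "r \<le> m" using r by linarith
  have "exp 1 \<le> real m / real r" using exp_le mr by linarith
  then show l1: "1 \<le> ln (real m / real r)" using mr by (subst ln_ge_iff) auto
  then have l: "1 \<le> l" by (simp add: l_def)
  have expl: "exp l = real m / real r" using mr by (simp add: l_def)
  have rl: "real r \<le> real r * l" using l by (simp add: mult_le_cancel_left1)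
  have Rl: "100000 * (real r * l) \<le> real R" using R by (simp add: l_def)
  then show "r \<le> R" using rl by linarith
  have "real (card (integer_vectors m (10 * r)))
      \<le> (real m / real (10 * r)) ^ (10 * r) * exp (4 * real (10 * r))"
    using r by (intro card_integer_vectors_le) linarith+
  also have "(real m / real (10 * r)) ^ (10 * r) \<le> exp l ^ (10 * r)"
    unfolding expl using r by (intro power_mono divide_left_mono) auto
  also have "exp l ^ (10 * r) = exp (real (10 * r) * l)"
    by (rule exp_of_nat_mult[symmetric])
  finally have card: "real (card (integer_vectors m (10 * r))) \<le> exp (10 * (real r * l) + 40 * real r)"
    by (simp add: exp_add mult_ac)
  have "(2 :: real) \<le> exp 1" using exp_ge_add_one_self[of 1] by simp
  also have "\<dots> \<le> exp (real r)" using r by simp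
  finally have two: "2 \<le> exp (real r)" .
  have "real (card (integer_vectors m (10 * r))) * (2 * exp (- (real R / 576)))
      \<le> exp (10 * (real r * l) + 40 * real r) * (exp (real r) * exp (- (real R / 576)))"
    using card two by (intro mult_mono) auto
  also have "\<dots> = exp (10 * (real r * l) + 41 * real r - real R / 576)"
    by (simp flip: exp_add)
  also have "\<dots> \<le> exp (- (1 / 1152) * real R)"
    using rl Rl by simp
  finally show "real (card (integer_vectors m (10 * r))) * (2 * exp (- (real R / 576))) \<le> exp (- (1 / 1152) * real R)" .
qed

subsection \<open>Existence of a generic subspace\<close>

text \<open>\<open>R * q a\<close> is the squared length of the matrix \<open>a\<close> applied to
  \<open>x\<close>. Its components are inner products of the signs with copies of \<open>x\<close>
  placed in disjoint rows, which are orthonormal after normalising \<open>x\<close>; so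
  \<open>hanson_wright_signs\<close> applies with the matrix entries as signs.\<close>

lemma sign_matrix_deviation:
  fixes x :: "nat \<Rightarrow> real" and m :: nat
  assumes R: "0 < R"
  defines "q \<equiv> \<lambda>a. bform m (\<lambda>i j. (\<Sum>k<R. a (k, i) * a (k, j)) / real R) x x"
  shows "real (card {a \<in> signs ({..<R} \<times> {..<m}). \<bar>q a - (\<Sum>i<m. (x i)\<^sup>2)\<bar> > (\<Sum>i<m. (x i)\<^sup>2) / 3})
    \<le> 2 ^ (R * m) * (2 * exp (- (real R / 576)))"
proof (cases "(\<Sum>i<m. (x i)\<^sup>2) = 0")
  case True
  then have x: "\<forall>i\<in>{..<m}. x i = 0" by (subst (asm) sum_nonneg_eq_0_iff) auto
  then have "q a = 0" for a by (simp add: q_def bform_def)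
  then show ?thesis using True by simp
next
  case False
  define n where "n = (\<Sum>i<m. (x i)\<^sup>2)"
  have n: "n > 0" using False by (simp add: n_def order_less_le sum_nonneg)
  define u where "u k = (\<lambda>(l, i). if l = k then x i / sqrt n else 0)" for k :: nat
  let ?J = "{..<R} \<times> {..<m}"
  have on: "(\<Sum>j\<in>?J. u k j * u l j) = (if k = l then 1 else 0)" if "k \<in> {..<R}" "l \<in> {..<R}" for k l
  proof -
    have "(\<Sum>j\<in>?J. u k j * u l j) = (\<Sum>k'<R. \<Sum>i<m. u k (k', i) * u l (k', i))"
      by (simp add: sum.cartesian_product)
    also have "\<dots> = (\<Sum>k'<R. if k' = k then if k = l then \<Sum>i<m. (x i)\<^sup>2 / n else 0 else 0)"
      using n by (intro sum.cong refl) (simp add: u_def power2_eq_square)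
    also have "\<dots> = (if k = l then 1 else 0)"
      using that n by (simp add: n_def[symmetric] flip: sum_divide_distrib)
    finally show ?thesis .
  qed
  have X: "(\<Sum>k<R. (\<Sum>j\<in>?J. u k j * a j)\<^sup>2) = real R * q a / n" for a
  proof -
    have "(\<Sum>j\<in>?J. u k j * a j) = (\<Sum>i<m. x i * a (k, i)) / sqrt n" if "k < R" for k
    proof -
      have "(\<Sum>j\<in>?J. u k j * a j) = (\<Sum>k'<R. \<Sum>i<m. u k (k', i) * a (k', i))"
        by (simp add: sum.cartesian_product)
      also have "\<dots> = (\<Sum>k'<R. if k' = k then \<Sum>i<m. x i / sqrt n * a (k, i) else 0)"
        by (intro sum.cong refl) (simp add: u_def)
      finally show ?thesis using that by (simp add: sum_divide_distrib)
    qed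
    then have "(\<Sum>k<R. (\<Sum>j\<in>?J. u k j * a j)\<^sup>2) = (\<Sum>k<R. (\<Sum>i<m. x i * a (k, i))\<^sup>2) / n"
      using n by (simp add: power_divide flip: sum_divide_distrib)
    also have "(\<Sum>k<R. (\<Sum>i<m. x i * a (k, i))\<^sup>2) = (\<Sum>k<R. \<Sum>i<m. \<Sum>j<m. a (k, i) * a (k, j) * x i * x j)"
      unfolding power2_eq_square sum_product by (simp add: mult_ac)
    also have "\<dots> = (\<Sum>i<m. \<Sum>j<m. (\<Sum>k<R. a (k, i) * a (k, j)) * x i * x j)"
      unfolding sum_distrib_right
      by (subst sum.swap, rule sum.cong[OF refl], subst sum.swap) (rule refl)
    also have "\<dots> = real R * q a"
      unfolding q_def bform_def sum_distrib_left using R by (intro sum.cong refl) simp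
    finally show ?thesis .
  qed
  have "\<bar>q a - n\<bar> > n / 3 \<longleftrightarrow> \<bar>(\<Sum>k<R. (\<Sum>j\<in>?J. u k j * a j)\<^sup>2) - card {..<R}\<bar> > card {..<R} / 3" for a
  proof -
    have "(\<Sum>k<R. (\<Sum>j\<in>?J. u k j * a j)\<^sup>2) - card {..<R} = real R / n * (q a - n)"
      unfolding X using n by (simp add: field_simps)
    then have eq: "\<bar>(\<Sum>k<R. (\<Sum>j\<in>?J. u k j * a j)\<^sup>2) - card {..<R}\<bar> = real R / n * \<bar>q a - n\<bar>"
      using n by (simp add: abs_mult)
    show ?thesis unfolding eq using n R by (simp add: field_simps)
  qed
  then have "real (card {a \<in> signs ?J. \<bar>q a - n\<bar> > n / 3})
      \<le> 2 ^ card ?J * (2 * exp (- (real (card {..<R}) / 576)))"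
    using hanson_wright_signs[of "{..<R}" ?J u] on by simp
  then show ?thesis by (simp add: n_def card_cartesian_product)
qed

text \<open>The rows of a sign matrix may be dependent; their span is enlarged to dimension exactly
  \<open>R\<close>. Vectors orthogonal to the larger space remain orthogonal to all rows.\<close>

lemma extend_to_dim:
  assumes S: "finite S" "S \<subseteq> Rspace m" "card S \<le> R" and R: "R \<le> m"
  shows "\<exists>E. E \<in> Grassmannian m R \<and> S \<subseteq> E"
proof -
  let ?e = "\<lambda>i. Poly_Mapping.single i (1 :: real)"
  have inj: "inj_on ?e {..<m}"
    by (rule inj_onI) (metis lookup_single_eq lookup_single_not_eq zero_neq_one)
  have ind: "independent (?e ` {..<m})"
  proof (rule independent_if_scalars_zero)
    fix f x assume sum: "(\<Sum>x\<in>?e ` {..<m}. f x *\<^sub>R x) = 0" and "x \<in> ?e ` {..<m}"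
    then obtain i where i: "i < m" "x = ?e i" by blast
    have "0 = coord (\<Sum>j<m. f (?e j) *\<^sub>R ?e j) i"
      using sum unfolding sum.reindex[OF inj] by simp
    also have "\<dots> = (\<Sum>j<m. if j = i then f (?e j) else 0)"
      unfolding lookup_sum by (intro sum.cong refl) (simp add: lookup_single when_def)
    finally show "f x = 0" using i by simp
  qed simp
  obtain B where B: "B \<subseteq> S" "independent B" "S \<subseteq> span B" using maximal_independent_subset by blast
  obtain B' where B': "B \<subseteq> B'" "B' \<subseteq> Rspace m" "independent B'" "Rspace m \<subseteq> span B'"
    using maximal_independent_subset_extend[OF order_trans[OF B(1) S(2)] B(2)] by blast
  obtain T :: "rvec set" where T: "finite T" "Rspace m \<subseteq> span T" using Rspace_finite_span by blast
  have fin: "finite B'" using independent_span_bound[OF T(1) B'(3)] B'(2) T(2) by blast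
  have "?e ` {..<m} \<subseteq> Rspace m" by (auto simp: Rspace_def)
  then have "card (?e ` {..<m}) \<le> card B'"
    using independent_span_bound[OF fin ind] B'(4) by blast
  then have "R \<le> card B'" using R by (simp add: card_image[OF inj])
  moreover have "card B \<le> R" using card_mono[OF S(1) B(1)] S(3) by simp
  ultimately obtain C where C: "B \<subseteq> C" "C \<subseteq> B'" "card C = R"
    using exists_subset_between[OF _ _ B'(1) fin] by blast
  have "dim (span C) = R"
    using C dim_span_eq_card_independent[OF independent_mono[OF B'(3) C(2)]] by simp
  moreover have "span C \<subseteq> Rspace m"
    using C(2) B'(2) by (intro span_minimal subspace_Rspace) auto
  moreover have "S \<subseteq> span C" using B(3) span_mono[OF C(1)] by blast
  ultimately show ?thesis by (intro exI[of _ "span C"]) (auto simp: Grassmannian_def)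
qed

lemma generic_section_exists:
  fixes m r R :: nat
  assumes r: "0 < r" "real r < 1 / 1152 * real m"
    and R: "0 < R" "R \<le> m" "real R \<ge> 100000 * real r * ln (real m / real r)"
  shows "\<exists>E \<in> Grassmannian m R. generic_section m r E"
proof -
  let ?J = "{..<R} \<times> {..<m}"
  define Q where "Q a i j = (\<Sum>k<R. a (k, i) * a (k, j)) / real R" for a :: "nat \<times> nat \<Rightarrow> real" and i j
  define bad where "bad w = {a \<in> signs ?J. \<bar>bform m (Q a) (\<lambda>i. real_of_int (w i)) (\<lambda>i. real_of_int (w i))
      - (\<Sum>i<m. (real_of_int (w i))\<^sup>2)\<bar> > (\<Sum>i<m. (real_of_int (w i))\<^sup>2) / 3}" for w :: "nat \<Rightarrow> int"
  let ?N = "integer_vectors m (10 * r)"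
  have bad: "real (card (bad w)) \<le> 2 ^ (R * m) * (2 * exp (- (real R / 576)))" for w
    unfolding bad_def Q_def by (rule sign_matrix_deviation[OF R(1)])
  have "real (card (\<Union>w\<in>?N. bad w)) \<le> real (\<Sum>w\<in>?N. card (bad w))"
    using card_UN_le[OF finite_integer_vectors] of_nat_le_iff by blast
  also have "\<dots> = (\<Sum>w\<in>?N. real (card (bad w)))" by simp
  also have "\<dots> \<le> (\<Sum>w\<in>?N. 2 ^ (R * m) * (2 * exp (- (real R / 576))))"
    by (intro sum_mono bad)
  also have "\<dots> = 2 ^ (R * m) * (real (card ?N) * (2 * exp (- (real R / 576))))" by simp
  also have "\<dots> \<le> 2 ^ (R * m) * exp (- (1 / 1152) * real R)"
    using net_bound(4)[OF r R(3)] by (intro mult_left_mono) simp_all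
  also have "\<dots> < 2 ^ (R * m) * 1"
    using R(1) by (intro mult_strict_left_mono) simp_all
  also have "\<dots> = real (card (signs ?J))" by (simp add: card_signs card_cartesian_product)
  finally have "card (\<Union>w\<in>?N. bad w) < card (signs ?J)" by simp
  then have "\<not> signs ?J \<subseteq> (\<Union>w\<in>?N. bad w)"
    using card_mono[of "\<Union>w\<in>?N. bad w" "signs ?J"] by (auto simp: bad_def not_le)
  then obtain a where a: "a \<in> signs ?J" "\<And>w. w \<in> ?N \<Longrightarrow> a \<notin> bad w" by blast
  define row where "row k = rvec_of m (\<lambda>i. a (k, i))" for k
  have "card (row ` {..<R}) \<le> R" using card_image_le[of "{..<R}" row] by simp
  moreover have "row ` {..<R} \<subseteq> Rspace m" by (auto simp: row_def)
  ultimately obtain E where E: "E \<in> Grassmannian m R" "row ` {..<R} \<subseteq> E"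
    using extend_to_dim[of "row ` {..<R}" m R] R(2) by blast
  have "generic_section m r E"
  proof (rule near_isometry_imp_generic_section[OF _ _ r(1), where Q = "Q a"])
    show "subspace E" "E \<subseteq> Rspace m" using E(1) by (auto simp: Grassmannian_def)
    fix w assume "w \<in> ?N"
    then show "\<bar>bform m (Q a) (\<lambda>i. real_of_int (w i)) (\<lambda>i. real_of_int (w i)) - (\<Sum>i<m. (real_of_int (w i))\<^sup>2)\<bar>
        \<le> (\<Sum>i<m. (real_of_int (w i))\<^sup>2) / 3"
      using a(2)[of w] a(1) by (simp add: bad_def not_less)
  next
    fix z assume z: "z \<in> Rspace m" "\<And>x. x \<in> E \<Longrightarrow> dotp z x = 0"
    \<comment> \<open>The form is the mean of the squared inner products with the rows, and all of
      these vanish for \<open>z\<close> orthogonal to \<open>E\<close>.\<close>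
    have "(\<Sum>j<m. coord z j * a (k, j)) = 0" if "k < R" for k
    proof -
      have "row k \<in> E" using E(2) that by blast
      from z(2)[OF this] show ?thesis by (simp add: dotp_Rspace[OF z(1)] row_def coord_rvec_of)
    qed
    then have "0 = (\<Sum>k<R. (\<Sum>i<m. coord z i * a (k, i)) * (\<Sum>j<m. coord z j * a (k, j))) / real R"
      by simp
    also have "\<dots> = (\<Sum>i<m. \<Sum>j<m. (\<Sum>k<R. a (k, i) * a (k, j) * coord z i * coord z j)) / real R"
      unfolding sum_product by (subst sum.swap, subst (2) sum.swap) (simp add: mult_ac)
    also have "\<dots> = bform m (Q a) (coord z) (coord z)"
      by (simp add: bform_def Q_def sum_divide_distrib sum_distrib_right)
    finally show "bform m (Q a) (coord z) (coord z) = 0" by simp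
  qed
  then show ?thesis using E(1) by blast
qed

subsection \<open>The Haar measure\<close>

text \<open>For \<open>x = y\<close> the coefficient is \<open>0/0 = 0\<close>, so that the reflection is the identity.\<close>

definition reflection :: "rvec \<Rightarrow> rvec \<Rightarrow> rvec \<Rightarrow> rvec" where
  "reflection x y v = v - (2 * dotp v (x - y) / dotp (x - y) (x - y)) *\<^sub>R (x - y)"

lemma linear_reflection: "linear (reflection x y)"
  by (rule linearI)
    (simp_all add: reflection_def dotp_add_left dotp_scale_left algebra_simps add_divide_distrib)

lemma dotp_reflection: "dotp (reflection x y a) (reflection x y b) = dotp a b"
proof (cases "x = y")
  case False
  define w where "w = x - y"
  have w: "dotp w w \<noteq> 0" using False by (simp add: w_def dotp_self_eq_0)
  define s where "s = 2 * dotp a w / dotp w w"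
  define t where "t = 2 * dotp b w / dotp w w"
  have "dotp (a - s *\<^sub>R w) (b - t *\<^sub>R w) = dotp a b - t * dotp a w - s * dotp b w + s * t * dotp w w"
    by (simp add: dotp_diff_left dotp_diff_right dotp_scale_left dotp_scale_right dotp_commute[of w b]
        algebra_simps)
  also have "s * t * dotp w w = 2 * (s * dotp b w)" using w by (simp add: t_def)
  also have "t * dotp a w = s * dotp b w" by (simp add: s_def t_def)
  finally show ?thesis by (simp add: reflection_def w_def s_def t_def)
qed (simp add: reflection_def)

text \<open>For vectors of equal length, \<open>2 * dotp x (x - y)\<close> is the squared length of
  \<open>x - y\<close>, so the coefficient is 1. Thus reflections alone carry any vector of a sphere
  to any other, and invariance under them is all that is used of the Haar measure.\<close>

lemma reflection_swap:
  assumes "dotp x x = dotp y y"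
  shows "reflection x y x = y"
proof (cases "x = y")
  case False
  then have "dotp (x - y) (x - y) \<noteq> 0" by (simp add: dotp_self_eq_0)
  moreover have "2 * dotp x (x - y) = dotp (x - y) (x - y)"
    using assms by (simp add: dotp_diff_left dotp_diff_right dotp_commute)
  ultimately show ?thesis by (simp add: reflection_def)
qed (simp add: reflection_def)

lemma reflection_involution: "reflection x y (reflection x y v) = v"
proof (cases "x = y")
  case False
  let ?w = "x - y"
  have w: "dotp ?w ?w \<noteq> 0" using False by (simp add: dotp_self_eq_0)
  have "dotp (reflection x y v) ?w = dotp v ?w - (2 * dotp v ?w / dotp ?w ?w) * dotp ?w ?w"
    unfolding reflection_def by (simp only: dotp_diff_left[of v] dotp_scale_left)
  then have "dotp (reflection x y v) ?w = - dotp v ?w" using w by simp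
  then have "reflection x y (reflection x y v) = reflection x y v + (2 * dotp v ?w / dotp ?w ?w) *\<^sub>R ?w"
    by (simp add: reflection_def[of x y "reflection x y v"])
  then show ?thesis by (simp add: reflection_def)
qed (simp add: reflection_def)

lemma reflection_Rspace: "x \<in> Rspace m \<Longrightarrow> y \<in> Rspace m \<Longrightarrow> v \<in> Rspace m \<Longrightarrow> reflection x y v \<in> Rspace m"
  unfolding reflection_def
  by (intro subspace_diff[OF subspace_Rspace] subspace_scale[OF subspace_Rspace])

lemma orthogonal_on_reflection:
  "x \<in> Rspace m \<Longrightarrow> y \<in> Rspace m \<Longrightarrow> orthogonal_on m (reflection x y)"
  by (auto simp: orthogonal_on_def linear_reflection dotp_reflection reflection_Rspace)

context
  fixes m :: nat and U :: "rvec \<Rightarrow> rvec" and E :: "rvec set"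
  assumes U: "linear U" "\<And>a b. dotp (U a) (U b) = dotp a b"
    and U_Rspace: "\<And>v. v \<in> Rspace m \<Longrightarrow> U v \<in> Rspace m"
    and E: "subspace E" "E \<subseteq> Rspace m"
begin

lemma orthonormal_basis_image:
  assumes "orthonormal_basis E R u"
  shows "orthonormal_basis (U ` E) R (\<lambda>k. U (u k))"
  using assms linear_span_image[OF U(1), of "u ` {..<R}"]
  by (auto simp: orthonormal_basis_def U(2) image_image)

lemma isometry_image_subspace: "subspace (U ` E)" "U ` E \<subseteq> Rspace m"
  using linear_subspace_image[OF U(1) E(1)] E(2) U_Rspace by auto

text \<open>For reflections the reverse inequality follows by applying this one to the image, since
  they are involutions.\<close>

lemma dim_isometry_image_le: "dim (U ` E) \<le> dim E"
proof -
  obtain u where u: "orthonormal_basis E (dim E) u" using orthonormal_basis_exists[OF E] by blast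
  have "dim (U ` E) \<le> card ((\<lambda>k. U (u k)) ` {..<dim E})"
    using orthonormal_basis_image[OF u] by (intro dim_le_card) (auto simp: orthonormal_basis_def)
  also have "\<dots> \<le> dim E" using card_image_le[of "{..<dim E}" "\<lambda>k. U (u k)"] by simp
  finally show ?thesis .
qed

lemma orth_proj_isometry_image: "orth_proj (U ` E) (U x) = U (orth_proj E x)"
proof -
  obtain u where u: "orthonormal_basis E (dim E) u" using orthonormal_basis_exists[OF E] by blast
  show ?thesis
    unfolding orth_proj_eq[OF E(2) u] orth_proj_eq[OF isometry_image_subspace(2) orthonormal_basis_image[OF u]]
    by (simp add: U(2) linear_sum[OF U(1)] linear_scale[OF U(1)])
qed

end

text \<open>The inner product is the squared length of the projection of \<open>x\<close>. Its mean
  over a rotation-invariant subspace is \<open>R/m\<close> times the squared length of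
  \<open>x\<close>, hence the factor \<open>m/R\<close>.\<close>

definition deviates :: "nat \<Rightarrow> nat \<Rightarrow> rvec \<Rightarrow> rvec set \<Rightarrow> bool" where
  "deviates m R x E \<longleftrightarrow> \<bar>real m / real R * dotp x (orth_proj E x) - dotp x x\<bar> > dotp x x / 3"

lemma dotp_orth_proj_matrix:
  assumes E: "E \<in> Grassmannian m R" and x: "x \<in> Rspace m"
  shows "dotp x (orth_proj E x) = bform m (proj_matrix E) (coord x) (coord x)"
proof -
  have E': "subspace E" "E \<subseteq> Rspace m" using E by (auto simp: Grassmannian_def)
  obtain u where u: "orthonormal_basis E (dim E) u" using orthonormal_basis_exists[OF E'] by blast
  show ?thesis
    by (simp add: dotp_Rspace[OF x] coord_orth_proj[OF E'(2) u x] bform_def sum_distrib_left mult_ac)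
qed

lemma openin_deviates:
  assumes x: "x \<in> Rspace m"
  shows "openin (Grassmannian_topology m R) {E \<in> Grassmannian m R. deviates m R x E}"
proof -
  let ?V = "{M. \<bar>real m / real R * bform m M (coord x) (coord x) - dotp x x\<bar> > dotp x x / 3}"
  have "continuous_on UNIV (\<lambda>M :: nat \<Rightarrow> nat \<Rightarrow> real. M i j)" for i j
    by (rule continuous_on_product_then_coordinatewise[OF continuous_on_product_coordinates])
  then have "open ?V"
    unfolding bform_def by (intro open_Collect_less continuous_intros)
  moreover have "{E \<in> Grassmannian m R. deviates m R x E} = proj_matrix -` ?V \<inter> Grassmannian m R"
    using dotp_orth_proj_matrix[OF _ x] by (auto simp: deviates_def)
  ultimately show ?thesis
    unfolding Grassmannian_topology_def openin_pullback_topology by auto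
qed

lemma deviates_image:
  assumes E: "E \<in> Grassmannian m R" and xy: "x \<in> Rspace m" "y \<in> Rspace m" "dotp x x = dotp y y"
  shows "reflection x y ` E \<in> Grassmannian m R"
    and "deviates m R y (reflection x y ` E) \<longleftrightarrow> deviates m R x E"
proof -
  let ?U = "reflection x y"
  have E': "subspace E" "E \<subseteq> Rspace m" "dim E = R" using E by (auto simp: Grassmannian_def)
  note U = linear_reflection dotp_reflection reflection_Rspace[OF xy(1,2)]
  have UE: "subspace (?U ` E)" "?U ` E \<subseteq> Rspace m"
    using isometry_image_subspace[OF U E'(1,2)] by blast+
  have "dim (?U ` E) \<le> R" using dim_isometry_image_le[OF U E'(1,2)] E'(3) by simp
  moreover have "?U ` ?U ` E = E" by (simp add: image_image reflection_involution)
  then have "R \<le> dim (?U ` E)" using dim_isometry_image_le[OF U UE] E'(3) by simp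
  ultimately show "?U ` E \<in> Grassmannian m R" using UE by (simp add: Grassmannian_def)
  have "dotp y (orth_proj (?U ` E) y) = dotp (?U x) (?U (orth_proj E x))"
    using orth_proj_isometry_image[OF U E'(1,2), of x] reflection_swap[OF xy(3)] by simp
  then show "deviates m R y (?U ` E) \<longleftrightarrow> deviates m R x E"
    by (simp add: deviates_def dotp_reflection xy(3))
qed

context
  fixes m R :: nat and \<mu> :: "rvec set measure"
  assumes haar: "Grassmannian_Haar m R \<mu>"
begin

lemma haar_prob_space: "prob_space \<mu>"
  and haar_space: "space \<mu> = Grassmannian m R"
  using haar by (auto simp: Grassmannian_Haar_def)

lemma haar_openin: "openin (Grassmannian_topology m R) A \<Longrightarrow> A \<in> sets \<mu>"
  using haar by (auto simp: Grassmannian_Haar_def intro: sigma_sets.Basic)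

text \<open>The reflection exchanging \<open>x\<close> and \<open>y\<close> maps the event for
  \<open>x\<close> onto the event for \<open>y\<close>; surjectivity uses that it is an
  involution.\<close>

lemma haar_deviates_eq:
  assumes xy: "x \<in> Rspace m" "y \<in> Rspace m" "dotp x x = dotp y y"
  shows "measure \<mu> {E \<in> Grassmannian m R. deviates m R y E} = measure \<mu> {E \<in> Grassmannian m R. deviates m R x E}"
proof -
  let ?U = "reflection x y" and ?A = "\<lambda>x. {E \<in> Grassmannian m R. deviates m R x E}"
  have "?A y = (\<lambda>E. ?U ` E) ` ?A x"
  proof (intro equalityI subsetI)
    fix E assume E: "E \<in> ?A y"
    have UU: "?U ` ?U ` E = E" by (simp add: image_image reflection_involution)
    have G: "?U ` E \<in> Grassmannian m R"
      using deviates_image(1)[OF _ xy] E by blast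
    then have "deviates m R x (?U ` E)"
      using deviates_image(2)[OF G xy] UU E by simp
    then show "E \<in> (\<lambda>E. ?U ` E) ` ?A x"
      using G UU by (intro image_eqI[of _ _ "?U ` E"]) auto
  qed (use deviates_image[OF _ xy] in auto)
  moreover have "?A x \<in> sets \<mu>" by (rule haar_openin[OF openin_deviates[OF xy(1)]])
  ultimately have "emeasure \<mu> (?A y) = emeasure \<mu> (?A x)"
    using haar orthogonal_on_reflection[OF xy(1,2)] by (simp add: Grassmannian_Haar_def)
  then show ?thesis by (simp add: measure_def)
qed

text \<open>
  By invariance, the probability is the same for all vectors of the same length, so it may be
  averaged over the sign vectors; for each fixed subspace the average is controlled by the
  Hanson--Wright inequality.
\<close>

lemma haar_deviates_le:
  assumes R: "0 < R" and m: "0 < m" and x: "x \<in> Rspace m"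
  shows "measure \<mu> {E \<in> Grassmannian m R. deviates m R x E} \<le> 2 * exp (- (real R / 576))"
proof (cases "x = 0")
  case True
  have "\<not> deviates m R 0 E" for E by (simp add: deviates_def dotp_zero_left)
  then show ?thesis using True by simp
next
  case False
  interpret prob_space \<mu> by (rule haar_prob_space)
  let ?S = "signs {..<m}" and ?A = "\<lambda>x. {E \<in> Grassmannian m R. deviates m R x E}"
  \<comment> \<open>All sign vectors scaled by \<open>c\<close> have the same length as
    \<open>x\<close>.\<close>
  define c where "c = sqrt (dotp x x / real m)"
  define y where "y \<epsilon> = rvec_of m (\<lambda>i. c * \<epsilon> i)" for \<epsilon>
  have c: "c > 0" "c\<^sup>2 * real m = dotp x x" using dotp_self_pos[OF False] m by (auto simp: c_def)
  have y: "y \<epsilon> \<in> Rspace m" for \<epsilon> by (simp add: y_def)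
  have yy: "dotp (y \<epsilon>) (y \<epsilon>) = dotp x x" if "\<epsilon> \<in> ?S" for \<epsilon>
  proof -
    have "dotp (y \<epsilon>) (y \<epsilon>) = (\<Sum>i<m. c\<^sup>2 * (\<epsilon> i * \<epsilon> i))"
      by (simp add: dotp_Rspace[of _ m] y_def coord_rvec_of power2_eq_square mult_ac)
    also have "\<dots> = (\<Sum>i<m. c\<^sup>2)" using signs_square[OF that] by simp
    finally show ?thesis using c(2) by (simp add: mult.commute)
  qed
  have A: "?A (y \<epsilon>) \<in> events" for \<epsilon> by (rule haar_openin[OF openin_deviates[OF y]])
  have int: "integrable \<mu> (indicat_real (?A (y \<epsilon>)))" for \<epsilon>
    by (rule integrable_real_indicator[OF A]) (simp add: less_top[symmetric])
  \<comment> \<open>Here the subspace is fixed and only the signs vary: an orthonormal basis of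
    \<open>E\<close> supplies the vectors for \<open>hanson_wright_signs\<close>.\<close>
  have count: "(\<Sum>\<epsilon>\<in>?S. indicator (?A (y \<epsilon>)) E) \<le> 2 ^ m * (2 * exp (- (real R / 576)))"
    if E: "E \<in> space \<mu>" for E
  proof -
    have E': "E \<in> Grassmannian m R" using E haar_space by simp
    then have sub: "subspace E" "E \<subseteq> Rspace m" "dim E = R" by (auto simp: Grassmannian_def)
    obtain u where u: "orthonormal_basis E R u" using orthonormal_basis_exists[OF sub(1,2)] sub(3) by blast
    have uR: "u k \<in> Rspace m" if "k < R" for k using basis_in[OF sub(2) u that] sub(2) by blast
    have on: "(\<Sum>j<m. coord (u k) j * coord (u l) j) = (if k = l then 1 else 0)" if "k \<in> {..<R}" "l \<in> {..<R}" for k l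
      using basis_dotp[OF sub(2) u, of k l] that dotp_Rspace[OF uR, of k "u l"] by simp
    have dev: "deviates m R (y \<epsilon>) E \<longleftrightarrow>
        \<bar>(\<Sum>k<R. (\<Sum>j<m. coord (u k) j * \<epsilon> j)\<^sup>2) - card {..<R}\<bar> > card {..<R} / 3" if "\<epsilon> \<in> ?S" for \<epsilon>
    proof -
      let ?X = "\<Sum>k<R. (\<Sum>j<m. coord (u k) j * \<epsilon> j)\<^sup>2"
      have yu: "dotp (y \<epsilon>) (u k) = c * (\<Sum>j<m. coord (u k) j * \<epsilon> j)" for k
        by (simp add: dotp_Rspace[of _ m] y_def coord_rvec_of sum_distrib_left mult_ac)
      have "dotp (y \<epsilon>) (orth_proj E (y \<epsilon>)) = c\<^sup>2 * ?X"
        unfolding sum_dotp_basis_square[OF sub(2) u, symmetric] yu power_mult_distrib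
        by (rule sum_distrib_left[symmetric])
      then have "real m / real R * dotp (y \<epsilon>) (orth_proj E (y \<epsilon>)) - dotp (y \<epsilon>) (y \<epsilon>)
          = dotp x x / real R * (?X - real R)"
        unfolding yy[OF that] using R by (simp add: c(2)[symmetric] field_simps)
      then have "\<bar>real m / real R * dotp (y \<epsilon>) (orth_proj E (y \<epsilon>)) - dotp (y \<epsilon>) (y \<epsilon>)\<bar>
          = dotp x x / real R * \<bar>?X - real R\<bar>"
        using dotp_self_nonneg[of x] by (simp add: abs_mult)
      then show ?thesis
        unfolding deviates_def yy[OF that] using dotp_self_pos[OF False] R by (simp add: field_simps)
    qed
    have "(\<Sum>\<epsilon>\<in>?S. indicator (?A (y \<epsilon>)) E) = (\<Sum>\<epsilon>\<in>?S. if deviates m R (y \<epsilon>) E then 1 else 0 :: real)"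
      using E' by (intro sum.cong refl) (simp add: indicator_def)
    also have "\<dots> = real (card {\<epsilon> \<in> ?S. deviates m R (y \<epsilon>) E})"
      by (simp add: sum.inter_filter[symmetric])
    also have "{\<epsilon> \<in> ?S. deviates m R (y \<epsilon>) E}
        = {\<epsilon> \<in> ?S. \<bar>(\<Sum>k<R. (\<Sum>j<m. coord (u k) j * \<epsilon> j)\<^sup>2) - card {..<R}\<bar> > card {..<R} / 3}"
      using dev by blast
    also have "real (card \<dots>) \<le> 2 ^ card {..<m} * (2 * exp (- (real (card {..<R}) / 576)))"
      by (rule hanson_wright_signs) (use on in auto)
    finally show ?thesis by simp
  qed
  have "2 ^ m * prob (?A x) = (\<Sum>\<epsilon>\<in>?S. prob (?A x))" by (simp add: card_signs)
  also have "\<dots> = (\<Sum>\<epsilon>\<in>?S. prob (?A (y \<epsilon>)))"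
    by (intro sum.cong refl haar_deviates_eq[symmetric] x y) (simp add: yy)
  also have "\<dots> = (\<Sum>\<epsilon>\<in>?S. \<integral>E. indicator (?A (y \<epsilon>)) E \<partial>\<mu>)"
    using A by (simp add: Int_absorb2 sets.sets_into_space)
  also have "\<dots> = (\<integral>E. (\<Sum>\<epsilon>\<in>?S. indicator (?A (y \<epsilon>)) E) \<partial>\<mu>)"
    by (intro Bochner_Integration.integral_sum[symmetric] int)
  also have "\<dots> \<le> 2 ^ m * (2 * exp (- (real R / 576)))"
    using count by (intro integral_le_const Bochner_Integration.integrable_sum int AE_I2)
  finally show ?thesis by simp
qed

lemma haar_generic_section_ge:
  assumes r: "0 < r" "real r < 1 / 1152 * real m"
    and R: "0 < R" "real R \<ge> 100000 * real r * ln (real m / real r)"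
  shows "measure \<mu> {E \<in> Grassmannian m R. generic_section m r E} \<ge> 1 - exp (- (1 / 1152) * real R)"
proof -
  interpret prob_space \<mu> by (rule haar_prob_space)
  let ?N = "integer_vectors m (10 * r)" and ?A = "\<lambda>x. {E \<in> Grassmannian m R. deviates m R x E}"
  let ?x = "\<lambda>w :: nat \<Rightarrow> int. rvec_of m (\<lambda>i. real_of_int (w i))"
  let ?good = "{E \<in> Grassmannian m R. generic_section m r E}"
  have m: "0 < m" using r by (cases m) auto
  have A: "?A (?x w) \<in> events" for w by (rule haar_openin[OF openin_deviates]) simp
  have good: "?good \<in> events" by (rule haar_openin[OF openin_generic_sections[OF net_bound(2)[OF r R(2)]]])
  \<comment> \<open>Off the bad events, \<open>m/R\<close> times the projection matrix approximates
    the squared norm on the integer vectors, and its form vanishes on vectors orthogonal to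
    \<open>E\<close>.\<close>
  have sub: "space \<mu> - (\<Union>w\<in>?N. ?A (?x w)) \<subseteq> ?good"
  proof
    fix E assume E: "E \<in> space \<mu> - (\<Union>w\<in>?N. ?A (?x w))"
    then have EG: "E \<in> Grassmannian m R" by (simp add: haar_space)
    then have E': "subspace E" "E \<subseteq> Rspace m" by (auto simp: Grassmannian_def)
    obtain u where u: "orthonormal_basis E (dim E) u" using orthonormal_basis_exists[OF E'] by blast
    let ?Q = "\<lambda>i j. real m / real R * proj_matrix E i j"
    have Q: "bform m ?Q (coord z) (coord z) = real m / real R * dotp z (orth_proj E z)" if "z \<in> Rspace m" for z
      unfolding dotp_orth_proj_matrix[OF EG that] by (simp add: bform_def sum_distrib_left mult_ac)
    have "generic_section m r E"
    proof (rule near_isometry_imp_generic_section[OF E' r(1), where Q = ?Q])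
      fix w assume "w \<in> ?N"
      then have nd: "\<not> deviates m R (?x w) E" using E EG by auto
      have eq: "coord (?x w) i = real_of_int (w i)" if "i < m" for i using that by (simp add: coord_rvec_of)
      have "bform m ?Q (\<lambda>i. real_of_int (w i)) (\<lambda>i. real_of_int (w i)) = bform m ?Q (coord (?x w)) (coord (?x w))"
        by (rule bform_cong) (simp_all add: eq)
      then have "bform m ?Q (\<lambda>i. real_of_int (w i)) (\<lambda>i. real_of_int (w i))
          = real m / real R * dotp (?x w) (orth_proj E (?x w))"
        using Q[of "?x w"] by simp
      moreover have "dotp (?x w) (?x w) = (\<Sum>i<m. (real_of_int (w i))\<^sup>2)"
        by (simp add: dotp_Rspace[of _ m] coord_rvec_of power2_eq_square)
      ultimately show "\<bar>bform m ?Q (\<lambda>i. real_of_int (w i)) (\<lambda>i. real_of_int (w i)) - (\<Sum>i<m. (real_of_int (w i))\<^sup>2)\<bar>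
          \<le> (\<Sum>i<m. (real_of_int (w i))\<^sup>2) / 3"
        using nd by (simp add: deviates_def not_less)
    next
      fix z assume z: "z \<in> Rspace m" "\<And>x. x \<in> E \<Longrightarrow> dotp z x = 0"
      then show "bform m ?Q (coord z) (coord z) = 0"
        using Q[OF z(1)] z(2)[OF orth_proj_in[OF E'(2) u]] by simp
    qed
    then show "E \<in> ?good" using EG by blast
  qed
  have "prob (\<Union>w\<in>?N. ?A (?x w)) \<le> (\<Sum>w\<in>?N. prob (?A (?x w)))"
    using A by (intro finite_measure_subadditive_finite) auto
  also have "\<dots> \<le> (\<Sum>w\<in>?N. 2 * exp (- (real R / 576)))"
    by (intro sum_mono haar_deviates_le R m) simp
  also have "\<dots> \<le> exp (- (1 / 1152) * real R)"
    using net_bound(4)[OF r R(2)] by simp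
  finally have "1 - exp (- (1 / 1152) * real R) \<le> prob (space \<mu> - (\<Union>w\<in>?N. ?A (?x w)))"
    using A by (subst prob_compl) auto
  also have "\<dots> \<le> prob ?good" using sub good by (rule finite_measure_mono)
  finally show ?thesis .
qed

end

theorem theorem3p1:
  shows "\<exists>C>0. \<exists>c>0. \<forall>m r R :: nat.
    0 < m \<longrightarrow> 0 < r \<longrightarrow> 0 < R \<longrightarrow>
    real r < c * real m \<longrightarrow> R \<le> m \<longrightarrow>
    real R \<ge> C * real r * ln (real m / real r) \<longrightarrow>
      (\<exists>P :: rvec set. sym_polytope R m P \<and>
          card (faces P (int R - int r)) = 2 ^ r * (m choose r)) \<and>
      (\<forall>Q :: rvec set. sym_polytope R m Q \<longrightarrow>
          card (faces Q (int R - int r)) \<le> 2 ^ r * (m choose r)) \<and>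
      (\<forall>\<mu>. Grassmannian_Haar m R \<mu> \<longrightarrow>
          measure \<mu> {E \<in> space \<mu>. sym_polytope R m (E \<inter> cube m) \<and>
              card (faces (E \<inter> cube m) (int R - int r)) = 2 ^ r * (m choose r)}
            \<ge> 1 - exp (- c * real R))"
proof (rule exI[of _ "100000"], rule conjI, simp, rule exI[of _ "1 / 1152"], rule conjI, simp,
    intro allI impI conjI)
  fix m r R :: nat
  assume r: "0 < r" "real r < 1 / 1152 * real m" and R: "0 < R" "R \<le> m"
    and Rr: "real R \<ge> 100000 * real r * ln (real m / real r)"
  note rm = net_bound(2)[OF r Rr] and rR = net_bound(3)[OF r Rr]
  note gen = generic_section_iff[OF _ r(1) rm rR]
  show "\<exists>P :: rvec set. sym_polytope R m P \<and> card (faces P (int R - int r)) = 2 ^ r * (m choose r)"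
    using generic_section_exists[OF r R Rr] gen by blast
  show "card (faces Q (int R - int r)) \<le> 2 ^ r * (m choose r)" if "sym_polytope R m Q" for Q :: "rvec set"
    by (rule sym_polytope_card_faces_le[OF that R(1) rR])
  fix \<mu> assume haar: "Grassmannian_Haar m R \<mu>"
  \<comment> \<open>Identifies the event of the statement with an open, hence measurable, set of
    subspaces; \<open>measure\<close> would be 0 on a non-measurable set.\<close>
  have "{E \<in> space \<mu>. sym_polytope R m (E \<inter> cube m) \<and>
      card (faces (E \<inter> cube m) (int R - int r)) = 2 ^ r * (m choose r)}
      = {E \<in> Grassmannian m R. generic_section m r E}"
    unfolding haar_space[OF haar] using gen by blast
  then show "measure \<mu> {E \<in> space \<mu>. sym_polytope R m (E \<inter> cube m) \<and>
      card (faces (E \<inter> cube m) (int R - int r)) = 2 ^ r * (m choose r)} \<ge> 1 - exp (- (1 / 1152) * real R)"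
    using haar_generic_section_ge[OF haar r R(1) Rr] by simp
qed

end
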